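(* Let $R=\mathcal{O}_{\mathbb{Q}(\sqrt{-7})}$ and $\omega=\frac12+\frac{\sqrt{-7}}{2}$. Every maximal connected cyclotomic $\mathcal{L}$-graph over $R$ that is not equivalent to a charged signed graph is equivalent to one of the following: (i) $S_2$: two uncharged vertices with one edge $\{1,2\}$ of label $2$; or $S_2^*$: two uncharged vertices with one edge $\{1,2\}$ of label $\frac32+\frac{\sqrt{-7}}{2}$; (ii) $S_4$: charges $+1,-1,-1,+1$ on vertices $1,2,3,4$, edges $\{1,2\}$ label $\omega$, $\{3,4\}$ label $-\omega$, $\{1,3\}$ label $1$, $\{2,4\}$ label $1$; (iii) $S_6^\dagger$: six uncharged vertices, edges $\{1,2\},\{3,4\},\{3,6\},\{5,6\}$ of label $1$, $\{1,4\},\{2,5\}$ of label $-1$, $\{2,3\}$ label $\omega$, $\{1,6\}$ label $\bar\omega$, $\{4,5\}$ label $-\omega$; (iv) $S_8^*$: eight uncharged vertices, edges $\{1,2\},\{1,5\},\{2,6\},\{3,4\},\{3,7\},\{4,8\}$ of label $1$, edges $\{5,6\},\{7,8\}$ of label $-1$, and $\{1,4\}$ label $\omega$, $\{2,3\}$ label $-\omega$, $\{5,8\}$ label $-\omega$, $\{6,7\}$ label $\omega$; (v) for some $k\ge 2$, $T_{2k}^4$: with $L=k-1$, uncharged vertices $1,\dots,2k$, edges for each $1\le i\le L-1$: $\{i,i+1\}$ label $1$, $\{L+i,L+i+1\}$ label $-1$, $\{i,L+i+1\}$ label $1$, $\{i+1,L+i\}$ label $-1$; together with $\{1,2L+1\}$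 label $\omega$, $\{L+1,2L+1\}$ label $\omega$, $\{L,2L+2\}$ label $\omega$, $\{2L,2L+2\}$ label $-\omega$; (vi) for some $k\ge2$, $T_{2k}^{4'}$: the same as $T_{2k}^4$ except that $\{L,2L+2\}$ has label $\bar\omega$ and $\{2L,2L+2\}$ has label $-\bar\omega$; (vii) for some $k\ge1$, $C_{2k}^{2+}$: vertices $1,\dots,2k+1$, vertices $1$ and $k+1$ of charge $+1$, all others uncharged, edges $\{1,k+1\}$ label $1$, for each $1\le i\le k-1$: $\{i,i+1\}$ label $1$, $\{k+i,k+i+1\}$ label $-1$, $\{i,k+i+1\}$ label $1$, $\{i+1,k+i\}$ label $-1$; together with $\{k,2k+1\}$ label $\omega$ and $\{2k,2k+1\}$ label $-\omega$.
   Context: Let $d<0$ be squarefree, $R=\mathcal{O}_{\mathbb{Q}(\sqrt{d})}$, and for $n\ge1$ let $\mathcal{L}_n=\{x\in R: x\bar x=n\}$, $\mathcal{L}=\{0\}\cup\mathcal{L}_1\cup\mathcal{L}_2\cup\mathcal{L}_3\cup\mathcal{L}_4$. A (charged) $\mathcal{L}$-graph on $n$ vertices is identified with an $n\times n$ Hermitian matrix $A$ whose diagonal entries (charges) lie in $\{0,1,-1\}$ and whose off-diagonal entries lie in $\mathcal{L}$; a vertex is charged if its diagonal entry is nonzero. An edge $\{i,j\}$ with $i<j$ and label $x$ means $A_{ij}=x$, $A_{ji}=\bar x$; unlisted off-diagonal entries are $0$; the weight of an edge is $x\bar x$. The graph is cyclotomic if all eigenvalues of $A$ lie in $[-2,2]$,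 connected if $A$ is not permutation-similar to a block diagonal matrix with more than one block. $H$ is contained in $G$ if the matrix of $H$ is obtained from that of $G$ by deleting some rows and the corresponding columns. A connected cyclotomic $\mathcal{L}$-graph is maximal if it is not contained in a strictly larger connected cyclotomic $\mathcal{L}$-graph. Matrices $A,A'$ are equivalent if $A'=DPXP^{T}D$ for some $X\in\{A,-A,\bar A,-\bar A\}$, permutation matrix $P$ and diagonal matrix $D$ with diagonal entries $\pm1$. A charged signed graph is an $\mathcal{L}$-graph all of whose entries lie in $\{0,1,-1\}$. *)

theory Defs
  imports
    "HOL-Combinatorics.Permutations"
    "HOL-Computational_Algebra.Polynomial"
    "Jordan_Normal_Form.Char_Poly"
    "Jordan_Normal_Form.Schur_Decomposition"
    "Jordan_Normal_Form.DL_Submatrix"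
begin

definition quadratic_field :: "int \<Rightarrow> complex set" where
  "quadratic_field d = {of_rat a + of_rat b * csqrt (of_int d) | a b. True}"

definition quadratic_integers :: "int \<Rightarrow> complex set" where
  "quadratic_integers d = {x \<in> quadratic_field d. algebraic_int x}"

definition norm_labels :: "int \<Rightarrow> nat \<Rightarrow> complex set" where
  "norm_labels d n = {x \<in> quadratic_integers d. x * cnj x = of_nat n}"

definition label_set :: "int \<Rightarrow> complex set" where
  "label_set d = {0} \<union> norm_labels d 1 \<union> norm_labels d 2 \<union> norm_labels d 3 \<union> norm_labels d 4"

definition L_graph :: "int \<Rightarrow> complex mat \<Rightarrow> bool" where
  "L_graph d A \<longleftrightarrow> square_mat A \<and> mat_adjoint A = A \<and>
     (\<forall>i < dim_row A. A $$ (i, i) \<in> {0, 1, -1}) \<and>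
     (\<forall>i < dim_row A. \<forall>j < dim_row A. i \<noteq> j \<longrightarrow> A $$ (i, j) \<in> label_set d)"

definition charged_signed_graph :: "int \<Rightarrow> complex mat \<Rightarrow> bool" where
  "charged_signed_graph d A \<longleftrightarrow> L_graph d A \<and> elements_mat A \<subseteq> {0, 1, -1}"

definition cyclotomic :: "complex mat \<Rightarrow> bool" where
  "cyclotomic A \<longleftrightarrow> (\<forall>x. eigenvalue A x \<longrightarrow> x \<in> complex_of_real ` {-2..2})"

definition permutation_matrix :: "nat \<Rightarrow> complex mat \<Rightarrow> bool" where
  "permutation_matrix n P \<longleftrightarrow>
     (\<exists>p. p permutes {..<n} \<and> P = mat n n (\<lambda>(i, j). if j = p i then 1 else 0))"

definition connected_mat :: "complex mat \<Rightarrow> bool" where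
  "connected_mat A \<longleftrightarrow>
     \<not> (\<exists>P Bs. permutation_matrix (dim_row A) P \<and> length Bs > 1 \<and>
          (\<forall>B \<in> set Bs. square_mat B \<and> dim_row B > 0) \<and>
          P * A * transpose_mat P = diag_block_mat Bs)"

definition contained_in :: "complex mat \<Rightarrow> complex mat \<Rightarrow> bool" where
  "contained_in H G \<longleftrightarrow> (\<exists>I \<subseteq> {..<dim_row G}. H = submatrix G I I)"

definition maximal_cyclotomic :: "int \<Rightarrow> complex mat \<Rightarrow> bool" where
  "maximal_cyclotomic d A \<longleftrightarrow>
     L_graph d A \<and> connected_mat A \<and> cyclotomic A \<and>
     \<not> (\<exists>G. L_graph d G \<and> connected_mat G \<and> cyclotomic G \<and>
          dim_row G > dim_row A \<and> contained_in A G)"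

definition sign_matrix :: "nat \<Rightarrow> complex mat \<Rightarrow> bool" where
  "sign_matrix n D \<longleftrightarrow> (\<exists>s. (\<forall>i. s i \<in> {1, -1}) \<and> D = mat_diag n s)"

definition equivalent_mat :: "complex mat \<Rightarrow> complex mat \<Rightarrow> bool" where
  "equivalent_mat A A' \<longleftrightarrow>
     (\<exists>X P D. X \<in> {A, - A, map_mat cnj A, - map_mat cnj A} \<and>
        permutation_matrix (dim_row A) P \<and> sign_matrix (dim_row A) D \<and>
        A' = D * P * X * transpose_mat P * D)"

definition edge_label :: "((nat \<times> nat) \<times> complex) list \<Rightarrow> nat \<Rightarrow> nat \<Rightarrow> complex" where
  "edge_label es i j = (case map_of es (i, j) of None \<Rightarrow> 0 | Some x \<Rightarrow> x)"

text \<open>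
  Vertices are numbered from 1, matrix indices from 0. Every edge \<open>(i, j)\<close> in the list has
  \<open>i < j\<close>, and no edge is listed twice.
\<close>

definition graph_mat ::
    "nat \<Rightarrow> (nat \<Rightarrow> complex) \<Rightarrow> ((nat \<times> nat) \<times> complex) list \<Rightarrow> complex mat" where
  "graph_mat n c es = mat n n (\<lambda>(i, j).
     if i = j then c (i + 1)
     else if i < j then edge_label es (i + 1) (j + 1)
     else cnj (edge_label es (j + 1) (i + 1)))"

definition \<omega> :: complex where
  "\<omega> = 1 / 2 + csqrt (-7) / 2"

definition S2 :: "complex mat" where
  "S2 = graph_mat 2 (\<lambda>_. 0) [((1, 2), 2)]"

definition S2_star :: "complex mat" where
  "S2_star = graph_mat 2 (\<lambda>_. 0) [((1, 2), 3 / 2 + csqrt (-7) / 2)]"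

definition S4 :: "complex mat" where
  "S4 = graph_mat 4 (\<lambda>i. if i \<in> {1, 4} then 1 else -1)
     [((1, 2), \<omega>), ((3, 4), - \<omega>), ((1, 3), 1), ((2, 4), 1)]"

definition S6_dagger :: "complex mat" where
  "S6_dagger = graph_mat 6 (\<lambda>_. 0)
     [((1, 2), 1), ((3, 4), 1), ((3, 6), 1), ((5, 6), 1),
      ((1, 4), -1), ((2, 5), -1),
      ((2, 3), \<omega>), ((1, 6), cnj \<omega>), ((4, 5), - \<omega>)]"

definition S8_star :: "complex mat" where
  "S8_star = graph_mat 8 (\<lambda>_. 0)
     [((1, 2), 1), ((1, 5), 1), ((2, 6), 1), ((3, 4), 1), ((3, 7), 1), ((4, 8), 1),
      ((5, 6), -1), ((7, 8), -1),
      ((1, 4), \<omega>), ((2, 3), - \<omega>), ((5, 8), - \<omega>), ((6, 7), \<omega>)]"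

definition ladder_edges :: "nat \<Rightarrow> ((nat \<times> nat) \<times> complex) list" where
  "ladder_edges m = concat (map (\<lambda>i.
     [((i, i + 1), 1), ((m + i, m + i + 1), -1), ((i, m + i + 1), 1), ((i + 1, m + i), -1)])
     [1..<m])"

definition T4 :: "nat \<Rightarrow> complex mat" where
  "T4 k = (let L = k - 1 in graph_mat (2 * k) (\<lambda>_. 0) (ladder_edges L @
     [((1, 2 * L + 1), \<omega>), ((L + 1, 2 * L + 1), \<omega>),
      ((L, 2 * L + 2), \<omega>), ((2 * L, 2 * L + 2), - \<omega>)]))"

definition T4' :: "nat \<Rightarrow> complex mat" where
  "T4' k = (let L = k - 1 in graph_mat (2 * k) (\<lambda>_. 0) (ladder_edges L @
     [((1, 2 * L + 1), \<omega>), ((L + 1, 2 * L + 1), \<omega>),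
      ((L, 2 * L + 2), cnj \<omega>), ((2 * L, 2 * L + 2), - cnj \<omega>)]))"

definition C2_plus :: "nat \<Rightarrow> complex mat" where
  "C2_plus k = graph_mat (2 * k + 1) (\<lambda>i. if i \<in> {1, k + 1} then 1 else 0)
     ([((1, k + 1), 1)] @ ladder_edges k @
      [((k, 2 * k + 1), \<omega>), ((2 * k, 2 * k + 1), - \<omega>)])"

end

theory Submission
  imports
    Defs
    "HOL-Computational_Algebra.Polynomial_Factorial"
    "HOL-Analysis.Function_Topology"
begin

text \<open>
  For a Hermitian matrix \<open>A\<close> being cyclotomic means \<open>A\<^sup>2 \<le> 4\<close>. Hence every row has weight (sum of the
  squared absolute values of its entries) at most \<open>4\<close>, and a row of weight \<open>4\<close> is orthogonal to
  all other rows. If \<open>u\<close> has weight \<open>3\<close>, or weight \<open>2\<close> with a prime \<open>p\<close> of norm \<open>2\<close>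
  dividing all entries \<open>(A\<^sup>2)\<^sub>u\<^sub>k\<close> with \<open>k \<noteq> u\<close>, then bordering \<open>A\<close> by a suitable multiple of the column
  \<open>(4 - A\<^sup>2) e\<^sub>u\<close> gives a larger connected cyclotomic graph; so this does not happen when \<open>A\<close> is
  maximal. In particular both ends of an edge of weight \<open>2\<close> have weight \<open>4\<close>, and orthogonality of
  rows determines the graph from there. An edge of weight \<open>4\<close> is already a whole component. If no
  vertex lies on two edges of weight \<open>2\<close>, the neighbourhood of such an edge leaves only \<open>S4\<close>,
  \<open>S6_dagger\<close> and \<open>S8_star\<close>. Otherwise the graph grows from a vertex with two such edges as a
  chain of two-vertex columns, which closes up to \<open>T4\<close>, \<open>T4'\<close> or \<open>C2_plus\<close>.
\<close>

section \<open>The ring of integers and its elements of small norm\<close>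

text \<open>Maximality enters only through the locale \<open>tight\<close>. Its conditions survive
  conjugation, negation and sign switching, so labels can be normalised inside it. The size of
  \<open>\<kappa>\<close> is forced. In the Gram representations of \<open>2 + A\<close> and
  \<open>2 - A\<close> a new vertex with charge \<open>r\<close> needs squared lengths
  \<open>2 + r\<close> and \<open>2 - r\<close>, with sum 4, while the vectors built from
  \<open>\<kappa>\<close> have lengths adding up to \<open>4 |\<kappa>|\<^sup>2 (4 - w)\<close>,
  where \<open>w\<close> is the weight of \<open>u\<close>. So
  \<open>|\<kappa>|\<^sup>2 = 1 / (4 - w)\<close>: weight 3 asks for a unit, and weight 2 for the
  inverse of an element of norm 2, which is integral on the new column only under a divisibility
  condition. The units are 1 and -1, so sign switching absorbs all of them. The number 2 splits as
  \<open>\<omega> * cnj \<omega>\<close> into two primes that are not associates. A vertex can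
  therefore carry heavy edges (those of weight 2) of equal or of different primes; this is why the
  two ends of a chain can differ (\<open>T4\<close> against \<open>T4'\<close>) and why mixed pairs
  of heavy edges need an argument of their own.\<close>

lemma omega_parts [simp]: "Re \<omega> = 1 / 2" "Im \<omega> = sqrt 7 / 2"
proof -
  have "csqrt (-7) = \<i> * sqrt 7"
    using csqrt_of_real_nonpos[of "-7"] by simp
  then show "Re \<omega> = 1 / 2" "Im \<omega> = sqrt 7 / 2"
    by (simp_all add: \<omega>_def)
qed

lemma csqrt_minus_7: "csqrt (-7) = 2 * \<omega> - 1"
  by (simp add: \<omega>_def)

lemma omega_squared: "\<omega> * \<omega> = \<omega> - 2"
  by (simp add: complex_eq_iff)

lemma cnj_omega: "cnj \<omega> = 1 - \<omega>"
  by (simp add: complex_eq_iff)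

text \<open>An explicit form of the ring of integers, \<open>\<omega>\<close> being a root of
  \<open>X\<^sup>2 - X + 2\<close>. The link with the labels is made in
  \<open>label_set_iff\<close>.\<close>

definition Zomega :: "complex set" where
  "Zomega = {of_int m + of_int k * \<omega> | m k. True}"

lemma ZomegaI: "x = of_int m + of_int k * \<omega> \<Longrightarrow> x \<in> Zomega"
  by (auto simp: Zomega_def)

lemma Zomega_of_int [simp]: "of_int m \<in> Zomega"
  by (rule ZomegaI[of _ m 0]) simp

lemma Zomega_0 [simp]: "0 \<in> Zomega" and Zomega_1 [simp]: "1 \<in> Zomega"
  using Zomega_of_int[of 0] Zomega_of_int[of 1] by simp_all

lemma Zomega_omega [simp]: "\<omega> \<in> Zomega"
  by (rule ZomegaI[of _ 0 1]) simp

lemma Zomega_add: "x \<in> Zomega \<Longrightarrow> y \<in> Zomega \<Longrightarrow> x + y \<in> Zomega"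
proof -
  assume "x \<in> Zomega" "y \<in> Zomega"
  then obtain m k m' k' where "x = of_int m + of_int k * \<omega>" "y = of_int m' + of_int k' * \<omega>"
    unfolding Zomega_def by blast
  then show ?thesis
    by (intro ZomegaI[of _ "m + m'" "k + k'"]) (simp add: algebra_simps)
qed

lemma Zomega_uminus: "x \<in> Zomega \<Longrightarrow> - x \<in> Zomega"
proof -
  assume "x \<in> Zomega"
  then obtain m k where "x = of_int m + of_int k * \<omega>"
    unfolding Zomega_def by blast
  then show ?thesis
    by (intro ZomegaI[of _ "- m" "- k"]) simp
qed

lemma Zomega_diff: "x \<in> Zomega \<Longrightarrow> y \<in> Zomega \<Longrightarrow> x - y \<in> Zomega"
  using Zomega_add[of x "- y"] Zomega_uminus by simp

lemma Zomega_mult: "x \<in> Zomega \<Longrightarrow> y \<in> Zomega \<Longrightarrow> x * y \<in> Zomega"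
proof -
  assume "x \<in> Zomega" "y \<in> Zomega"
  then obtain m k m' k' where x: "x = of_int m + of_int k * \<omega>" and y: "y = of_int m' + of_int k' * \<omega>"
    unfolding Zomega_def by blast
  have "x * y = of_int (m * m') + of_int (m * k' + k * m') * \<omega> + of_int (k * k') * (\<omega> * \<omega>)"
    by (simp add: x y algebra_simps)
  then show ?thesis
    by (intro ZomegaI[of _ "m * m' - 2 * k * k'" "m * k' + k * m' + k * k'"])
      (simp add: omega_squared algebra_simps)
qed

lemma Zomega_cnj: "x \<in> Zomega \<Longrightarrow> cnj x \<in> Zomega"
proof -
  assume "x \<in> Zomega"
  then obtain m k where "x = of_int m + of_int k * \<omega>"
    unfolding Zomega_def by blast
  then show ?thesis
    by (intro ZomegaI[of _ "m + k" "- k"]) (simp add: cnj_omega algebra_simps)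
qed

lemma Zomega_sum: "(\<And>i. i \<in> I \<Longrightarrow> f i \<in> Zomega) \<Longrightarrow> sum f I \<in> Zomega"
  by (induction I rule: infinite_finite_induct) (auto intro: Zomega_add)

lemma cmod2_int_omega:
  "(cmod (of_int m + of_int k * \<omega>))\<^sup>2 = of_int (m * m + m * k + 2 * k * k)"
  unfolding cmod_power2 by (simp add: power2_eq_square algebra_simps)

text \<open>Completing the square of the norm form \<open>m\<^sup>2 + m k + 2 k\<^sup>2\<close> in
  both variables bounds both coordinates. The list shows that the units are 1 and -1 and that 3 is
  not a norm.\<close>

lemma Zomega_norm_cases:
  assumes "x \<in> Zomega" "(cmod x)\<^sup>2 \<le> 4"
  shows "x \<in> {0, 1, -1, \<omega>, -\<omega>, cnj \<omega>, -cnj \<omega>, 2, -2, 1 + \<omega>, - 1 - \<omega>, 1 + cnj \<omega>, - 1 - cnj \<omega>}"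
proof -
  obtain m k where x: "x = of_int m + of_int k * \<omega>"
    using assms(1) unfolding Zomega_def by blast
  have le: "m * m + m * k + 2 * k * k \<le> 4"
    using assms(2) unfolding x cmod2_int_omega by linarith
  have eq: "4 * (m * m + m * k + 2 * k * k) = (2 * m + k)\<^sup>2 + 7 * k\<^sup>2"
      "8 * (m * m + m * k + 2 * k * k) = 7 * m\<^sup>2 + (m + 4 * k)\<^sup>2"
    by (simp_all add: power2_eq_square algebra_simps)
  have "7 * k\<^sup>2 \<le> 4 * (m * m + m * k + 2 * k * k)"
      "7 * m\<^sup>2 \<le> 8 * (m * m + m * k + 2 * k * k)"
    unfolding eq by simp_all
  then have "7 * k\<^sup>2 \<le> 16" "7 * m\<^sup>2 \<le> 32"
    using le by simp_all
  then have "k\<^sup>2 < 2\<^sup>2" "m\<^sup>2 < 3\<^sup>2" by simp_all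
  then have "\<bar>k\<bar> < 2" "\<bar>m\<bar> < 3"
    using abs_square_less_1 power2_less_imp_less[of "\<bar>k\<bar>" 2] power2_less_imp_less[of "\<bar>m\<bar>" 3] by auto
  then have "k \<in> {-1, 0, 1}" "m \<in> {-2, -1, 0, 1, 2}" by auto
  then show ?thesis
    using le unfolding x by (auto simp: cnj_omega)
qed

text \<open>The square of the denominator divides 7, which is squarefree.\<close>

lemma rational_square_int:
  fixes q :: rat
  assumes "7 * q\<^sup>2 = of_int N"
  shows "q \<in> \<int>"
proof -
  obtain c d where q: "quotient_of q = (c, d)" by (cases "quotient_of q")
  have d: "d > 0" and cop: "coprime c d" and qd: "q = of_int c / of_int d"
    using q quotient_of_denom_pos quotient_of_coprime quotient_of_div by auto
  have "7 * (of_int c)\<^sup>2 = (of_int N * (of_int d)\<^sup>2 :: rat)"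
    using assms d unfolding qd by (simp add: field_simps)
  then have "7 * c\<^sup>2 = N * d\<^sup>2"
    by (metis (mono_tags, lifting) of_int_eq_iff of_int_mult of_int_numeral of_int_power)
  then have "d\<^sup>2 dvd 7 * c\<^sup>2" by simp
  moreover have "coprime (d\<^sup>2) (c\<^sup>2)" using cop by (simp add: coprime_commute)
  ultimately have "d\<^sup>2 dvd 7" by (simp add: coprime_dvd_mult_left_iff)
  then have "d\<^sup>2 \<le> 7" by (auto dest: zdvd_imp_le)
  then have "d\<^sup>2 < 3\<^sup>2" by simp
  then have "d < 3" using d power2_less_imp_less[of d 3] by simp
  then have "d = 1 \<or> d = 2" using d by auto
  then have "d = 1" using \<open>d\<^sup>2 dvd 7\<close> by auto
  then show ?thesis using qd by simp
qed

text \<open>Gauss's lemma: with \<open>t = c / d\<close> in lowest terms, \<open>d\<close> times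
  \<open>X\<^sup>2 - t X + n\<close> is a primitive integer polynomial. By pseudo-division a monic
  integer polynomial with root \<open>x\<close> is a multiple of it; comparing contents and then
  leading coefficients gives \<open>d = 1\<close>.\<close>

lemma algebraic_int_trace_int:
  fixes x :: complex
  assumes alg: "algebraic_int x" and nonreal: "Im x \<noteq> 0"
    and norm: "x * cnj x = of_int n" and trace: "x + cnj x = of_rat t"
  shows "t \<in> \<int>"
proof -
  obtain c d where q: "quotient_of t = (c, d)" by (cases "quotient_of t")
  have d: "d > 0" and cop: "coprime c d" and td: "t = of_int c / of_int d"
    using q quotient_of_denom_pos quotient_of_coprime quotient_of_div by auto
  obtain p where p: "lead_coeff p = 1" "poly (map_poly of_int p) x = 0"
    using alg unfolding algebraic_int_altdef_ipoly by blast
  define g where "g = [: d * n, - c, d :]"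
  have g0: "g \<noteq> 0" "degree g = 2" "lead_coeff g = d" using d by (auto simp: g_def)
  have "x * x - of_rat t * x + of_int n = 0"
    unfolding trace[symmetric] norm[symmetric] by (simp add: algebra_simps)
  then have "of_int d * (x * x - of_rat t * x + of_int n) = 0" by simp
  then have "of_int d * x * x - (of_int d * of_rat t) * x + of_int d * of_int n = 0"
    by (simp add: algebra_simps)
  moreover have "of_int d * of_rat t = (of_int c :: complex)"
    using d by (simp add: td of_rat_divide)
  ultimately have gx: "poly (map_poly of_int g) x = 0"
    by (simp add: g_def of_int_hom.map_poly_pCons_hom algebra_simps)
  obtain s r where sr: "pseudo_divmod p g = (s, r)" by (cases "pseudo_divmod p g")
  define e where "e = Suc (degree p) - degree g"
  have eq: "smult (d ^ e) p = g * s + r" and deg: "r = 0 \<or> degree r < degree g"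
    using pseudo_divmod[OF g0(1) sr] g0 by (simp_all add: e_def)
  have "poly (map_poly of_int (smult (d ^ e) p)) x = 0"
    using p by (simp add: of_int_hom.map_poly_hom_smult)
  then have rx: "poly (map_poly of_int r) x = 0"
    unfolding eq using gx by (simp add: of_int_hom.map_poly_hom_add of_int_poly_hom.hom_mult)
  have "degree r \<le> 1" using deg g0 by auto
  then have "coeff r i = 0" if "i > 1" for i
    using that by (intro coeff_eq_0) simp
  then have "r = [: coeff r 0, coeff r 1 :]"
    by (intro poly_eqI) (auto simp: coeff_pCons split: nat.split)
  then obtain r0 r1 where r: "r = [: r0, r1 :]" by blast
  have "of_int r0 + of_int r1 * x = 0"
    using rx unfolding r by (simp add: of_int_hom.map_poly_pCons_hom algebra_simps)
  then have 0: "of_int r0 + of_int r1 * x = 0" .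
  \<comment> \<open>The remainder has degree at most 1, and a nonzero one would make the nonreal
    \<open>x\<close> rational.\<close>
  have "Im (of_int r0 + of_int r1 * x) = of_int r1 * Im x" by simp
  then have "r1 = 0" using nonreal unfolding 0 by simp
  moreover from this have "r0 = 0" using 0 by simp
  ultimately have "r1 = 0" "r0 = 0" by simp_all
  then have r0: "r = 0" by (simp add: r)
  have "content p = 1"
    using p(1) content_dvd_coeff[of p "degree p"] is_unit_content_iff[of p] by metis
  moreover have "content g = 1"
  proof -
    have "content g dvd coeff g 1" "content g dvd coeff g 2" by (rule content_dvd_coeff)+
    then have "content g dvd c" "content g dvd d" by (simp_all add: g_def numeral_2_eq_2)
    then have "is_unit (content g)" using cop by (rule_tac coprime_common_divisor)
    then show ?thesis using is_unit_content_iff[of g] by metis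
  qed
  ultimately have cs: "content s = d ^ e"
    using arg_cong[OF eq, of content] d by (simp add: r0 content_mult)
  then obtain s' where s': "s = smult (d ^ e) s'"
    using content_times_primitive_part[of s] by metis
  have "[:d ^ e:] * p = [:d ^ e:] * (g * s')" using eq by (simp add: r0 s')
  then have "p = g * s'" using d by (simp only: mult_cancel_left) simp
  then have "d * lead_coeff s' = 1" using p(1) g0 by (simp add: lead_coeff_mult)
  then have "d = 1" using d by (metis zmult_eq_1_iff less_minus_one_simps(1) order.asym)
  then show ?thesis using td by simp
qed

text \<open>The trace \<open>2 a\<close> is an integer by \<open>algebraic_int_trace_int\<close>.
  The norm then makes \<open>7 (2 b)\<^sup>2\<close> an integer, hence also \<open>2 b\<close>.
  Finally \<open>t\<^sup>2 + 7 s\<^sup>2 = 4 n\<close> forces \<open>t\<close> and \<open>s\<close>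
  to have the same parity, which is what the basis \<open>1\<close>, \<open>\<omega>\<close>
  requires.\<close>

lemma norm_labels_subset: "norm_labels (-7) n \<subseteq> Zomega"
proof
  fix x assume "x \<in> norm_labels (-7) n"
  then obtain a b where x: "x = of_rat a + of_rat b * csqrt (-7)" and alg: "algebraic_int x"
      and nx: "x * cnj x = of_nat n"
    unfolding norm_labels_def quadratic_integers_def quadratic_field_def by auto
  have rr: "of_rat q = complex_of_real (real_of_rat q)" for q
    by (cases q) (simp add: of_rat_rat)
  have xr: "Re x = real_of_rat a" "Im x = real_of_rat b * sqrt 7"
    unfolding x csqrt_minus_7 rr by simp_all
  show "x \<in> Zomega"
  proof (cases "b = 0")
    case True
    then have "x \<in> \<rat>" using x by simp
    then have "x \<in> \<int>" using alg by (rule rational_algebraic_int_is_int[rotated])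
    then show ?thesis by (auto elim: Ints_cases)
  next
    case False
    have "2 * a \<in> \<int>"
    proof (rule algebraic_int_trace_int[OF alg])
      show "Im x \<noteq> 0" using False xr by simp
      show "x * cnj x = of_int (int n)" using nx by simp
      show "x + cnj x = of_rat (2 * a)" unfolding rr by (simp add: complex_eq_iff xr of_rat_mult)
    qed
    then obtain t where t: "2 * a = of_int t" by (auto elim: Ints_cases)
    have "Re (x * cnj x) = real n" using nx by simp
    then have "(real_of_rat a)\<^sup>2 + 7 * (real_of_rat b)\<^sup>2 = real n"
      by (simp add: xr power2_eq_square algebra_simps)
    then have "real_of_rat (a\<^sup>2 + 7 * b\<^sup>2) = real_of_rat (of_nat n)"
      by (simp add: of_rat_add of_rat_mult of_rat_power)
    then have ab: "a\<^sup>2 + 7 * b\<^sup>2 = of_nat n" by (simp only: of_rat_eq_iff)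
    then have N: "(2 * a)\<^sup>2 + 7 * (2 * b)\<^sup>2 = of_int (4 * int n)"
      by (simp add: power2_eq_square algebra_simps)
    then have "7 * (2 * b)\<^sup>2 = of_int (4 * int n - t\<^sup>2)" unfolding t by simp
    then have "2 * b \<in> \<int>" by (rule rational_square_int)
    then obtain s where s: "2 * b = of_int s" by (auto elim: Ints_cases)
    have "(of_int (t\<^sup>2 + 7 * s\<^sup>2) :: rat) = of_int (4 * int n)" using N unfolding t s by simp
    then have "t\<^sup>2 + 7 * s\<^sup>2 = 4 * int n" by (simp only: of_int_eq_iff)
    then have "even (t\<^sup>2 + 7 * s\<^sup>2)" by simp
    then have "even (t - s)" by simp
    then obtain m where m: "t = s + 2 * m" by (metis dvdE diff_eq_eq add.commute)
    have "real_of_rat (2 * a) = of_int t" "real_of_rat (2 * b) = of_int s" unfolding t s by simp_all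
    then have "real_of_rat a = of_int s / 2 + of_int m" "real_of_rat b = of_int s / 2"
      by (simp_all add: of_rat_mult m)
    then show ?thesis
      by (intro ZomegaI[of _ m s]) (simp add: complex_eq_iff xr)
  qed
qed

lemma algebraic_int_Zomega: "x \<in> Zomega \<Longrightarrow> algebraic_int x"
proof -
  assume "x \<in> Zomega"
  then obtain m k where x: "x = of_int m + of_int k * \<omega>" unfolding Zomega_def by blast
  have ev: "x * x - of_int (2 * m + k) * x + of_int (m * m + m * k + 2 * k * k) = 0"
  proof -
    have "x * x = of_int (m * m) + of_int (2 * m * k) * \<omega> + of_int (k * k) * (\<omega> * \<omega>)"
      by (simp add: x algebra_simps)
    then show ?thesis by (simp add: omega_squared x algebra_simps)
  qed
  define p where "p = [: m * m + m * k + 2 * k * k, - (2 * m + k), 1 :]"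
  have "poly (map_poly of_int p) x = 0"
    using ev by (simp add: p_def of_int_hom.map_poly_pCons_hom algebra_simps)
  moreover have "lead_coeff p = 1" by (simp add: p_def)
  ultimately show ?thesis unfolding algebraic_int_altdef_ipoly by blast
qed

lemma Zomega_quadratic_integers: "x \<in> Zomega \<Longrightarrow> x \<in> quadratic_integers (-7)"
proof -
  assume R: "x \<in> Zomega"
  then obtain m k where x: "x = of_int m + of_int k * \<omega>" unfolding Zomega_def by blast
  have "x = of_rat (of_int m + of_int k / 2) + of_rat (of_int k / 2) * csqrt (of_int (-7))"
    by (simp add: x \<omega>_def of_rat_add of_rat_divide algebra_simps)
  then show ?thesis
    using algebraic_int_Zomega[OF R] unfolding quadratic_integers_def quadratic_field_def by blast
qed

text \<open>The norm form takes integer values, so the union over the norms 1 to 4 becomes one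
  inequality. Labels are used only in this form from here on.\<close>

lemma label_set_iff: "x \<in> label_set (-7) \<longleftrightarrow> x \<in> Zomega \<and> (cmod x)\<^sup>2 \<le> 4"
proof
  assume "x \<in> label_set (-7)"
  then consider "x = 0" | n where "n \<in> {1,2,3,4}" "x \<in> norm_labels (-7) n"
    unfolding label_set_def by auto
  then show "x \<in> Zomega \<and> (cmod x)\<^sup>2 \<le> 4"
  proof cases
    case 2
    then have "complex_of_real ((cmod x)\<^sup>2) = of_nat n"
      by (simp add: norm_labels_def complex_norm_square flip: of_real_power)
    then have "(cmod x)\<^sup>2 = real n" by (metis of_real_eq_iff of_real_of_nat_eq)
    then show ?thesis using 2 norm_labels_subset by auto
  qed simp
next
  assume R: "x \<in> Zomega \<and> (cmod x)\<^sup>2 \<le> 4"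
  then obtain m k where x: "x = of_int m + of_int k * \<omega>" unfolding Zomega_def by blast
  define N where "N = m * m + m * k + 2 * k * k"
  have "real_of_int N = (cmod x)\<^sup>2" unfolding x N_def by (rule cmod2_int_omega[symmetric])
  then have N: "N \<ge> 0" "N \<le> 4" "(cmod x)\<^sup>2 = of_int N"
    using R zero_le_power2[of "cmod x"] by linarith+
  then have xx: "x * cnj x = of_int N"
    by (metis complex_norm_square of_real_of_int_eq)
  have q: "x \<in> quadratic_integers (-7)" using R Zomega_quadratic_integers by blast
  have "N \<in> {0,1,2,3,4}" using N by auto
  then show "x \<in> label_set (-7)"
    using xx q N(3) by (auto simp: label_set_def norm_labels_def)
qed

section \<open>Hermitian matrices with bounded eigenvalues\<close>

text \<open>Vectors and matrices are plain functions with the dimension as a parameter, so that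
  bordering, switching and relabelling stay pointwise; values from \<open>n\<close> on never count.
  The form is conjugate linear in its second argument.\<close>

definition iprod :: "nat \<Rightarrow> (nat \<Rightarrow> complex) \<Rightarrow> (nat \<Rightarrow> complex) \<Rightarrow> complex" where
  "iprod n x y = (\<Sum>i<n. x i * cnj (y i))"

definition apply_mat :: "nat \<Rightarrow> (nat \<Rightarrow> nat \<Rightarrow> complex) \<Rightarrow> (nat \<Rightarrow> complex) \<Rightarrow> nat \<Rightarrow> complex" where
  "apply_mat n a x i = (\<Sum>j<n. a i j * x j)"

definition sqnorm :: "nat \<Rightarrow> (nat \<Rightarrow> complex) \<Rightarrow> real" where
  "sqnorm n x = (\<Sum>i<n. (cmod (x i))\<^sup>2)"

definition hermitian :: "nat \<Rightarrow> (nat \<Rightarrow> nat \<Rightarrow> complex) \<Rightarrow> bool" where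
  "hermitian n a \<longleftrightarrow> (\<forall>i<n. \<forall>j<n. a j i = cnj (a i j))"

lemma iprod_self: "iprod n x x = of_real (sqnorm n x)"
  by (simp add: iprod_def sqnorm_def flip: complex_norm_square)

lemma iprod_add_left: "iprod n (\<lambda>i. x i + y i) z = iprod n x z + iprod n y z"
  and iprod_add_right: "iprod n z (\<lambda>i. x i + y i) = iprod n z x + iprod n z y"
  and iprod_scale_left: "iprod n (\<lambda>i. c * x i) z = c * iprod n x z"
  and iprod_scale_right: "iprod n z (\<lambda>i. c * x i) = cnj c * iprod n z x"
  by (simp_all add: iprod_def algebra_simps sum.distrib sum_distrib_left)

lemma iprod_commute: "iprod n y x = cnj (iprod n x y)"
  by (simp add: iprod_def mult.commute)

lemma iprod_apply:
  assumes "hermitian n a"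
  shows "iprod n (apply_mat n a x) y = iprod n x (apply_mat n a y)"
proof -
  have "iprod n (apply_mat n a x) y = (\<Sum>i<n. \<Sum>j<n. a i j * x j * cnj (y i))"
    by (simp add: iprod_def apply_mat_def sum_distrib_right)
  also have "\<dots> = (\<Sum>j<n. \<Sum>i<n. a i j * x j * cnj (y i))"
    by (rule sum.swap)
  also have "\<dots> = (\<Sum>j<n. \<Sum>i<n. x j * cnj (a j i * y i))"
  proof (intro sum.cong refl)
    fix j i assume "j \<in> {..<n}" "i \<in> {..<n}"
    then have "a i j = cnj (a j i)" using assms unfolding hermitian_def by blast
    then show "a i j * x j * cnj (y i) = x j * cnj (a j i * y i)" by simp
  qed
  also have "\<dots> = iprod n x (apply_mat n a y)"
    by (simp add: iprod_def apply_mat_def sum_distrib_left)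
  finally show ?thesis .
qed

lemma apply_mat_add: "apply_mat n a (\<lambda>i. x i + y i) = (\<lambda>i. apply_mat n a x i + apply_mat n a y i)"
  and apply_mat_scale: "apply_mat n a (\<lambda>i. c * x i) = (\<lambda>i. c * apply_mat n a x i)"
  by (rule ext; simp add: apply_mat_def algebra_simps sum.distrib sum_distrib_left)+

lemma sqnorm_nonneg: "sqnorm n x \<ge> 0"
  by (simp add: sqnorm_def sum_nonneg)

lemma sqnorm_eq_0_iff: "sqnorm n x = 0 \<longleftrightarrow> (\<forall>i<n. x i = 0)"
  by (auto simp: sqnorm_def sum_nonneg_eq_0_iff)

lemma sqnorm_add:
  "sqnorm n (\<lambda>i. x i + y i) = sqnorm n x + sqnorm n y + 2 * Re (iprod n x y)"
proof -
  have "(cmod (u + v))\<^sup>2 = (cmod u)\<^sup>2 + (cmod v)\<^sup>2 + 2 * Re (u * cnj v)" for u v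
    by (simp only: cmod_power2) (simp add: power2_eq_square algebra_simps)
  then show ?thesis by (simp add: sqnorm_def iprod_def sum.distrib sum_distrib_left)
qed

lemma sqnorm_scale: "sqnorm n (\<lambda>i. c * x i) = (cmod c)\<^sup>2 * sqnorm n x"
  by (simp add: sqnorm_def norm_mult power_mult_distrib sum_distrib_left)

lemma sqnorm_cong: "(\<And>i. i < n \<Longrightarrow> x i = y i) \<Longrightarrow> sqnorm n x = sqnorm n y"
  by (simp add: sqnorm_def)

lemma iprod_cong: "(\<And>i. i < n \<Longrightarrow> x i = x' i) \<Longrightarrow> (\<And>i. i < n \<Longrightarrow> y i = y' i) \<Longrightarrow> iprod n x y = iprod n x' y'"
  by (simp add: iprod_def)

lemma apply_mat_cong: "(\<And>i. i < n \<Longrightarrow> x i = y i) \<Longrightarrow> apply_mat n a x = apply_mat n a y"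
  by (rule ext) (simp add: apply_mat_def)

text \<open>The vector \<open>x\<close> minimises the nonnegative form
  \<open>m |y|\<^sup>2 - |A y|\<^sup>2\<close>, so the gradient \<open>g = (m - A\<^sup>2) x\<close>
  vanishes. This serves both for finding an extremal eigenvector and for rows of weight 4.\<close>

lemma extremal_vector_square:
  assumes herm: "hermitian n a"
    and bound: "\<And>y. sqnorm n (apply_mat n a y) \<le> m * sqnorm n y"
    and attained: "sqnorm n (apply_mat n a x) = m * sqnorm n x"
    and i: "i < n"
  shows "apply_mat n a (apply_mat n a x) i = of_real m * x i"
proof -
  let ?T = "apply_mat n a"
  define g where "g = (\<lambda>i. of_real m * x i + (-1) * ?T (?T x) i)"
  define K where "K = m * sqnorm n g - sqnorm n (?T g)"
  have gl: "iprod n g h = of_real m * iprod n x h - iprod n (?T (?T x)) h" for h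
    unfolding g_def iprod_add_left iprod_scale_left by simp
  have "K \<ge> 0" unfolding K_def using bound[of g] by simp
  \<comment> \<open>The form is evaluated at \<open>x - t g\<close>: its value at \<open>x\<close>
    is 0 and its linear term is \<open>- 2 t |g|\<^sup>2\<close>.\<close>
  have ineq: "2 * t * sqnorm n g \<le> t\<^sup>2 * K" for t :: real
  proof -
    let ?c = "of_real (- t) :: complex"
    have add: "sqnorm n (\<lambda>i. u i + ?c * v i) = sqnorm n u + t\<^sup>2 * sqnorm n v - 2 * t * Re (iprod n u v)"
      for u v
      unfolding sqnorm_add sqnorm_scale iprod_scale_right by simp
    have "sqnorm n (\<lambda>i. ?T x i + ?c * ?T g i) \<le> m * sqnorm n (\<lambda>i. x i + ?c * g i)"
      using bound[of "\<lambda>i. x i + ?c * g i"] unfolding apply_mat_add apply_mat_scale .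
    note 1 = this[unfolded add]
    have "iprod n (?T x) (?T g) = iprod n (?T (?T x)) g"
      by (simp add: iprod_apply[OF herm])
    then have "of_real m * iprod n x g - iprod n (?T x) (?T g) = iprod n g g"
      using gl[of g] by simp
    then have "Re (of_real m * iprod n x g - iprod n (?T x) (?T g)) = Re (iprod n g g)" by simp
    then have "m * Re (iprod n x g) - Re (iprod n (?T x) (?T g)) = sqnorm n g"
      unfolding iprod_self by simp
    then have 3: "2 * t * (m * Re (iprod n x g) - Re (iprod n (?T x) (?T g))) = 2 * t * sqnorm n g"
      by simp
    show ?thesis
      using 1 3 attained unfolding K_def
      by (simp add: algebra_simps)
  qed
  have "sqnorm n g = 0"
  proof (rule ccontr)
    assume "sqnorm n g \<noteq> 0"
    then have pos: "sqnorm n g > 0" using sqnorm_nonneg[of n g] by simp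
    \<comment> \<open>Small enough for the quadratic term to lose against the linear one;
      \<open>K + 1\<close> also avoids division by zero.\<close>
    define t where "t = sqnorm n g / (K + 1)"
    have t: "t > 0" unfolding t_def using pos \<open>K \<ge> 0\<close> by simp
    have "2 * sqnorm n g \<le> t * K"
      using ineq[of t] t by (simp add: power2_eq_square)
    also have "\<dots> \<le> t * (K + 1)" using t by simp
    also have "\<dots> = sqnorm n g" unfolding t_def using \<open>K \<ge> 0\<close> by simp
    finally show False using pos by simp
  qed
  then have "g i = 0" using i by (simp add: sqnorm_eq_0_iff)
  then show ?thesis by (simp add: g_def)
qed

text \<open>Compactness of the unit sphere. It lives among all functions on the naturals, so the
  coordinates from \<open>n\<close> on are pinned to 0 and the product topology gives compactness.
  Homogeneity carries the bound from the sphere to every \<open>y\<close>.\<close>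

lemma sqnorm_apply_attains:
  assumes "n > 0"
  obtains x m where "sqnorm n x = 1" "sqnorm n (apply_mat n a x) = m"
    "\<And>y. sqnorm n (apply_mat n a y) \<le> m * sqnorm n y"
proof -
  \<comment> \<open>A compact square that contains the unit disc.\<close>
  define Q where "Q = (\<lambda>(x, y). Complex x y) ` ({-1..1} \<times> {-1..1})"
  have cQ: "compact Q"
    unfolding Q_def Complex_eq case_prod_unfold
    by (intro compact_continuous_image compact_Times compact_Icc continuous_intros)
  define B where "B = (\<lambda>i::nat. if i < n then Q else {0})"
  have "compactin (product_topology (\<lambda>_. euclidean) UNIV) (PiE UNIV B)"
    unfolding compactin_PiE by (auto simp: B_def cQ)
  then have cB: "compact (PiE UNIV B)"
    by (simp add: euclidean_product_topology)
  have cont: "continuous_on UNIV (sqnorm n)"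
    unfolding sqnorm_def[abs_def] by (intro continuous_intros continuous_on_product_coordinates)
  have cont2: "continuous_on UNIV (\<lambda>x. sqnorm n (apply_mat n a x))"
    unfolding sqnorm_def apply_mat_def by (intro continuous_intros continuous_on_product_coordinates)
  have cl: "closed {x. sqnorm n x = 1}"
    using closed_vimage[of "{1}" "sqnorm n"] cont by (simp add: vimage_def)
  define S where "S = PiE UNIV B \<inter> {x. sqnorm n x = 1}"
  have "compact S" unfolding S_def using cB cl by (rule compact_Int_closed)
  moreover have "(\<lambda>i. if i = 0 then 1 else 0) \<in> S"
  proof -
    have "sqnorm n (\<lambda>i. if i = 0 then 1 else 0) = (\<Sum>i<n. if i = 0 then 1 else 0)"
      unfolding sqnorm_def by (rule sum.cong) auto
    moreover have "1 \<in> Q" "0 \<in> Q"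
      unfolding Q_def by (force simp: complex_eq_iff)+
    ultimately show ?thesis using assms by (auto simp: S_def B_def)
  qed
  then have "S \<noteq> {}" by blast
  moreover have "continuous_on S (\<lambda>x. sqnorm n (apply_mat n a x))"
    using cont2 by (rule continuous_on_subset) simp
  ultimately obtain x where x: "x \<in> S"
    and mx: "\<And>y. y \<in> S \<Longrightarrow> sqnorm n (apply_mat n a y) \<le> sqnorm n (apply_mat n a x)"
    using continuous_attains_sup by meson
  let ?m = "sqnorm n (apply_mat n a x)"
  have "sqnorm n (apply_mat n a y) \<le> ?m * sqnorm n y" for y
  proof (cases "sqnorm n y = 0")
    case True
    then have "apply_mat n a y = apply_mat n a (\<lambda>_. 0)"
      by (intro apply_mat_cong) (simp add: sqnorm_eq_0_iff)
    then have "apply_mat n a y i = 0" for i by (simp add: apply_mat_def)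
    then have "sqnorm n (apply_mat n a y) = 0" by (simp add: sqnorm_def)
    then show ?thesis by (simp add: True)
  next
    case False
    then have pos: "sqnorm n y > 0" using sqnorm_nonneg[of n y] by simp
    define c where "c = complex_of_real (1 / sqrt (sqnorm n y))"
    define z where "z = (\<lambda>i. if i < n then c * y i else 0)"
    have c2: "(cmod c)\<^sup>2 * sqnorm n y = 1"
      using pos by (simp add: c_def norm_divide power_divide)
    have "sqnorm n z = sqnorm n (\<lambda>i. c * y i)"
      by (rule sqnorm_cong) (simp add: z_def)
    moreover have "apply_mat n a z = apply_mat n a (\<lambda>i. c * y i)"
      by (rule apply_mat_cong) (simp add: z_def)
    ultimately have zc: "sqnorm n z = 1" "apply_mat n a z = apply_mat n a (\<lambda>i. c * y i)"
      unfolding sqnorm_scale c2 by auto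
    have "(cmod (z i))\<^sup>2 \<le> 1" if "i < n" for i
      using zc(1) member_le_sum[of i "{..<n}" "\<lambda>i. (cmod (z i))\<^sup>2"] that by (simp add: sqnorm_def)
    then have "cmod (z i) \<le> 1" if "i < n" for i
      using that by (simp add: power_le_one_iff abs_square_le_1)
    then have "\<bar>Re (z i)\<bar> \<le> 1" "\<bar>Im (z i)\<bar> \<le> 1" if "i < n" for i
      using that abs_Re_le_cmod[of "z i"] abs_Im_le_cmod[of "z i"] by fastforce+
    then have "z i \<in> Q" if "i < n" for i
      using that unfolding Q_def
      by (intro image_eqI[of _ _ "(Re (z i), Im (z i))"]) (auto simp: abs_le_iff minus_le_iff)
    then have "z \<in> S" using zc(1) by (auto simp: S_def B_def z_def)
    then have "sqnorm n (apply_mat n a z) \<le> ?m" by (rule mx)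
    then have "(cmod c)\<^sup>2 * sqnorm n (apply_mat n a y) \<le> ?m"
      by (simp add: zc(2) apply_mat_scale sqnorm_scale)
    then have "(cmod c)\<^sup>2 * sqnorm n (apply_mat n a y) * sqnorm n y \<le> ?m * sqnorm n y"
      using pos by (intro mult_right_mono) auto
    moreover have "(cmod c)\<^sup>2 * sqnorm n (apply_mat n a y) * sqnorm n y = sqnorm n (apply_mat n a y)"
      using c2 by (metis mult.assoc mult.commute mult_1)
    ultimately show ?thesis by simp
  qed
  then show ?thesis using that[of x ?m] x by (simp add: S_def)
qed

text \<open>A substitute for the spectral theorem. A maximiser \<open>x\<close> satisfies
  \<open>A\<^sup>2 x = m x\<close>, that is \<open>(A - s) (A + s) x = 0\<close> with
  \<open>s = sqrt m\<close>. Either \<open>(A + s) x\<close> is an eigenvector for \<open>s\<close>,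
  or it vanishes and \<open>x\<close> is one for \<open>- s\<close>.\<close>

lemma eigenvalue_bound_sqnorm:
  assumes herm: "hermitian n a"
    and ev: "\<And>l x i. i < n \<Longrightarrow> x i \<noteq> 0 \<Longrightarrow>
      (\<And>j. j < n \<Longrightarrow> apply_mat n a x j = of_real l * x j) \<Longrightarrow> \<bar>l\<bar> \<le> 2"
  shows "sqnorm n (apply_mat n a y) \<le> 4 * sqnorm n y"
proof (cases "n = 0")
  case True
  then show ?thesis by (simp add: sqnorm_def)
next
  case False
  then obtain x m where x: "sqnorm n x = 1" and m: "sqnorm n (apply_mat n a x) = m"
    and bound: "\<And>y. sqnorm n (apply_mat n a y) \<le> m * sqnorm n y"
    using sqnorm_apply_attains[of n a] by auto
  have m0: "m \<ge> 0" using m sqnorm_nonneg by metis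
  let ?T = "apply_mat n a"
  have T2: "?T (?T x) i = of_real m * x i" if "i < n" for i
    by (rule extremal_vector_square[OF herm bound _ that]) (simp add: x m)
  define s where "s = sqrt m"
  have s: "of_real s * of_real s = complex_of_real m" unfolding s_def using m0
    by (simp flip: of_real_mult)
  define w where "w = (\<lambda>i. ?T x i + of_real s * x i)"
  have "\<bar>s\<bar> \<le> 2"
  proof (cases "\<exists>i<n. w i \<noteq> 0")
    case True
    then obtain i where i: "i < n" "w i \<noteq> 0" by blast
    show ?thesis
    proof (rule ev[of i w])
      fix j assume "j < n"
      then show "?T w j = of_real s * w j"
        unfolding w_def apply_mat_add apply_mat_scale
        by (simp add: T2 distrib_left add.commute flip: mult.assoc s)
    qed (use i in auto)
  next
    case False
    obtain i where i: "i < n" "x i \<noteq> 0"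
      using x sqnorm_eq_0_iff[of n x] by auto
    have "\<bar>- s\<bar> \<le> 2"
    proof (rule ev[of i x])
      fix j assume "j < n"
      then have "w j = 0" using False by simp
      then show "?T x j = of_real (- s) * x j"
        unfolding w_def by (simp add: add_eq_0_iff)
    qed (use i in auto)
    then show ?thesis by simp
  qed
  then have "m \<le> 4"
    using m0 real_sqrt_le_iff[of m 4] by (simp add: s_def)
  then have "m * sqnorm n y \<le> 4 * sqnorm n y"
    using sqnorm_nonneg by (rule mult_right_mono)
  then show ?thesis using bound[of y] by simp
qed

section \<open>Cyclotomic and connected matrices\<close>

lemma eigenvalue_entries_iff:
  fixes A :: "complex mat"
  assumes "A \<in> carrier_mat n n"
  shows "eigenvalue A l \<longleftrightarrow>
    (\<exists>x. (\<exists>i<n. x i \<noteq> 0) \<and> (\<forall>j<n. apply_mat n (\<lambda>i j. A $$ (i, j)) x j = l * x j))"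
proof
  assume "eigenvalue A l"
  then obtain v where v: "v \<in> carrier_vec n" "v \<noteq> 0\<^sub>v n" "A *\<^sub>v v = l \<cdot>\<^sub>v v"
    using assms unfolding eigenvalue_def eigenvector_def by auto
  have "\<exists>i<n. v $ i \<noteq> 0"
  proof (rule ccontr)
    assume "\<not> (\<exists>i<n. v $ i \<noteq> 0)"
    then have "v = 0\<^sub>v n" using v(1) by (intro eq_vecI) auto
    then show False using v(2) by blast
  qed
  moreover have "apply_mat n (\<lambda>i j. A $$ (i, j)) (($) v) j = l * v $ j" if "j < n" for j
  proof -
    have "(A *\<^sub>v v) $ j = (l \<cdot>\<^sub>v v) $ j" using v(3) by simp
    then show ?thesis using that v(1) assms
      by (simp add: apply_mat_def scalar_prod_def row_def lessThan_atLeast0)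
  qed
  ultimately show "\<exists>x. (\<exists>i<n. x i \<noteq> 0) \<and>
      (\<forall>j<n. apply_mat n (\<lambda>i j. A $$ (i, j)) x j = l * x j)" by blast
next
  assume "\<exists>x. (\<exists>i<n. x i \<noteq> 0) \<and> (\<forall>j<n. apply_mat n (\<lambda>i j. A $$ (i, j)) x j = l * x j)"
  then obtain x i where i: "i < n" "x i \<noteq> 0"
    and x: "\<And>j. j < n \<Longrightarrow> apply_mat n (\<lambda>i j. A $$ (i, j)) x j = l * x j" by blast
  have "vec n x \<noteq> 0\<^sub>v n"
    using i by (metis index_vec index_zero_vec(1))
  moreover have "A *\<^sub>v vec n x = l \<cdot>\<^sub>v vec n x"
    using assms x by (intro eq_vecI) (auto simp: apply_mat_def scalar_prod_def lessThan_atLeast0)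
  ultimately show "eigenvalue A l"
    using assms unfolding eigenvalue_def eigenvector_def
    by (auto intro!: exI[of _ "vec n x"])
qed

lemma cyclotomic_sqnorm_bound:
  assumes A: "A \<in> carrier_mat n n" and herm: "hermitian n (\<lambda>i j. A $$ (i, j))"
    and cyc: "cyclotomic A"
  shows "sqnorm n (apply_mat n (\<lambda>i j. A $$ (i, j)) y) \<le> 4 * sqnorm n y"
proof (rule eigenvalue_bound_sqnorm[OF herm])
  fix l x i
  assume "i < n" "x i \<noteq> 0"
    "\<And>j. j < n \<Longrightarrow> apply_mat n (\<lambda>i j. A $$ (i, j)) x j = complex_of_real l * x j"
  then have "eigenvalue A (of_real l)"
    unfolding eigenvalue_entries_iff[OF A] by blast
  then have "complex_of_real l \<in> of_real ` {-2..2}" using cyc unfolding cyclotomic_def by blast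
  then show "\<bar>l\<bar> \<le> 2" by auto
qed

text \<open>Expand \<open>0 \<le> |(A + 2) x|\<^sup>2\<close> and bound
  \<open>|A x|\<^sup>2\<close>. Applied to \<open>- A\<close> this gives the form of
  \<open>2 - A\<close> as well.\<close>

lemma sqnorm_bound_form:
  assumes "\<And>y. sqnorm n (apply_mat n a y) \<le> 4 * sqnorm n y"
  shows "2 * sqnorm n x + Re (iprod n (apply_mat n a x) x) \<ge> 0"
proof -
  have "0 \<le> sqnorm n (\<lambda>i. apply_mat n a x i + 2 * x i)" by (rule sqnorm_nonneg)
  also have "\<dots> = sqnorm n (apply_mat n a x) + 4 * sqnorm n x + 4 * Re (iprod n (apply_mat n a x) x)"
    unfolding sqnorm_add sqnorm_scale iprod_scale_right by simp
  also have "\<dots> \<le> 8 * sqnorm n x + 4 * Re (iprod n (apply_mat n a x) x)"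
    using assms[of x] by simp
  finally show ?thesis by simp
qed

text \<open>The way back, for showing that a bordered matrix is cyclotomic: an eigenvalue is real by
  Hermitian symmetry, and the two forms at its eigenvector bound it from below and above.\<close>

lemma forms_imp_cyclotomic:
  assumes A: "A \<in> carrier_mat n n" and herm: "hermitian n (\<lambda>i j. A $$ (i, j))"
    and pos: "\<And>x. 2 * sqnorm n x + Re (iprod n (apply_mat n (\<lambda>i j. A $$ (i, j)) x) x) \<ge> 0"
    and neg: "\<And>x. 2 * sqnorm n x - Re (iprod n (apply_mat n (\<lambda>i j. A $$ (i, j)) x) x) \<ge> 0"
  shows "cyclotomic A"
  unfolding cyclotomic_def
proof (intro allI impI)
  fix l assume "eigenvalue A l"
  then obtain x i where i: "i < n" "x i \<noteq> 0"
    and x: "\<And>j. j < n \<Longrightarrow> apply_mat n (\<lambda>i j. A $$ (i, j)) x j = l * x j"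
    unfolding eigenvalue_entries_iff[OF A] by blast
  let ?T = "apply_mat n (\<lambda>i j. A $$ (i, j))"
  have "iprod n (?T x) x = iprod n (\<lambda>i. l * x i) x" by (rule iprod_cong) (simp_all add: x)
  then have 1: "iprod n (?T x) x = l * of_real (sqnorm n x)"
    by (simp add: iprod_scale_left iprod_self)
  have "iprod n x (?T x) = iprod n x (\<lambda>i. l * x i)" by (rule iprod_cong) (simp_all add: x)
  then have 2: "iprod n x (?T x) = cnj l * of_real (sqnorm n x)"
    by (simp add: iprod_scale_right iprod_self)
  have s: "sqnorm n x > 0"
    using i sqnorm_eq_0_iff[of n x] sqnorm_nonneg[of n x] by auto
  have "l * of_real (sqnorm n x) = cnj l * of_real (sqnorm n x)"
    using iprod_apply[OF herm, of x x] 1 2 by simp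
  then have "l = cnj l" using s by simp
  then have l: "l = of_real (Re l)" by (simp add: complex_eq_iff)
  have "Re (iprod n (?T x) x) = Re l * sqnorm n x" unfolding 1 by simp
  then have "0 \<le> (2 + Re l) * sqnorm n x" "0 \<le> (2 - Re l) * sqnorm n x"
    using pos[of x] neg[of x] by (simp_all add: algebra_simps)
  then have "Re l \<in> {-2..2}" using s by (simp add: zero_le_mult_iff)
  then show "l \<in> complex_of_real ` {-2..2}" using l by blast
qed

lemma hermitian_adjoint:
  assumes "square_mat A" "mat_adjoint A = A"
  shows "hermitian (dim_row A) (\<lambda>i j. A $$ (i, j))"
  unfolding hermitian_def
proof (intro allI impI)
  fix i j assume ij: "i < dim_row A" "j < dim_row A"
  have "A $$ (j, i) = mat_adjoint A $$ (j, i)" using assms by simp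
  also have "\<dots> = cnj (A $$ (i, j))"
    using ij assms(1) by (simp add: mat_adjoint_def mat_of_rows_index)
  finally show "A $$ (j, i) = cnj (A $$ (i, j))" .
qed

lemma adjoint_hermitian:
  assumes "A \<in> carrier_mat n n" "hermitian n (\<lambda>i j. A $$ (i, j))"
  shows "mat_adjoint A = A"
proof (rule eq_matI)
  fix i j assume ij: "i < dim_row A" "j < dim_col A"
  have "mat_adjoint A $$ (i, j) = cnj (A $$ (j, i))"
    using ij assms(1) by (simp add: mat_adjoint_def mat_of_rows_index)
  also have "\<dots> = A $$ (i, j)" using assms ij unfolding hermitian_def by (metis carrier_matD)
  finally show "mat_adjoint A $$ (i, j) = A $$ (i, j)" .
qed (use assms in \<open>simp_all add: mat_adjoint_def\<close>)

lemma permutation_conjugate: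
  fixes A :: "complex mat"
  assumes A: "A \<in> carrier_mat n n" and p: "p permutes {..<n}"
    and P: "P = mat n n (\<lambda>(i, j). if j = p i then 1 else 0)"
  shows "P * A * transpose_mat P = mat n n (\<lambda>(i, j). A $$ (p i, p j))"
proof (rule eq_matI)
  fix i j assume ij: "i < dim_row (mat n n (\<lambda>(i, j). A $$ (p i, p j)))"
    "j < dim_col (mat n n (\<lambda>(i, j). A $$ (p i, p j)))"
  have lt: "p k < n" if "k < n" for k
    using permutes_in_image[OF p, of k] that by simp
  have PA: "(P * A) $$ (i, k) = A $$ (p i, k)" if "k < n" for k
  proof -
    have "(P * A) $$ (i, k) = (\<Sum>l<n. (if l = p i then 1 else 0) * A $$ (l, k))"
      using ij that A by (simp add: P scalar_prod_def lessThan_atLeast0)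
    also have "\<dots> = (\<Sum>l<n. if l = p i then A $$ (l, k) else 0)"
      by (intro sum.cong) auto
    finally show ?thesis using lt ij by simp
  qed
  have "(P * A * transpose_mat P) $$ (i, j) = (\<Sum>l<n. (P * A) $$ (i, l) * (if l = p j then 1 else 0))"
    using ij A by (simp add: P scalar_prod_def lessThan_atLeast0)
  also have "\<dots> = (\<Sum>l<n. if l = p j then (P * A) $$ (i, l) else 0)"
    by (intro sum.cong) auto
  finally show "(P * A * transpose_mat P) $$ (i, j) = mat n n (\<lambda>(i, j). A $$ (p i, p j)) $$ (i, j)"
    using lt ij PA by simp
qed (use A in \<open>simp_all add: P\<close>)

section \<open>Connectedness as the absence of proper closed vertex sets\<close>

definition closed_under :: "nat \<Rightarrow> (nat \<Rightarrow> nat \<Rightarrow> complex) \<Rightarrow> nat set \<Rightarrow> bool" where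
  "closed_under n a U \<longleftrightarrow> (\<forall>i\<in>U. \<forall>j<n. a i j \<noteq> 0 \<longrightarrow> j \<in> U)"

text \<open>Otherwise list \<open>U\<close> first and its complement second: the permuted matrix is
  block diagonal with two nonempty blocks. The entries leading back into \<open>U\<close> vanish by
  Hermitian symmetry.\<close>

lemma connected_mat_closed:
  assumes A: "A \<in> carrier_mat n n" and herm: "hermitian n (\<lambda>i j. A $$ (i, j))"
    and conn: "connected_mat A"
    and U: "U \<subseteq> {..<n}" "U \<noteq> {}" "closed_under n (\<lambda>i j. A $$ (i, j)) U"
  shows "U = {..<n}"
proof (rule ccontr)
  assume neq: "U \<noteq> {..<n}"
  let ?V = "{..<n} - U"
  have finU: "finite U" using U(1) finite_subset by blast
  define m where "m = card U"
  have cV: "card ?V = n - m" using U(1) by (simp add: m_def card_Diff_subset finU)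
  have m0: "m > 0" using U(2) finU by (simp add: m_def card_gt_0_iff)
  have mn: "m < n" using neq U(1) psubset_card_mono[of "{..<n}" U] by (simp add: m_def psubset_eq)
  obtain f where f: "bij_betw f {..<m} U"
    using finite_same_card_bij[of "{..<m}" U] finU by (auto simp: m_def)
  obtain g where g: "bij_betw g {m..<n} ?V"
    using finite_same_card_bij[of "{m..<n}" ?V] cV by auto
  define p where "p = (\<lambda>i. if i < m then f i else if i < n then g i else i)"
  have "bij_betw p {..<m} U"
    using f by (subst bij_betw_cong[of _ _ f]) (auto simp: p_def)
  moreover have "bij_betw p {m..<n} ?V"
    using g by (subst bij_betw_cong[of _ _ g]) (auto simp: p_def)
  ultimately have "bij_betw p ({..<m} \<union> {m..<n}) (U \<union> ?V)"
    by (rule bij_betw_combine) auto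
  moreover have "{..<m} \<union> {m..<n} = {..<n}" "U \<union> ?V = {..<n}" using mn U(1) by auto
  ultimately have bp: "bij_betw p {..<n} {..<n}" by simp
  have p: "p permutes {..<n}"
    by (rule bij_imp_permutes[OF bp]) (use mn in \<open>auto simp: p_def\<close>)
  have pU: "p i \<in> U" if "i < m" for i
    using f that by (auto simp: p_def bij_betw_def)
  have pV: "p i \<in> ?V" if "m \<le> i" "i < n" for i
    using g that by (auto simp: p_def bij_betw_def)
  define P where "P = mat n n (\<lambda>(i, j). if j = p i then 1 else (0 :: complex))"
  define B1 where "B1 = mat m m (\<lambda>(i, j). A $$ (p i, p j))"
  define B2 where "B2 = mat (n - m) (n - m) (\<lambda>(i, j). A $$ (p (i + m), p (j + m)))"
  have z1: "A $$ (p i, p j) = 0" if "i < m" "m \<le> j" "j < n" for i j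
    using U(3) pU[OF that(1)] pV[OF that(2,3)] unfolding closed_under_def by blast
  have z2: "A $$ (p j, p i) = 0" if "i < m" "m \<le> j" "j < n" for i j
    using z1[OF that] herm pU[OF that(1)] pV[OF that(2,3)] U(1) unfolding hermitian_def
    by (metis DiffD1 complex_cnj_zero lessThan_iff subsetD)
  have "P * A * transpose_mat P = mat n n (\<lambda>(i, j). A $$ (p i, p j))"
    by (rule permutation_conjugate[OF A p]) (rule P_def)
  also have "\<dots> = diag_block_mat [B1, B2]"
  proof (rule eq_matI)
    fix i j assume "i < dim_row (diag_block_mat [B1, B2])" "j < dim_col (diag_block_mat [B1, B2])"
    then have ij: "i < n" "j < n" using mn by (simp_all add: dim_diag_block_mat B1_def B2_def)
    then show "mat n n (\<lambda>(i, j). A $$ (p i, p j)) $$ (i, j) = diag_block_mat [B1, B2] $$ (i, j)"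
      using mn z1 z2 by (auto simp: Let_def B1_def B2_def not_less)
  qed (use mn in \<open>simp_all add: dim_diag_block_mat B1_def B2_def\<close>)
  finally have "P * A * transpose_mat P = diag_block_mat [B1, B2]" .
  moreover have "permutation_matrix (dim_row A) P"
    unfolding permutation_matrix_def using A p P_def by auto
  moreover have "\<forall>B\<in>set [B1, B2]. square_mat B \<and> dim_row B > 0"
    using m0 mn by (simp add: B1_def B2_def)
  moreover have "length [B1, B2] > 1" by simp
  ultimately show False using conn unfolding connected_mat_def by blast
qed

text \<open>The vertices of the first block form a closed set, which is proper because blocks are
  nonempty. All later blocks are merged into the single matrix \<open>D\<close>.\<close>

lemma closed_connected_mat:
  assumes A: "A \<in> carrier_mat n n"
    and closed: "\<And>U. U \<subseteq> {..<n} \<Longrightarrow> U \<noteq> {} \<Longrightarrow> closed_under n (\<lambda>i j. A $$ (i, j)) U \<Longrightarrow> U = {..<n}"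
  shows "connected_mat A"
  unfolding connected_mat_def
proof
  assume "\<exists>P Bs. permutation_matrix (dim_row A) P \<and> length Bs > 1 \<and>
    (\<forall>B\<in>set Bs. square_mat B \<and> dim_row B > 0) \<and> P * A * transpose_mat P = diag_block_mat Bs"
  then obtain P Bs p where len: "length Bs > 1"
    and Bs: "\<And>B. B \<in> set Bs \<Longrightarrow> square_mat B \<and> dim_row B > 0"
    and eq: "P * A * transpose_mat P = diag_block_mat Bs"
    and p: "p permutes {..<n}" and P: "P = mat n n (\<lambda>(i, j). if j = p i then 1 else 0)"
    unfolding permutation_matrix_def using A by auto
  obtain B1 B2 Bs' where B: "Bs = B1 # B2 # Bs'"
    using len by (metis One_nat_def length_0_conv length_Suc_conv less_one list.exhaust not_less_iff_gr_or_eq not_one_less_zero)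
  define D where "D = diag_block_mat (B2 # Bs')"
  define m where "m = dim_row B1"
  have sq: "dim_col B1 = m" "m > 0" using Bs[of B1] by (simp_all add: B m_def)
  have eqn: "mat n n (\<lambda>(i, j). A $$ (p i, p j)) =
      four_block_mat B1 (0\<^sub>m m (dim_col D)) (0\<^sub>m (dim_row D) m) D"
    using eq permutation_conjugate[OF A p P] by (simp add: B Let_def D_def m_def sq)
  then have "n = m + dim_row D" "n = m + dim_col D"
    by (metis dim_col_mat(1) dim_row_mat(1) index_mat_four_block(2,3) m_def sq(1))+
  moreover have "dim_row D > 0"
    using Bs[of B2] by (simp add: D_def B dim_diag_block_mat)
  ultimately have mn: "m < n" and D: "dim_col D = n - m" "dim_row D = n - m" by auto
  have zero: "A $$ (p i, p j) = 0" if "i < m" "m \<le> j" "j < n" for i j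
  proof -
    have "mat n n (\<lambda>(i, j). A $$ (p i, p j)) $$ (i, j) = 0"
      unfolding eqn using that D mn sq by (simp add: m_def)
    then show ?thesis using that mn by simp
  qed
  have bp: "bij_betw p {..<n} {..<n}" using p by (rule permutes_imp_bij)
  have "closed_under n (\<lambda>i j. A $$ (i, j)) (p ` {..<m})"
    unfolding closed_under_def
  proof (intro ballI allI impI)
    fix i j assume i: "i \<in> p ` {..<m}" and j: "j < n" "A $$ (i, j) \<noteq> 0"
    obtain j' where j': "j' < n" "j = p j'" using bp j(1) unfolding bij_betw_def by blast
    then show "j \<in> p ` {..<m}" using zero i j by (cases "j' < m") auto
  qed
  moreover have "p ` {..<m} \<subseteq> {..<n}" using bp mn unfolding bij_betw_def by auto
  ultimately have "p ` {..<m} = {..<n}" using closed[of "p ` {..<m}"] sq(2) by blast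
  then have "card {..<n} \<le> card {..<m}" by (metis card_image_le finite_lessThan)
  then show False using mn by simp
qed

section \<open>Extension by one vertex\<close>

definition unit_fun :: "nat \<Rightarrow> nat \<Rightarrow> complex" where
  "unit_fun u i = (if i = u then 1 else 0)"

definition border :: "nat \<Rightarrow> (nat \<Rightarrow> nat \<Rightarrow> complex) \<Rightarrow> (nat \<Rightarrow> complex) \<Rightarrow> complex \<Rightarrow> nat \<Rightarrow> nat \<Rightarrow> complex" where
  "border n a c r i j = (if i < n then if j < n then a i j else c i
     else if j < n then cnj (c j) else r)"

lemma apply_unit_fun: "u < n \<Longrightarrow> apply_mat n a (unit_fun u) i = a i u"
  by (simp add: apply_mat_def unit_fun_def if_distrib[of "\<lambda>x. _ * x"] cong: if_cong)

lemma iprod_unit_fun: "u < n \<Longrightarrow> iprod n x (unit_fun u) = x u"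
  by (simp add: iprod_def unit_fun_def if_distrib[of cnj] if_distrib[of "\<lambda>y. _ * y"] cong: if_cong)

lemma iprod_border:
  "iprod (Suc n) (apply_mat (Suc n) (border n a c r) z) z =
    iprod n (apply_mat n a z) z + z n * iprod n c z + cnj (z n) * iprod n z c + r * (z n * cnj (z n))"
proof -
  have "apply_mat (Suc n) (border n a c r) z i = apply_mat n a z i + z n * c i" if "i < n" for i
    using that by (simp add: apply_mat_def border_def mult.commute)
  then have "iprod n (apply_mat (Suc n) (border n a c r) z) z =
      iprod n (\<lambda>i. apply_mat n a z i + z n * c i) z"
    by (intro iprod_cong) simp_all
  also have "\<dots> = iprod n (apply_mat n a z) z + z n * iprod n c z"
    by (simp only: iprod_add_left iprod_scale_left)
  finally have 1: "iprod n (apply_mat (Suc n) (border n a c r) z) z =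
    iprod n (apply_mat n a z) z + z n * iprod n c z" .
  have 2: "apply_mat (Suc n) (border n a c r) z n = iprod n z c + r * z n"
    by (simp add: apply_mat_def border_def iprod_def mult.commute)
  have "iprod (Suc n) (apply_mat (Suc n) (border n a c r) z) z =
      iprod n (apply_mat (Suc n) (border n a c r) z) z + apply_mat (Suc n) (border n a c r) z n * cnj (z n)"
    by (simp add: iprod_def)
  then show ?thesis unfolding 1 2 by (simp add: algebra_simps)
qed

text \<open>With \<open>q = \<kappa> (2 - A) e\<^sub>u\<close> the new column is
  \<open>(2 + A) q\<close>, and the normalisation of \<open>\<kappa>\<close> makes the form of
  \<open>2 + A\<close> at \<open>q\<close> equal to \<open>2 + r\<close>. So the bordered form at
  \<open>z\<close> is the form of \<open>2 + A\<close> at \<open>z + z\<^sub>n q\<close>.\<close>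

lemma border_form_nonneg:
  assumes herm: "hermitian n a" and u: "u < n"
    and pos: "\<And>x. 2 * sqnorm n x + Re (iprod n (apply_mat n a x) x) \<ge> 0"
    and S_def: "S = (\<lambda>i. 4 * unit_fun u i - apply_mat n a (apply_mat n a (unit_fun u)) i)"
    and k: "(cmod \<kappa>)\<^sup>2 * Re (S u) = 1"
  shows "2 * sqnorm (Suc n) z + Re (iprod (Suc n) (apply_mat (Suc n)
    (border n a (\<lambda>i. \<kappa> * S i) (- of_real ((cmod \<kappa>)\<^sup>2 * Re (apply_mat n a S u)))) z) z) \<ge> 0"
proof -
  let ?T = "apply_mat n a"
  let ?e = "unit_fun u"
  define c where "c = (\<lambda>i. \<kappa> * S i)"
  define r where "r = - ((cmod \<kappa>)\<^sup>2 * Re (?T S u))"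
  define q0 where "q0 = (\<lambda>i. 2 * ?e i + (-1) * ?T ?e i)"
  define q where "q = (\<lambda>i. \<kappa> * q0 i)"
  have Tq0: "?T q0 = (\<lambda>i. 2 * ?T ?e i + (-1) * ?T (?T ?e) i)"
    unfolding q0_def apply_mat_add apply_mat_scale by simp
  have cq: "c = (\<lambda>i. 2 * q i + ?T q i)"
    unfolding q_def apply_mat_scale Tq0 by (rule ext) (simp add: c_def S_def q0_def algebra_simps)
  have qq: "2 * sqnorm n q + Re (iprod n (?T q) q) = 2 + r"
  proof -
    have "of_real (2 * sqnorm n q) + iprod n (?T q) q = iprod n c q"
      unfolding cq iprod_add_left iprod_scale_left iprod_self by simp
    also have "\<dots> = of_real ((cmod \<kappa>)\<^sup>2) * iprod n S q0"
      unfolding c_def q_def iprod_scale_left iprod_scale_right complex_norm_square by simp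
    also have "iprod n S q0 = 2 * S u - iprod n S (?T ?e)"
      unfolding q0_def iprod_add_right iprod_scale_right iprod_unit_fun[OF u] by simp
    also have "iprod n S (?T ?e) = ?T S u"
      unfolding iprod_apply[OF herm, symmetric] iprod_unit_fun[OF u] ..
    finally have "Re (of_real (2 * sqnorm n q) + iprod n (?T q) q)
        = (cmod \<kappa>)\<^sup>2 * (2 * Re (S u) - Re (?T S u))" by simp
    then show ?thesis using k unfolding r_def by (simp add: algebra_simps)
  qed
  define t where "t = z n"
  have "0 \<le> 2 * sqnorm n (\<lambda>i. z i + t * q i) + Re (iprod n (?T (\<lambda>i. z i + t * q i)) (\<lambda>i. z i + t * q i))"
    by (rule pos)
  also have "\<dots> = 2 * sqnorm n z + Re (iprod n (?T z) z) + (cmod t)\<^sup>2 * (2 * sqnorm n q + Re (iprod n (?T q) q))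
      + 2 * Re (cnj t * iprod n z c)"
  proof -
    have "iprod n (?T q) z = cnj (iprod n z (?T q))" by (rule iprod_commute)
    then have "Re (t * iprod n (?T q) z) = Re (cnj t * iprod n z (?T q))" by simp
    moreover have "Re (t * iprod n (?T q) (\<lambda>i. t * q i)) = (cmod t)\<^sup>2 * Re (iprod n (?T q) q)"
    proof -
      have *: "t * (cnj t * x) = of_real ((cmod t)\<^sup>2) * x" for x
        by (simp only: complex_norm_square mult.assoc)
      show ?thesis unfolding iprod_scale_right * by simp
    qed
    moreover have "iprod n (?T z) q = iprod n z (?T q)" by (rule iprod_apply[OF herm])
    moreover have "iprod n z c = 2 * iprod n z q + iprod n z (?T q)"
      unfolding cq iprod_add_right iprod_scale_right by simp
    ultimately show ?thesis
      unfolding apply_mat_add apply_mat_scale iprod_add_left iprod_scale_left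
      unfolding iprod_add_right sqnorm_add sqnorm_scale
      by (simp add: iprod_scale_right algebra_simps)
  qed
  also have "\<dots> = 2 * sqnorm (Suc n) z + Re (iprod (Suc n) (apply_mat (Suc n) (border n a c (of_real r)) z) z)"
  proof -
    have "iprod n c z = cnj (iprod n z c)" by (rule iprod_commute)
    then have "Re (t * iprod n c z) = Re (cnj t * iprod n z c)" by simp
    moreover have "Re (of_real r * (t * cnj t)) = r * (cmod t)\<^sup>2"
      by (simp flip: complex_norm_square of_real_power)
    moreover have "sqnorm (Suc n) z = sqnorm n z + (cmod t)\<^sup>2" by (simp add: sqnorm_def t_def)
    ultimately show ?thesis
      unfolding iprod_border qq t_def[symmetric] by (simp add: algebra_simps)
  qed
  finally show ?thesis by (simp add: c_def r_def)
qed

text \<open>For the diagonal entry of a border, which has to be a charge.\<close>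

lemma Zomega_real_cases:
  assumes "of_real r \<in> Zomega" "r\<^sup>2 < 4"
  shows "r \<in> {0, 1, -1}"
proof -
  have "of_real r \<in> {0, 1, -1, \<omega>, -\<omega>, cnj \<omega>, -cnj \<omega>, 2, -2, 1 + \<omega>, - 1 - \<omega>, 1 + cnj \<omega>, - 1 - cnj \<omega>}"
    using assms by (intro Zomega_norm_cases) (simp_all add: power2_abs)
  then show ?thesis using assms(2) by (auto simp: complex_eq_iff)
qed

lemma pick_lessThan: "i < n \<Longrightarrow> pick {..<n} i = i"
proof -
  assume "i < n"
  moreover from this have "{a \<in> {..<n}. a < i} = {..<i}" by auto
  ultimately show ?thesis using pick_card_in_set[of i "{..<n}"] by simp
qed

lemma hermitian_square_cnj:
  assumes herm: "hermitian n a" and "i < n" "k < n"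
  shows "cnj (\<Sum>j<n. a k j * a j i) = (\<Sum>j<n. a i j * a j k)"
  unfolding cnj_sum
proof (rule sum.cong)
  fix j assume "j \<in> {..<n}"
  then have "a i j = cnj (a j i)" "a j k = cnj (a k j)"
    using assms unfolding hermitian_def by blast+
  then show "cnj (a k j * a j i) = a i j * a j k" by simp
qed simp

lemma hermitian_square_diag:
  assumes herm: "hermitian n a" and "i < n"
  shows "(\<Sum>j<n. a i j * a j i) = of_real (\<Sum>j<n. (cmod (a i j))\<^sup>2)"
  unfolding of_real_sum
proof (rule sum.cong)
  fix j assume "j \<in> {..<n}"
  then have "a j i = cnj (a i j)" using assms unfolding hermitian_def by blast
  then show "a i j * a j i = of_real ((cmod (a i j))\<^sup>2)" by (simp only: complex_norm_square)
qed simp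

lemma sqnorm_unit_fun: "u < n \<Longrightarrow> sqnorm n (unit_fun u) = 1"
  using iprod_unit_fun[of u n "unit_fun u"] iprod_self[of n "unit_fun u"] by (simp add: unit_fun_def)

lemma sqnorm_apply_unit_fun:
  assumes "hermitian n a" "u < n"
  shows "sqnorm n (apply_mat n a (unit_fun u)) = (\<Sum>j<n. (cmod (a u j))\<^sup>2)"
  unfolding sqnorm_def apply_unit_fun[OF assms(2)]
proof (rule sum.cong)
  fix j assume "j \<in> {..<n}"
  then have "a j u = cnj (a u j)" using assms unfolding hermitian_def by blast
  then show "(cmod (a j u))\<^sup>2 = (cmod (a u j))\<^sup>2" by simp
qed simp

text \<open>The weight of row \<open>u\<close> is the squared length of the image of the unit vector
  at \<open>u\<close>.\<close>

lemma weight_le_4: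
  assumes "hermitian n a" "\<And>y. sqnorm n (apply_mat n a y) \<le> 4 * sqnorm n y" "u < n"
  shows "(\<Sum>j<n. (cmod (a u j))\<^sup>2) \<le> 4"
  using assms(2)[of "unit_fun u"] by (simp add: sqnorm_apply_unit_fun sqnorm_unit_fun assms)

text \<open>Weight 4 means that the unit vector at \<open>u\<close> attains the bound, so
  \<open>A\<^sup>2 e\<^sub>u = 4 e\<^sub>u\<close> by \<open>extremal_vector_square\<close>. The
  components away from \<open>u\<close> are the inner products of rows.\<close>

lemma saturated_orthogonal:
  assumes herm: "hermitian n a" and bound: "\<And>y. sqnorm n (apply_mat n a y) \<le> 4 * sqnorm n y"
    and u: "u < n" and k: "k < n" "k \<noteq> u" and sat: "(\<Sum>j<n. (cmod (a u j))\<^sup>2) = 4"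
  shows "(\<Sum>j<n. a u j * a j k) = 0"
proof -
  have "apply_mat n a (apply_mat n a (unit_fun u)) k = of_real 4 * unit_fun u k"
    by (rule extremal_vector_square[OF herm bound _ k(1)])
      (simp add: sqnorm_apply_unit_fun[OF herm u] sqnorm_unit_fun[OF u] sat)
  then have "(\<Sum>j<n. a k j * a j u) = 0"
    using k(2) by (simp add: apply_mat_def[of n a "apply_mat n a _"] apply_unit_fun[OF u] unit_fun_def)
  then show ?thesis using hermitian_square_cnj[OF herm u k(1)] by simp
qed

text \<open>The new row is \<open>\<kappa> (4 - A\<^sup>2) e\<^sub>u\<close>. It works because \<open>2 + A\<close> and \<open>2 - A\<close> are positive
  semidefinite and the new vertex is represented by \<open>\<kappa> (2 - A) e\<^sub>u\<close>, respectively
  \<open>- \<kappa> (2 + A) e\<^sub>u\<close>, in the two corresponding Gram representations.\<close>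

lemma maximal_no_extension:
  assumes max: "maximal_cyclotomic (-7) A" and n: "n = dim_row A" and u: "u < n"
    and a_def: "a = (\<lambda>i j. A $$ (i, j))"
    and S_def: "S = (\<lambda>i. 4 * unit_fun u i - (\<Sum>j<n. a i j * a j u))"
    and k: "(cmod \<kappa>)\<^sup>2 * (4 - (\<Sum>j<n. (cmod (a u j))\<^sup>2)) = 1"
    and int: "\<And>i. i < n \<Longrightarrow> \<kappa> * S i \<in> Zomega"
    and int2: "of_real ((cmod \<kappa>)\<^sup>2 * Re (\<Sum>j<n. a u j * S j)) \<in> Zomega"
  shows False
proof -
  have L: "L_graph (-7) A" and conn: "connected_mat A" and cyc: "cyclotomic A"
    and nex: "\<And>G. L_graph (-7) G \<Longrightarrow> connected_mat G \<Longrightarrow> cyclotomic G \<Longrightarrow>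
      dim_row G > n \<Longrightarrow> contained_in A G \<Longrightarrow> False"
    using max n unfolding maximal_cyclotomic_def by blast+
  have A: "A \<in> carrier_mat n n" using L n unfolding L_graph_def by auto
  have herm: "hermitian n a"
    using L hermitian_adjoint n unfolding L_graph_def a_def by blast
  then have conj: "a j i = cnj (a i j)" if "i < n" "j < n" for i j
    using that unfolding hermitian_def by blast
  have bound: "sqnorm n (apply_mat n a y) \<le> 4 * sqnorm n y" for y
    using cyclotomic_sqnorm_bound[OF A _ cyc] herm unfolding a_def by blast
  have TTe: "apply_mat n a (apply_mat n a (unit_fun u)) i = (\<Sum>j<n. a i j * a j u)" for i
    by (simp add: apply_mat_def[of n a "apply_mat n a _"] apply_unit_fun[OF u])
  have S: "S = (\<lambda>i. 4 * unit_fun u i - apply_mat n a (apply_mat n a (unit_fun u)) i)"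
    unfolding S_def TTe ..
  have Su: "S u = of_real (4 - (\<Sum>j<n. (cmod (a u j))\<^sup>2))"
    by (simp add: S_def unit_fun_def hermitian_square_diag[OF herm u])
  have k': "(cmod \<kappa>)\<^sup>2 * Re (S u) = 1" using k unfolding Su by simp
  define c where "c = (\<lambda>i. \<kappa> * S i)"
  define r where "r = - ((cmod \<kappa>)\<^sup>2 * Re (apply_mat n a S u))"
  define g where "g = border n a c (of_real r)"
  have form1: "2 * sqnorm (Suc n) z + Re (iprod (Suc n) (apply_mat (Suc n) g z) z) \<ge> 0" for z
    using border_form_nonneg[OF herm u sqnorm_bound_form[OF bound] S k', of z]
    unfolding g_def c_def r_def by simp
  have form2: "2 * sqnorm (Suc n) z - Re (iprod (Suc n) (apply_mat (Suc n) g z) z) \<ge> 0" for z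
  proof -
    let ?b = "\<lambda>i j. - a i j"
    have neg: "apply_mat m (\<lambda>i j. - b i j) x = (\<lambda>i. - apply_mat m b x i)" for m b x
      by (rule ext) (simp add: apply_mat_def sum_negf)
    have neg2: "apply_mat m b (\<lambda>i. - x i) = (\<lambda>i. - apply_mat m b x i)" for m b x
      by (rule ext) (simp add: apply_mat_def sum_negf)
    have hb: "hermitian n ?b"
      unfolding hermitian_def using conj by (metis complex_cnj_minus)
    have bb: "sqnorm n (apply_mat n ?b y) \<le> 4 * sqnorm n y" for y
      using bound[of y] unfolding neg sqnorm_def by simp
    have Sb: "S = (\<lambda>i. 4 * unit_fun u i - apply_mat n ?b (apply_mat n ?b (unit_fun u)) i)"
      unfolding S neg neg2 by simp
    \<comment> \<open>The same new column serves \<open>2 - A\<close>: negating both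
      \<open>A\<close> and \<open>\<kappa>\<close> leaves \<open>S\<close> unchanged and negates the
      whole bordered matrix.\<close>
    have "border n ?b (\<lambda>i. - \<kappa> * S i) (- of_real ((cmod (- \<kappa>))\<^sup>2 * Re (apply_mat n ?b S u)))
        = (\<lambda>i j. - g i j)"
      by (intro ext) (simp add: border_def g_def c_def r_def neg)
    then have "2 * sqnorm (Suc n) z + Re (iprod (Suc n) (apply_mat (Suc n) (\<lambda>i j. - g i j) z) z) \<ge> 0"
      using border_form_nonneg[OF hb u sqnorm_bound_form[OF bb] Sb, of "- \<kappa>" z] k' by simp
    then show ?thesis unfolding neg by (simp add: iprod_def sum_negf)
  qed
  define G where "G = mat (Suc n) (Suc n) (\<lambda>(i, j). g i j)"
  have G: "G \<in> carrier_mat (Suc n) (Suc n)" by (simp add: G_def)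
  have hg: "hermitian (Suc n) g"
    unfolding hermitian_def
  proof (intro allI impI)
    fix i j assume ij: "i < Suc n" "j < Suc n"
    show "g j i = cnj (g i j)"
    proof (cases "i < n \<and> j < n")
      case True
      then have "a j i = cnj (a i j)" using conj by blast
      then show ?thesis using True by (simp add: g_def border_def)
    qed (auto simp: g_def border_def)
  qed
  have apG: "apply_mat (Suc n) (\<lambda>i j. G $$ (i, j)) x i = apply_mat (Suc n) g x i" if "i < Suc n" for x i
    unfolding apply_mat_def by (intro sum.cong) (use that in \<open>auto simp: G_def\<close>)
  have hG: "hermitian (Suc n) (\<lambda>i j. G $$ (i, j))"
    unfolding hermitian_def
  proof (intro allI impI)
    fix i j assume "i < Suc n" "j < Suc n"
    moreover from this have "g j i = cnj (g i j)" using hg unfolding hermitian_def by blast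
    ultimately show "G $$ (j, i) = cnj (G $$ (i, j))" by (simp add: G_def)
  qed
  have ipG: "iprod (Suc n) (apply_mat (Suc n) (\<lambda>i j. G $$ (i, j)) x) x = iprod (Suc n) (apply_mat (Suc n) g x) x" for x
    by (intro iprod_cong) (simp_all add: apG)
  have cycG: "cyclotomic G"
    by (rule forms_imp_cyclotomic[OF G hG]) (simp_all only: ipG form1 form2)
  \<comment> \<open>\<open>G\<close> is cyclotomic and so obeys the weight bound itself; the size
    conditions on its labels and on its new charge follow from this.\<close>
  have gw: "(\<Sum>j<Suc n. (cmod (g i j))\<^sup>2) \<le> 4" if "i < Suc n" for i
  proof -
    have "(\<Sum>j<Suc n. (cmod (G $$ (i, j)))\<^sup>2) \<le> 4"
      by (rule weight_le_4[OF hG cyclotomic_sqnorm_bound[OF G hG cycG] that])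
    moreover have "(\<Sum>j<Suc n. (cmod (G $$ (i, j)))\<^sup>2) = (\<Sum>j<Suc n. (cmod (g i j))\<^sup>2)"
      by (intro sum.cong) (use that in \<open>auto simp: G_def\<close>)
    ultimately show ?thesis by simp
  qed
  \<comment> \<open>The new vertex is adjacent to \<open>u\<close>. This yields both
    \<open>r\<^sup>2 < 4\<close> and the connectedness of \<open>G\<close>.\<close>
  have cu: "c u \<noteq> 0"
    using k' by (auto simp: c_def)
  have "(cmod (g n j))\<^sup>2 = (if j < n then (cmod (c j))\<^sup>2 else r\<^sup>2)" for j
    by (simp add: g_def border_def)
  then have "(\<Sum>j<n. (cmod (c j))\<^sup>2) + r\<^sup>2 \<le> 4" using gw[of n] by simp
  moreover have "(cmod (c u))\<^sup>2 \<le> (\<Sum>j<n. (cmod (c j))\<^sup>2)"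
    using u by (intro member_le_sum) auto
  moreover have "(cmod (c u))\<^sup>2 > 0" using cu by simp
  ultimately have "r\<^sup>2 < 4" by linarith
  moreover have "of_real r \<in> Zomega"
    using Zomega_uminus[OF int2] unfolding r_def apply_mat_def by simp
  ultimately have r01: "r \<in> {0, 1, -1}" by (intro Zomega_real_cases)
  have lab: "a i j \<in> Zomega" if "i < n" "j < n" for i j
  proof (cases "i = j")
    case True
    then have "a i j \<in> {0, 1, -1}" using L that n unfolding L_graph_def a_def by blast
    then show ?thesis using Zomega_uminus[of 1] by auto
  next
    case False
    then show ?thesis using L that n label_set_iff unfolding L_graph_def a_def by blast
  qed
  have cZ: "c i \<in> Zomega" if "i < n" for i using int that by (simp add: c_def)
  have rZ: "of_real r \<in> Zomega" by fact
  have gZ: "g i j \<in> Zomega" if "i < Suc n" "j < Suc n" for i j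
    unfolding g_def border_def using lab cZ Zomega_cnj rZ by simp
  have "L_graph (-7) G"
    unfolding L_graph_def
  proof (intro conjI allI impI)
    show "square_mat G" by (simp add: G_def)
    show "mat_adjoint G = G" by (rule adjoint_hermitian[OF G hG])
    fix i assume "i < dim_row G"
    then have i: "i < Suc n" by (simp add: G_def)
    show "G $$ (i, i) \<in> {0, 1, -1}"
    proof (cases "i < n")
      case True
      then have "a i i \<in> {0, 1, -1}" using L n unfolding L_graph_def a_def by blast
      then show ?thesis using True by (simp add: G_def g_def border_def)
    next
      case False
      then show ?thesis using r01 i by (auto simp: G_def g_def border_def)
    qed
    fix j assume "j < dim_row G" "i \<noteq> j"
    then have j: "j < Suc n" by (simp add: G_def)
    have "(cmod (g i j))\<^sup>2 \<le> (\<Sum>j<Suc n. (cmod (g i j))\<^sup>2)"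
      using j by (intro member_le_sum) auto
    then have "(cmod (g i j))\<^sup>2 \<le> 4" using gw[OF i] by linarith
    then show "G $$ (i, j) \<in> label_set (-7)"
      using gZ[OF i j] i j by (simp add: label_set_iff G_def)
  qed
  moreover have "connected_mat G"
  proof (rule closed_connected_mat[OF G])
    fix U assume U: "U \<subseteq> {..<Suc n}" "U \<noteq> {}" "closed_under (Suc n) (\<lambda>i j. G $$ (i, j)) U"
    have step: "j \<in> U" if "i \<in> U" "j < Suc n" "g i j \<noteq> 0" for i j
      using U(1,3) that unfolding closed_under_def by (auto simp: G_def)
    have nu: "n \<in> U \<longleftrightarrow> u \<in> U"
      using step[of n u] step[of u n] cu u by (auto simp: g_def border_def)
    have "closed_under n (\<lambda>i j. A $$ (i, j)) (U \<inter> {..<n})"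
      unfolding closed_under_def
    proof (intro ballI allI impI)
      fix i j assume "i \<in> U \<inter> {..<n}" "j < n" "A $$ (i, j) \<noteq> 0"
      then show "j \<in> U \<inter> {..<n}" using step[of i j] by (auto simp: g_def border_def a_def)
    qed
    moreover have "U \<inter> {..<n} \<noteq> {}"
      using U(1,2) nu u by (auto simp: lessThan_Suc)
    ultimately have "U \<inter> {..<n} = {..<n}"
      using connected_mat_closed[OF A herm[unfolded a_def] conn, of "U \<inter> {..<n}"] by blast
    then show "U = {..<Suc n}" using nu u U(1) by (auto simp: lessThan_Suc)
  qed
  moreover have "contained_in A G"
    unfolding contained_in_def
  proof (intro exI conjI)
    have card: "card {i. i < Suc n \<and> i \<in> {..<n}} = n"
    proof -
      have "{i. i < Suc n \<and> i \<in> {..<n}} = {..<n}" by auto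
      then show ?thesis by simp
    qed
    show "A = submatrix G {..<n} {..<n}"
    proof (rule eq_matI)
      fix i j assume "i < dim_row (submatrix G {..<n} {..<n})" "j < dim_col (submatrix G {..<n} {..<n})"
      then have ij: "i < n" "j < n" using G card by (simp_all add: dim_submatrix)
      then show "A $$ (i, j) = submatrix G {..<n} {..<n} $$ (i, j)"
        using G card by (simp add: submatrix_index pick_lessThan) (simp add: G_def g_def border_def a_def)
    qed (use A G card in \<open>simp_all add: dim_submatrix\<close>)
    show "{..<n} \<subseteq> {..<dim_row G}" using G by auto
  qed
  ultimately show False using nex[of G] cycG G by auto
qed

section \<open>Rows of a maximal graph\<close>

definition row_weight :: "nat \<Rightarrow> (nat \<Rightarrow> nat \<Rightarrow> complex) \<Rightarrow> nat \<Rightarrow> real" where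
  "row_weight n a i = (\<Sum>j<n. (cmod (a i j))\<^sup>2)"

text \<open>The last two weight conditions are obstructions to extending the graph with \<open>\<kappa> = 1\<close> and with
  \<open>\<kappa> = 1 / cnj p\<close>, respectively.\<close>

locale tight =
  fixes n :: nat and a :: "nat \<Rightarrow> nat \<Rightarrow> complex"
  assumes herm: "i < n \<Longrightarrow> j < n \<Longrightarrow> a j i = cnj (a i j)"
    and diag: "i < n \<Longrightarrow> a i i \<in> {0, 1, -1}"
    and entry: "i < n \<Longrightarrow> j < n \<Longrightarrow> a i j \<in> Zomega"
    and weight_le: "i < n \<Longrightarrow> row_weight n a i \<le> 4"
    and orth: "i < n \<Longrightarrow> k < n \<Longrightarrow> k \<noteq> i \<Longrightarrow> row_weight n a i = 4 \<Longrightarrow> (\<Sum>j<n. a i j * a j k) = 0"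
    and weight_ne_3: "i < n \<Longrightarrow> row_weight n a i \<noteq> 3"
    and weight_2: "i < n \<Longrightarrow> row_weight n a i = 2 \<Longrightarrow> p \<in> Zomega \<Longrightarrow> (cmod p)\<^sup>2 = 2 \<Longrightarrow>
      (\<And>k. k < n \<Longrightarrow> k \<noteq> i \<Longrightarrow> \<exists>w\<in>Zomega. (\<Sum>j<n. a i j * a j k) = p * w) \<Longrightarrow> False"
    and conn: "U \<subseteq> {..<n} \<Longrightarrow> U \<noteq> {} \<Longrightarrow> closed_under n a U \<Longrightarrow> U = {..<n}"

lemma Zomega_real_int:
  assumes "x \<in> Zomega" "Im x = 0"
  shows "\<exists>m. x = of_int m"
proof -
  obtain m k where x: "x = of_int m + of_int k * \<omega>" using assms(1) unfolding Zomega_def by blast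
  then have "k = 0" using assms(2) by simp
  then show ?thesis using x by auto
qed

lemma Zomega_sqnorm_int:
  assumes "x \<in> Zomega"
  shows "\<exists>m. (cmod x)\<^sup>2 = real_of_int m"
  using assms cmod2_int_omega unfolding Zomega_def by blast

lemma Im_iprod_apply: "hermitian n a \<Longrightarrow> Im (iprod n (apply_mat n a x) x) = 0"
  using iprod_apply[of n a x x] iprod_commute[of n x "apply_mat n a x"]
  by (metis complex_cnj_cancel_iff complex_cnj_complex_of_real complex_cnj_cnj Reals_cnj_iff complex_is_Real_iff)

lemma maximal_tight:
  assumes max: "maximal_cyclotomic (-7) A" and n: "n = dim_row A"
  shows "tight n (\<lambda>i j. A $$ (i, j))"
proof -
  define a where "a = (\<lambda>i j. A $$ (i, j))"
  have L: "L_graph (-7) A" and conn: "connected_mat A" and cyc: "cyclotomic A"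
    using max unfolding maximal_cyclotomic_def by blast+
  have A: "A \<in> carrier_mat n n" using L n unfolding L_graph_def by auto
  have herm: "hermitian n a"
    using L hermitian_adjoint n unfolding L_graph_def a_def by blast
  then have conj: "a j i = cnj (a i j)" if "i < n" "j < n" for i j
    using that unfolding hermitian_def by blast
  have bound: "sqnorm n (apply_mat n a y) \<le> 4 * sqnorm n y" for y
    using cyclotomic_sqnorm_bound[OF A _ cyc] herm unfolding a_def by blast
  have diag: "a i i \<in> {0, 1, -1}" if "i < n" for i
    using L that n unfolding L_graph_def a_def by blast
  have entry: "a i j \<in> Zomega" if "i < n" "j < n" for i j
  proof (cases "i = j")
    case True
    then show ?thesis using Zomega_uminus[of 1] diag[OF that(1)] by auto
  next
    case False
    then show ?thesis using L that n label_set_iff unfolding L_graph_def a_def by blast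
  qed
  \<comment> \<open>This is the \<open>(u, u)\<close> entry of the Hermitian matrix
    \<open>A (4 - A\<^sup>2)\<close>, so the real part taken in the new charge loses
    nothing.\<close>
  have real: "Im (\<Sum>j<n. a u j * (4 * unit_fun u j - (\<Sum>l<n. a j l * a l u))) = 0" if u: "u < n" for u
  proof -
    let ?T = "apply_mat n a" and ?e = "unit_fun u"
    have TTe: "?T (?T ?e) i = (\<Sum>j<n. a i j * a j u)" for i
      by (simp add: apply_mat_def[of n a "?T _"] apply_unit_fun[OF u])
    have "(\<Sum>j<n. a u j * (4 * ?e j - (\<Sum>l<n. a j l * a l u))) = ?T (\<lambda>j. 4 * ?e j + (-1) * ?T (?T ?e) j) u"
      unfolding TTe by (simp add: apply_mat_def)
    also have "\<dots> = 4 * ?T ?e u - ?T (?T (?T ?e)) u"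
      unfolding apply_mat_add apply_mat_scale by simp
    also have "\<dots> = 4 * iprod n (?T ?e) ?e - iprod n (?T (?T ?e)) (?T ?e)"
      unfolding iprod_apply[OF herm, symmetric, of "?T (?T ?e)"] iprod_unit_fun[OF u] ..
    finally show ?thesis using Im_iprod_apply[OF herm] by simp
  qed
  show ?thesis unfolding a_def[symmetric]
  proof
    show "a j i = cnj (a i j)" if "i < n" "j < n" for i j by (rule conj[OF that])
    show "a i i \<in> {0, 1, -1}" if "i < n" for i by (rule diag[OF that])
    show "a i j \<in> Zomega" if "i < n" "j < n" for i j by (rule entry[OF that])
    show "row_weight n a i \<le> 4" if "i < n" for i
      unfolding row_weight_def by (rule weight_le_4[OF herm bound that])
    show "(\<Sum>j<n. a i j * a j k) = 0" if "i < n" "k < n" "k \<noteq> i" "row_weight n a i = 4" for i k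
      using saturated_orthogonal[OF herm bound that(1-3)] that(4) unfolding row_weight_def by blast
    show "U = {..<n}" if "U \<subseteq> {..<n}" "U \<noteq> {}" "closed_under n a U" for U
      using connected_mat_closed[OF A herm[unfolded a_def] conn that(1,2)] that(3)
      unfolding a_def by blast
    show "row_weight n a u \<noteq> 3" if u: "u < n" for u
    proof
      assume w: "row_weight n a u = 3"
      let ?S = "\<lambda>i. 4 * unit_fun u i - (\<Sum>j<n. a i j * a j u)"
      have S: "?S i \<in> Zomega" if "i < n" for i
        using that u Zomega_of_int[of 4]
        by (intro Zomega_diff Zomega_sum Zomega_mult entry) (auto simp: unit_fun_def)
      have x: "(\<Sum>j<n. a u j * ?S j) \<in> Zomega"
        using u S by (intro Zomega_sum Zomega_mult entry) auto
      have "of_real (Re (\<Sum>j<n. a u j * ?S j)) = (\<Sum>j<n. a u j * ?S j)"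
        using real[OF u] by (simp add: complex_eq_iff)
      then have x': "of_real ((cmod 1)\<^sup>2 * Re (\<Sum>j<n. a u j * ?S j)) \<in> Zomega"
        using x by (simp only: norm_one one_power2 mult_1)
      show False
        by (rule maximal_no_extension[OF max n u a_def refl _ _ x'])
          (use w S in \<open>simp_all add: row_weight_def\<close>)
    qed
    show False if u: "u < n" and w: "row_weight n a u = 2" and p: "p \<in> Zomega" "(cmod p)\<^sup>2 = 2"
      and dv: "\<And>k. k < n \<Longrightarrow> k \<noteq> u \<Longrightarrow> \<exists>w\<in>Zomega. (\<Sum>j<n. a u j * a j k) = p * w" for u p
    proof -
      let ?S = "\<lambda>i. 4 * unit_fun u i - (\<Sum>j<n. a i j * a j u)"
      have pp: "p * cnj p = 2" using p(2) complex_norm_square[of p] by simp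
      then have p0: "p \<noteq> 0" by auto
      \<comment> \<open>Its squared absolute value is the required \<open>1 / (4 - 2)\<close>. The
        conjugate appears because \<open>p\<close> divides row \<open>u\<close> of
        \<open>A\<^sup>2\<close>, while the border uses column \<open>u\<close>.\<close>
      define k where "k = 1 / cnj p"
      have kp: "(cmod k)\<^sup>2 = 1 / 2" using p(2) by (simp add: k_def norm_divide power_divide)
      have Su: "?S u = 2"
        using w hermitian_square_diag[OF herm u] by (simp add: unit_fun_def row_weight_def)
      have S: "k * ?S i \<in> Zomega" if i: "i < n" for i
      proof (cases "i = u")
        case True
        have "k * 2 = p" using pp p0 by (simp add: k_def field_simps)
        then show ?thesis using p(1) Su unfolding True by simp
      next
        case False
        obtain v where v: "v \<in> Zomega" "(\<Sum>j<n. a u j * a j i) = p * v" using dv[OF i False] by blast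
        have "cnj (\<Sum>j<n. a u j * a j i) = (\<Sum>j<n. a i j * a j u)"
          by (rule hermitian_square_cnj[OF herm i u])
        then have "?S i = - cnj (p * v)" using v(2) False by (simp add: unit_fun_def)
        then have "k * ?S i = - cnj v" using p0 by (simp add: k_def)
        then show ?thesis using v(1) Zomega_cnj Zomega_uminus by simp
      qed
      let ?x = "\<Sum>j<n. a u j * ?S j"
      \<comment> \<open>Up to sign the new charge is half of \<open>?x\<close>. As an integer of the
        form \<open>cnj p * y\<close> with integral \<open>y\<close>, \<open>?x\<close> has a square
        that is twice a norm, so it is even.\<close>
      define y where "y = (\<Sum>j<n. a u j * (k * ?S j))"
      have yZ: "y \<in> Zomega" unfolding y_def using u by (intro Zomega_sum Zomega_mult[OF entry S]) auto
      have xy: "?x = cnj p * y"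
        unfolding y_def sum_distrib_left using p0 by (intro sum.cong) (auto simp: k_def)
      then have "?x \<in> Zomega" using yZ p(1) Zomega_mult Zomega_cnj by metis
      then obtain m where m: "?x = of_int m" using Zomega_real_int real[OF u] by blast
      obtain l where l: "(cmod y)\<^sup>2 = real_of_int l" using Zomega_sqnorm_int[OF yZ] by blast
      have "(cmod ?x)\<^sup>2 = 2 * (cmod y)\<^sup>2"
        unfolding xy using p(2) by (simp add: norm_mult power_mult_distrib)
      then have "(real_of_int m)\<^sup>2 = 2 * real_of_int l" unfolding m l by simp
      then have "m\<^sup>2 = 2 * l"
        by (metis of_int_eq_iff of_int_mult of_int_numeral of_int_power)
      then have "even (m\<^sup>2)" by simp
      then have "even m" by simp
      then obtain h where h: "m = 2 * h" by blast
      have "of_real ((cmod k)\<^sup>2 * Re ?x) = (of_int h :: complex)"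
        unfolding kp m h by (simp add: complex_eq_iff)
      then have x': "of_real ((cmod k)\<^sup>2 * Re ?x) \<in> Zomega" by (simp only: Zomega_of_int)
      show False
        by (rule maximal_no_extension[OF max n u a_def refl _ _ x'])
          (use w S kp in \<open>simp_all add: row_weight_def\<close>)
    qed
  qed
qed

section \<open>Symmetries of the conditions in \<open>tight\<close>\<close>

lemma (in tight) tight_cnj: "tight n (\<lambda>i j. cnj (a i j))"
proof -
  have W: "row_weight n (\<lambda>i j. cnj (a i j)) i = row_weight n a i" for i
    by (simp add: row_weight_def)
  have sums: "(\<Sum>j<n. cnj (a i j) * cnj (a j k)) = cnj (\<Sum>j<n. a i j * a j k)" for i k
    by simp
  show ?thesis
  proof
    show "cnj (a j i) = cnj (cnj (a i j))" if "i < n" "j < n" for i j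
      using herm[OF that] by simp
    show "cnj (a i i) \<in> {0, 1, -1}" if "i < n" for i using diag[OF that] by auto
    show "cnj (a i j) \<in> Zomega" if "i < n" "j < n" for i j using entry[OF that] by (rule Zomega_cnj)
    show "U = {..<n}" if "U \<subseteq> {..<n}" "U \<noteq> {}" "closed_under n (\<lambda>i j. cnj (a i j)) U" for U
      using conn[OF that(1,2)] that(3) by (simp add: closed_under_def)
    show False if "i < n" "row_weight n (\<lambda>i j. cnj (a i j)) i = 2" "p \<in> Zomega" "(cmod p)\<^sup>2 = 2"
      and dv: "\<And>k. k < n \<Longrightarrow> k \<noteq> i \<Longrightarrow> \<exists>w\<in>Zomega. (\<Sum>j<n. cnj (a i j) * cnj (a j k)) = p * w" for i p
    \<comment> \<open>Conjugation exchanges the two primes of norm 2, so divisibility by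
      \<open>p\<close> is traded for divisibility by \<open>cnj p\<close>.\<close>
    proof (rule weight_2[of i "cnj p"])
      fix k assume "k < n" "k \<noteq> i"
      then obtain w where w: "w \<in> Zomega" "cnj (\<Sum>j<n. a i j * a j k) = p * w"
        using dv unfolding sums by blast
      then have "(\<Sum>j<n. a i j * a j k) = cnj p * cnj w"
        by (metis complex_cnj_cnj complex_cnj_mult)
      then show "\<exists>w\<in>Zomega. (\<Sum>j<n. a i j * a j k) = cnj p * w"
        using Zomega_cnj[OF w(1)] by blast
    qed (use that W Zomega_cnj in auto)
    show "(\<Sum>j<n. cnj (a i j) * cnj (a j k)) = 0"
      if "i < n" "k < n" "k \<noteq> i" "row_weight n (\<lambda>i j. cnj (a i j)) i = 4" for i k
      unfolding sums using orth[OF that(1-3)] that(4) unfolding W by simp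
  qed (use W weight_le weight_ne_3 in auto)
qed

text \<open>Switching multiplies every entry of \<open>A\<close> and of \<open>A\<^sup>2\<close> by
  a unit, so weights, vanishing and divisibility are unchanged.\<close>

lemma (in tight) tight_switch:
  assumes t: "\<And>i. t i \<in> {1, -1 :: complex}"
  shows "tight n (\<lambda>i j. t i * t j * a i j)"
proof -
  have t2: "t i * t i = 1" for i using t[of i] by auto
  have tc: "cnj (t i) = t i" "cmod (t i) = 1" for i using t[of i] by auto
  have W: "row_weight n (\<lambda>i j. t i * t j * a i j) i = row_weight n a i" for i
    by (simp add: row_weight_def norm_mult tc)
  have tZ: "t i \<in> Zomega" for i using t[of i] Zomega_uminus[of 1] by auto
  have sums: "(\<Sum>j<n. (t i * t j * a i j) * (t j * t k * a j k)) = t i * t k * (\<Sum>j<n. a i j * a j k)" for i k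
    unfolding sum_distrib_left
  proof (rule sum.cong)
    fix j
    have "(t i * t j * a i j) * (t j * t k * a j k) = t i * t k * (t j * t j) * (a i j * a j k)"
      by (simp add: algebra_simps)
    then show "(t i * t j * a i j) * (t j * t k * a j k) = t i * t k * (a i j * a j k)"
      by (simp add: t2)
  qed simp
  show ?thesis
  proof
    show "t j * t i * a j i = cnj (t i * t j * a i j)" if "i < n" "j < n" for i j
      using herm[OF that] tc by simp
    show "t i * t i * a i i \<in> {0, 1, -1}" if "i < n" for i using diag[OF that] by (simp add: t2)
    show "t i * t j * a i j \<in> Zomega" if "i < n" "j < n" for i j
      by (intro Zomega_mult tZ entry that)
    show "U = {..<n}" if "U \<subseteq> {..<n}" "U \<noteq> {}" "closed_under n (\<lambda>i j. t i * t j * a i j) U" for U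
    proof (rule conn[OF that(1,2)])
      have "t i \<noteq> 0" for i using t[of i] by auto
      then show "closed_under n a U" using that(3) unfolding closed_under_def by simp
    qed
    show False if "i < n" "row_weight n (\<lambda>i j. t i * t j * a i j) i = 2" "p \<in> Zomega" "(cmod p)\<^sup>2 = 2"
      and dv: "\<And>k. k < n \<Longrightarrow> k \<noteq> i \<Longrightarrow> \<exists>w\<in>Zomega. (\<Sum>j<n. t i * t j * a i j * (t j * t k * a j k)) = p * w" for i p
    proof (rule weight_2[of i p])
      fix k assume "k < n" "k \<noteq> i"
      then obtain w where w: "w \<in> Zomega" "t i * t k * (\<Sum>j<n. a i j * a j k) = p * w"
        using dv unfolding sums by blast
      have "(\<Sum>j<n. a i j * a j k) = (t i * t i) * (t k * t k) * (\<Sum>j<n. a i j * a j k)"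
        by (simp add: t2)
      also have "\<dots> = t i * t k * (t i * t k * (\<Sum>j<n. a i j * a j k))"
        by (simp only: mult_ac)
      also have "\<dots> = p * (t i * t k * w)" unfolding w(2) by (simp only: mult_ac)
      finally show "\<exists>w\<in>Zomega. (\<Sum>j<n. a i j * a j k) = p * w"
        using Zomega_mult[OF Zomega_mult[OF tZ tZ] w(1)] by blast
    qed (use that W in auto)
  qed (use W sums weight_le weight_ne_3 orth in \<open>auto\<close>)
qed

text \<open>This is \<open>equivalent_mat\<close> read entrywise: \<open>f\<close> is the choice of
  \<open>X\<close>, and \<open>s\<close> the diagonal of the sign matrix. Only the values of
  \<open>p\<close> below \<open>n\<close> matter, so a list of vertices can act as \<open>p\<close>
  through \<open>nth\<close>.\<close>

definition equiv_entries :: "nat \<Rightarrow> (nat \<Rightarrow> nat \<Rightarrow> complex) \<Rightarrow> complex mat \<Rightarrow> bool" where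
  "equiv_entries n a B \<longleftrightarrow> B \<in> carrier_mat n n \<and>
    (\<exists>f p s. f \<in> {\<lambda>x. x, uminus, cnj, \<lambda>x. - cnj x} \<and> bij_betw p {..<n} {..<n} \<and>
      (\<forall>i. s i \<in> {1, -1}) \<and> (\<forall>i<n. \<forall>j<n. B $$ (i, j) = s i * s j * f (a (p i) (p j))))"

lemma equiv_entries_equivalent_mat:
  assumes A: "A \<in> carrier_mat n n" and eq: "equiv_entries n (\<lambda>i j. A $$ (i, j)) B"
  shows "equivalent_mat A B"
proof -
  obtain f p0 s where f: "f \<in> {\<lambda>x. x, uminus, cnj, \<lambda>x. - cnj x}" and p0: "bij_betw p0 {..<n} {..<n}"
    and s: "\<And>i. s i \<in> {1, -1}"
    and B: "B \<in> carrier_mat n n" "\<And>i j. i < n \<Longrightarrow> j < n \<Longrightarrow> B $$ (i, j) = s i * s j * f (A $$ (p0 i, p0 j))"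
    using eq unfolding equiv_entries_def by blast
  \<comment> \<open>\<open>permutes\<close> asks for the identity outside the index range.\<close>
  define p where "p = (\<lambda>i. if i < n then p0 i else i)"
  have "bij_betw p {..<n} {..<n}"
    using p0 by (subst bij_betw_cong[of _ _ p0]) (auto simp: p_def)
  then have p: "p permutes {..<n}" by (rule bij_imp_permutes) (simp add: p_def)
  have lt: "p i < n" if "i < n" for i using permutes_in_image[OF p, of i] that by simp
  define X where "X = map_mat f A"
  have X: "X \<in> carrier_mat n n" "X \<in> {A, - A, map_mat cnj A, - map_mat cnj A}"
    using A f by (auto simp: X_def intro!: eq_matI)
  define P where "P = mat n n (\<lambda>(i, j). if j = p i then 1 else (0 :: complex))"
  define D where "D = mat_diag n s"
  have P: "P \<in> carrier_mat n n" and D: "D \<in> carrier_mat n n" by (simp_all add: P_def D_def)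
  have "D * P * X * transpose_mat P * D = D * (P * X * transpose_mat P) * D"
    using X P D by (simp add: assoc_mult_mat[of _ n n _ n _ n])
  also have "P * X * transpose_mat P = mat n n (\<lambda>(i, j). X $$ (p i, p j))"
    by (rule permutation_conjugate[OF X(1) p]) (rule P_def)
  also have "D * \<dots> = mat n n (\<lambda>(i, j). s i * X $$ (p i, p j))"
    unfolding D_def by (subst mat_diag_mult_left[of _ n n]) auto
  also have "\<dots> * D = mat n n (\<lambda>(i, j). s i * X $$ (p i, p j) * s j)"
    unfolding D_def by (subst mat_diag_mult_right[of _ n n]) auto
  also have "\<dots> = B"
    using B A lt by (intro eq_matI) (auto simp: X_def p_def)
  finally have "B = D * P * X * transpose_mat P * D" by simp
  moreover have "permutation_matrix (dim_row A) P" "sign_matrix (dim_row A) D"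
    unfolding permutation_matrix_def sign_matrix_def using A p s P_def D_def by auto
  ultimately show ?thesis using X(2) unfolding equivalent_mat_def by blast
qed

text \<open>The four choices of \<open>f\<close> are closed under composition with conjugation, so
  classifying the conjugate graph is enough.\<close>

lemma equiv_entries_cnj:
  assumes "equiv_entries n (\<lambda>i j. cnj (a i j)) B"
  shows "equiv_entries n a B"
proof -
  obtain f p s where f: "f \<in> {\<lambda>x. x, uminus, cnj, \<lambda>x. - cnj x}" "bij_betw p {..<n} {..<n}"
    "\<forall>i. s i \<in> {1, -1}" "\<forall>i<n. \<forall>j<n. B $$ (i, j) = s i * s j * f (cnj (a (p i) (p j)))"
    and B: "B \<in> carrier_mat n n"
    using assms unfolding equiv_entries_def by blast
  have "(\<lambda>x. f (cnj x)) \<in> {\<lambda>x. x, uminus, cnj, \<lambda>x. - cnj x}" using f(1) by auto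
  then show ?thesis using f(2-4) B unfolding equiv_entries_def by blast
qed

lemma equiv_entries_switch:
  assumes t: "\<And>i. t i \<in> {1, -1 :: complex}" and eq: "equiv_entries n (\<lambda>i j. t i * t j * a i j) B"
  shows "equiv_entries n a B"
proof -
  obtain f p s where f: "f \<in> {\<lambda>x. x, uminus, cnj, \<lambda>x. - cnj x}" and p: "bij_betw p {..<n} {..<n}"
    and s: "\<And>i. s i \<in> {1, -1}"
    and B: "B \<in> carrier_mat n n" "\<And>i j. i < n \<Longrightarrow> j < n \<Longrightarrow> B $$ (i, j) = s i * s j * f (t (p i) * t (p j) * a (p i) (p j))"
    using eq unfolding equiv_entries_def by blast
  have ft: "f (t i * t j * x) = t i * t j * f x" for i j x
    using f t[of i] t[of j] by auto
  have "\<forall>i<n. \<forall>j<n. B $$ (i, j) = (s i * t (p i)) * (s j * t (p j)) * f (a (p i) (p j))"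
    using B(2) unfolding ft by (simp add: mult_ac)
  moreover have "\<forall>i. s i * t (p i) \<in> {1, -1}"
  proof
    fix i show "s i * t (p i) \<in> {1, -1}" using s[of i] t[of "p i"] by auto
  qed
  ultimately show ?thesis using f p B(1) unfolding equiv_entries_def
    by (intro conjI exI[of _ f] exI[of _ p] exI[of _ "\<lambda>i. s i * t (p i)"]) auto
qed

lemma cmod2_omega [simp]: "(cmod \<omega>)\<^sup>2 = 2"
  unfolding cmod_power2 by (simp add: power_divide)

lemma omega_ne [simp]: "\<omega> \<noteq> 0" "\<omega> \<noteq> 1" "\<omega> \<noteq> - 1" "\<omega> \<noteq> cnj \<omega>" "\<omega> \<noteq> - \<omega>"
  by (simp_all add: complex_eq_iff)

lemma omega_mult_cnj [simp]: "\<omega> * cnj \<omega> = 2" "cnj \<omega> * \<omega> = 2"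
  using complex_norm_square[of \<omega>] by (simp_all add: mult.commute)

lemma cmod2_one_add_omega: "(cmod (1 + \<omega>))\<^sup>2 = 4" "(cmod (1 + cnj \<omega>))\<^sup>2 = 4"
  unfolding cmod_power2 by (simp_all add: power2_eq_square)

lemma Zomega_norm_1: "x \<in> Zomega \<Longrightarrow> (cmod x)\<^sup>2 = 1 \<Longrightarrow> x \<in> {1, -1}"
  using Zomega_norm_cases[of x] cmod2_one_add_omega norm_minus_cancel[of "1 + \<omega>"]
    norm_minus_cancel[of "1 + cnj \<omega>"] by auto

lemma Zomega_norm_2: "x \<in> Zomega \<Longrightarrow> (cmod x)\<^sup>2 = 2 \<Longrightarrow> x \<in> {\<omega>, -\<omega>, cnj \<omega>, - cnj \<omega>}"
  using Zomega_norm_cases[of x] cmod2_one_add_omega norm_minus_cancel[of "1 + \<omega>"]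
    norm_minus_cancel[of "1 + cnj \<omega>"] by auto

lemma Zomega_norm_4: "x \<in> Zomega \<Longrightarrow> (cmod x)\<^sup>2 = 4 \<Longrightarrow>
    x \<in> {2, -2, 1 + \<omega>, - (1 + \<omega>), 1 + cnj \<omega>, - (1 + cnj \<omega>)}"
  using Zomega_norm_cases[of x] by auto

lemma nat_sum_eq_2:
  fixes N :: "nat \<Rightarrow> nat"
  assumes "finite R" "sum N R = 2"
  shows "(\<exists>z\<in>R. N z = 2) \<or> (\<exists>z\<in>R. \<exists>z'\<in>R. z \<noteq> z' \<and> N z = 1 \<and> N z' = 1)"
proof -
  obtain z where z: "z \<in> R" "N z \<noteq> 0" using assms by (metis sum.neutral zero_neq_numeral)
  have s: "N z + sum N (R - {z}) = 2" using sum.remove[OF assms(1) z(1), of N] assms(2) by simp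
  show ?thesis
  proof (cases "N z = 2")
    case False
    then have 1: "N z = 1" "sum N (R - {z}) = 1" using z(2) s by auto
    then obtain z' where z': "z' \<in> R - {z}" "N z' \<noteq> 0" by (metis sum.neutral zero_neq_one)
    then have "N z' \<le> 1" using member_le_sum[of z' "R - {z}" N] assms(1) 1(2) by simp
    then have "N z' = 1" using z'(2) by simp
    then show ?thesis using z z' 1 by auto
  qed (use z in auto)
qed

lemma nat_sum_eq_1:
  fixes N :: "nat \<Rightarrow> nat"
  assumes "finite R" "sum N R = 1"
  shows "\<exists>z\<in>R. N z = 1"
proof -
  obtain z where z: "z \<in> R" "N z \<noteq> 0" using assms by (metis sum.neutral zero_neq_one)
  moreover have "N z \<le> 1" using member_le_sum[of z R N] assms z(1) by simp
  ultimately show ?thesis by (metis le_less_trans less_one nat_less_le)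
qed

section \<open>Distributing integral weights over a row\<close>

context tight
begin

lemma weight_split:
  assumes "distinct xs" "set xs \<subseteq> {..<n}"
  shows "row_weight n a i = (\<Sum>x\<leftarrow>xs. (cmod (a i x))\<^sup>2) + (\<Sum>j\<in>{..<n} - set xs. (cmod (a i j))\<^sup>2)"
  unfolding row_weight_def
  using sum.subset_diff[OF assms(2), of "\<lambda>j. (cmod (a i j))\<^sup>2"] assms(1)
  by (simp add: sum_list_distinct_conv_sum_set)

lemma entry_norm_nat:
  assumes "i < n"
  obtains N :: "nat \<Rightarrow> nat" where "\<And>j. j < n \<Longrightarrow> (cmod (a i j))\<^sup>2 = real (N j)"
proof -
  have "\<exists>m::nat. (cmod (a i j))\<^sup>2 = real m" if j: "j < n" for j
  proof -
    obtain m where m: "(cmod (a i j))\<^sup>2 = real_of_int m"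
      using Zomega_sqnorm_int[OF entry[OF assms j]] by blast
    then have "m \<ge> 0" using zero_le_power2[of "cmod (a i j)"] by simp
    then have "(cmod (a i j))\<^sup>2 = real (nat m)" using m by simp
    then show ?thesis by blast
  qed
  then show ?thesis using that by metis
qed

text \<open>The listed entries exhaust the maximal weight, so all others vanish and the
  orthogonality sums shrink to the list. The graphs below are determined and closed off by repeated
  use of this.\<close>

lemma full_row:
  assumes i: "i < n" and xs: "distinct xs" "set xs \<subseteq> {..<n}" "(\<Sum>x\<leftarrow>xs. (cmod (a i x))\<^sup>2) \<ge> 4"
  shows full_row_zero: "\<And>j. j < n \<Longrightarrow> j \<notin> set xs \<Longrightarrow> a i j = 0"
    and full_row_orth: "\<And>k. k < n \<Longrightarrow> k \<noteq> i \<Longrightarrow> (\<Sum>x\<leftarrow>xs. a i x * a x k) = 0"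
    and full_row_weight: "row_weight n a i = 4"
proof -
  have "(\<Sum>j\<in>{..<n} - set xs. (cmod (a i j))\<^sup>2) \<ge> 0" by (intro sum_nonneg) simp
  then have 0: "(\<Sum>j\<in>{..<n} - set xs. (cmod (a i j))\<^sup>2) = 0" and W: "row_weight n a i = 4"
    using weight_split[OF xs(1,2), of i] xs(3) weight_le[OF i] by linarith+
  show z: "a i j = 0" if "j < n" "j \<notin> set xs" for j
    using 0 that by (subst (asm) sum_nonneg_eq_0_iff) auto
  show "row_weight n a i = 4" by (rule W)
  fix k assume k: "k < n" "k \<noteq> i"
  have "0 = (\<Sum>j<n. a i j * a j k)" using orth[OF i k W] by simp
  also have "\<dots> = (\<Sum>j\<in>set xs. a i j * a j k)"
    by (rule sum.mono_neutral_right) (use xs(2) z in auto)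
  finally show "(\<Sum>x\<leftarrow>xs. a i x * a x k) = 0"
    using xs(1) by (simp add: sum_list_distinct_conv_sum_set)
qed

lemma remaining_weight_2:
  assumes i: "i < n" and W: "row_weight n a i = 4"
    and xs: "distinct xs" "set xs \<subseteq> {..<n}" "(\<Sum>x\<leftarrow>xs. (cmod (a i x))\<^sup>2) = 2"
  shows "(\<exists>z<n. z \<notin> set xs \<and> (cmod (a i z))\<^sup>2 = 2) \<or>
    (\<exists>z<n. \<exists>z'<n. z \<noteq> z' \<and> z \<notin> set xs \<and> z' \<notin> set xs \<and> (cmod (a i z))\<^sup>2 = 1 \<and> (cmod (a i z'))\<^sup>2 = 1)"
proof -
  obtain N where N: "\<And>j. j < n \<Longrightarrow> (cmod (a i j))\<^sup>2 = real (N j)" by (rule entry_norm_nat[OF i]) blast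
  have "(\<Sum>j\<in>{..<n} - set xs. (cmod (a i j))\<^sup>2) = 2"
    using weight_split[OF xs(1,2), of i] W xs(3) by simp
  then have "real (\<Sum>j\<in>{..<n} - set xs. N j) = 2" by (simp add: N)
  then have "(\<Sum>j\<in>{..<n} - set xs. N j) = 2" by linarith
  from nat_sum_eq_2[OF _ this] show ?thesis using N by fastforce
qed

lemma remaining_weight_1:
  assumes i: "i < n" and W: "row_weight n a i = 4"
    and xs: "distinct xs" "set xs \<subseteq> {..<n}" "(\<Sum>x\<leftarrow>xs. (cmod (a i x))\<^sup>2) = 3"
  shows "\<exists>z<n. z \<notin> set xs \<and> (cmod (a i z))\<^sup>2 = 1"
proof -
  obtain N where N: "\<And>j. j < n \<Longrightarrow> (cmod (a i j))\<^sup>2 = real (N j)" by (rule entry_norm_nat[OF i]) blast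
  have "(\<Sum>j\<in>{..<n} - set xs. (cmod (a i j))\<^sup>2) = 1"
    using weight_split[OF xs(1,2), of i] W xs(3) by simp
  then have "real (\<Sum>j\<in>{..<n} - set xs. N j) = 1" by (simp add: N)
  then have "(\<Sum>j\<in>{..<n} - set xs. N j) = 1" by linarith
  from nat_sum_eq_1[OF _ this] show ?thesis using N by fastforce
qed

text \<open>Norms are integers, and a remainder of weight 1 would give the excluded weight
  3.\<close>

lemma weight_2_or_4:
  assumes i: "i < n" and xs: "distinct xs" "set xs \<subseteq> {..<n}" "(\<Sum>x\<leftarrow>xs. (cmod (a i x))\<^sup>2) = 2"
  shows "row_weight n a i = 4 \<or> row_weight n a i = 2 \<and> (\<forall>j<n. j \<notin> set xs \<longrightarrow> a i j = 0)"
proof -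
  obtain N where N: "\<And>j. j < n \<Longrightarrow> (cmod (a i j))\<^sup>2 = real (N j)" by (rule entry_norm_nat[OF i]) blast
  let ?R = "{..<n} - set xs"
  define m where "m = sum N ?R"
  have r: "(\<Sum>j\<in>?R. (cmod (a i j))\<^sup>2) = real m" by (simp add: N m_def)
  have W: "row_weight n a i = 2 + real m"
    using weight_split[OF xs(1,2), of i] xs(3) r by simp
  then have "m \<le> 2" "m \<noteq> 1" using weight_le[OF i] weight_ne_3[OF i] by auto
  then consider "m = 2" | "m = 0" by linarith
  then show ?thesis
  proof cases
    case 2
    then have "a i j = 0" if "j < n" "j \<notin> set xs" for j using that N[of j] by (auto simp: m_def)
    then show ?thesis using W 2 by simp
  qed (use W in simp)
qed

text \<open>Were the edge alone in row \<open>i\<close>, every off-diagonal entry of this row of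
  \<open>A\<^sup>2\<close> would be \<open>a i j * a j k\<close>, divisible by the label
  \<open>a i j\<close> of norm 2, against \<open>weight_2\<close>.\<close>

lemma heavy_saturated:
  assumes ij: "i < n" "j < n" and w: "(cmod (a i j))\<^sup>2 = 2"
  shows "row_weight n a i = 4"
proof (rule ccontr)
  assume "row_weight n a i \<noteq> 4"
  then have W: "row_weight n a i = 2" and z: "\<And>k. k < n \<Longrightarrow> k \<noteq> j \<Longrightarrow> a i k = 0"
    using weight_2_or_4[of i "[j]"] ij w by auto
  show False
  proof (rule weight_2[OF ij(1) W entry[OF ij] w])
    fix k assume k: "k < n"
    have "(\<Sum>l<n. a i l * a l k) = (\<Sum>l<n. if l = j then a i j * a j k else 0)"
      by (intro sum.cong) (auto simp: z)
    then have "(\<Sum>l<n. a i l * a l k) = a i j * a j k" using ij by simp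
    then show "\<exists>w\<in>Zomega. (\<Sum>l<n. a i l * a l k) = a i j * w" using entry[OF ij(2) k] by blast
  qed
qed

lemma norm_sym: "i < n \<Longrightarrow> j < n \<Longrightarrow> cmod (a j i) = cmod (a i j)"
  using herm[of i j] by simp

lemma all_vertices:
  assumes "i < n" "set (i # is) \<subseteq> {..<n}"
    and "\<And>j k. j \<in> set (i # is) \<Longrightarrow> k < n \<Longrightarrow> k \<notin> set (i # is) \<Longrightarrow> a j k = 0"
  shows "{..<n} = set (i # is)"
  using conn[of "set (i # is)"] assms unfolding closed_under_def by blast

end

lemma bij_betw_nth_vertices:
  assumes "distinct xs" "{..<n} = set xs"
  shows "n = length xs" "bij_betw (nth xs) {..<n} {..<n}"
proof -
  show n: "n = length xs" using assms distinct_card[of xs] by (metis card_lessThan)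
  show "bij_betw (nth xs) {..<n} {..<n}"
    using bij_betw_nth[OF assms(1) _ assms(2)] n by simp
qed

lemma graph_mat_carrier [simp]: "graph_mat n c es \<in> carrier_mat n n"
  by (simp add: graph_mat_def)

context tight
begin

text \<open>Both matrices are Hermitian and every admissible \<open>f\<close> commutes with
  conjugation, so comparing diagonals and upper triangles suffices.\<close>

lemma equiv_graph_matI:
  assumes f: "f \<in> {\<lambda>x. x, uminus, cnj, \<lambda>x. - cnj x}" and p: "bij_betw p {..<n} {..<n}"
    and s: "\<And>i. s i \<in> {1, -1}"
    and c: "\<And>i. i < n \<Longrightarrow> c (i + 1) = f (a (p i) (p i))"
    and e: "\<And>i j. i < j \<Longrightarrow> j < n \<Longrightarrow> edge_label es (i + 1) (j + 1) = s i * s j * f (a (p i) (p j))"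
  shows "equiv_entries n a (graph_mat n c es)"
  unfolding equiv_entries_def
proof (intro conjI exI allI impI)
  show "f \<in> {\<lambda>x. x, uminus, cnj, \<lambda>x. - cnj x}" by (rule f)
  show "bij_betw p {..<n} {..<n}" by (rule p)
  show "s i \<in> {1, -1}" for i by (rule s)
  fix i j assume ij: "i < n" "j < n"
  have lt: "p i < n" "p j < n" using p ij unfolding bij_betw_def by auto
  have ss: "s k * s k = 1" "cnj (s k) = s k" for k using s[of k] by auto
  have fc: "f (cnj x) = cnj (f x)" for x using f by auto
  consider "i = j" | "i < j" | "j < i" by linarith
  then show "graph_mat n c es $$ (i, j) = s i * s j * f (a (p i) (p j))"
  proof cases
    case 1
    then show ?thesis using c[OF ij(1)] ij by (simp add: graph_mat_def ss)
  next
    case 2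
    then show ?thesis using e[OF 2 ij(2)] ij by (simp add: graph_mat_def)
  next
    case 3
    have "a (p i) (p j) = cnj (a (p j) (p i))" using herm[OF lt(2,1)] .
    then show ?thesis using e[OF 3 ij(1)] 3 ij by (simp add: graph_mat_def ss fc mult_ac)
  qed
qed simp

text \<open>Both end rows are full, so the edge is the whole graph. Up to sign and conjugation the
  elements of norm 4 are \<open>2\<close> and \<open>1 + \<omega>\<close>, and the latter is the
  label of \<open>S2_star\<close>.\<close>

lemma weight_4_edge:
  assumes ij: "i < n" "j < n" "i \<noteq> j" and w: "(cmod (a i j))\<^sup>2 = 4"
  shows "equiv_entries n a S2 \<or> equiv_entries n a S2_star"
proof -
  have w': "(cmod (a j i))\<^sup>2 = 4" using w norm_sym ij by simp
  have zi: "a i k = 0" if "k < n" "k \<noteq> j" for k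
    by (rule full_row_zero[of i "[j]"]) (use ij w that in auto)
  have zj: "a j k = 0" if "k < n" "k \<noteq> i" for k
    by (rule full_row_zero[of j "[i]"]) (use ij w' that in auto)
  have V: "{..<n} = {i, j}" using all_vertices[of i "[j]"] ij zi zj by auto
  define p where "p = nth [i, j]"
  have n: "n = 2" and p: "bij_betw p {..<n} {..<n}"
    using bij_betw_nth_vertices[of "[i, j]" n] V ij by (simp_all add: p_def)
  have lbl: "a i j \<in> {2, -2, 1 + \<omega>, - (1 + \<omega>), 1 + cnj \<omega>, - (1 + cnj \<omega>)}"
    by (rule Zomega_norm_4[OF entry w]) (use ij in auto)
  have rule: "equiv_entries n a (graph_mat 2 (\<lambda>_. 0) [((1, 2), x)])"
    if "f \<in> {\<lambda>x. x, uminus, cnj, \<lambda>x. - cnj x}" "x = f (a i j) \<or> x = - f (a i j)" for f x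
  proof -
    \<comment> \<open>A sign at the second vertex repairs the case
      \<open>x = - f (a i j)\<close>.\<close>
    define s where "s = (\<lambda>k::nat. if k = 0 \<or> x = f (a i j) then 1 else -1 :: complex)"
    have f0: "f 0 = 0" using that(1) by auto
    have "equiv_entries n a (graph_mat n (\<lambda>_. 0) [((1, 2), x)])"
    proof (rule equiv_graph_matI[OF that(1) p, of s])
      fix k l assume "k < l" "l < n"
      then have "k = 0" "l = 1" using n by auto
      then show "edge_label [((1, 2), x)] (k + 1) (l + 1) = s k * s l * f (a (p k) (p l))"
        using that(2) by (auto simp: edge_label_def s_def p_def)
    qed (use n ij zi zj f0 in \<open>auto simp: s_def p_def less_Suc_eq numeral_2_eq_2\<close>)
    then show ?thesis unfolding n .
  qed
  have st: "3 / 2 + csqrt (-7) / 2 = 1 + \<omega>" by (simp add: \<omega>_def)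
  from lbl consider "a i j = 2 \<or> a i j = - 2" | "1 + \<omega> = a i j \<or> 1 + \<omega> = - a i j" |
    "1 + \<omega> = cnj (a i j) \<or> 1 + \<omega> = - cnj (a i j)" by fastforce
  then show ?thesis
  proof cases
    case 1
    then show ?thesis using rule[of "\<lambda>x. x" 2] unfolding S2_def by auto
  next
    case 2
    then show ?thesis using rule[of "\<lambda>x. x" "1 + \<omega>"] unfolding S2_star_def st by simp
  next
    case 3
    then show ?thesis using rule[of cnj "1 + \<omega>"] unfolding S2_star_def st by simp
  qed
qed

end

section \<open>Graphs with isolated edges of weight 2\<close>

lemma edge_label_Nil: "edge_label [] i j = 0"
  and edge_label_Cons: "edge_label (((k, l), x) # es) i j = (if i = k \<and> j = l then x else edge_label es i j)"
  by (auto simp: edge_label_def)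

text \<open>Spells out the 28 index pairs, so that all labels of \<open>S8_star\<close> can be
  checked by simplification at once.\<close>

lemma all_less_8: "(\<forall>i j. i < j \<and> j < (8::nat) \<longrightarrow> P i j) \<longleftrightarrow>
  P 0 1 \<and> P 0 2 \<and> P 0 3 \<and> P 0 4 \<and> P 0 5 \<and> P 0 6 \<and> P 0 7 \<and>
  P 1 2 \<and> P 1 3 \<and> P 1 4 \<and> P 1 5 \<and> P 1 6 \<and> P 1 7 \<and>
  P 2 3 \<and> P 2 4 \<and> P 2 5 \<and> P 2 6 \<and> P 2 7 \<and>
  P 3 4 \<and> P 3 5 \<and> P 3 6 \<and> P 3 7 \<and>
  P 4 5 \<and> P 4 6 \<and> P 4 7 \<and> P 5 6 \<and> P 5 7 \<and> P 6 7" (is "?l \<longleftrightarrow> ?r")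
proof
  assume ?r
  show ?l
  proof (intro allI impI)
    fix i j :: nat assume ij: "i < j \<and> j < 8"
    then have "j = 1 \<or> j = 2 \<or> j = 3 \<or> j = 4 \<or> j = 5 \<or> j = 6 \<or> j = 7" by auto
    moreover have "i = 0 \<or> i = 1 \<or> i = 2 \<or> i = 3 \<or> i = 4 \<or> i = 5 \<or> i = 6" using ij by auto
    ultimately show "P i j" using ij \<open>?r\<close> by (elim disjE) simp_all
  qed
qed simp

context tight
begin

lemma heavy_ne: "i < n \<Longrightarrow> j < n \<Longrightarrow> (cmod (a i j))\<^sup>2 = 2 \<Longrightarrow> i \<noteq> j"
  using diag[of i] by auto

lemma light_entry:
  assumes "i < n" "j < n" "(cmod (a i j))\<^sup>2 < 2"
  shows "a i j \<in> {0, 1, -1}"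
proof -
  obtain N where N: "\<And>j. j < n \<Longrightarrow> (cmod (a i j))\<^sup>2 = real (N j)"
    by (rule entry_norm_nat[OF assms(1)]) blast
  then have "N j = 0 \<or> N j = 1" using assms(2,3) by force
  then show ?thesis
    using N[OF assms(2)] Zomega_norm_1[OF entry[OF assms(1,2)]] by auto
qed

text \<open>The heavy entry leaves weight at most 2, and \<open>single\<close> excludes the norm 2;
  what remains is real, so the matrix is symmetric there.\<close>

lemma second_heavy_light:
  assumes single: "\<And>i j k. i < n \<Longrightarrow> j < n \<Longrightarrow> k < n \<Longrightarrow> j \<noteq> k \<Longrightarrow>
      (cmod (a i j))\<^sup>2 = 2 \<Longrightarrow> (cmod (a i k))\<^sup>2 \<noteq> 2"
    and v: "v < n" "u < n" "k < n" "k \<noteq> u" "(cmod (a v u))\<^sup>2 = 2"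
  shows "a v k \<in> {0, 1, -1}" "a k v = a v k"
proof -
  obtain N where N: "\<And>j. j < n \<Longrightarrow> (cmod (a v j))\<^sup>2 = real (N j)"
    by (rule entry_norm_nat[OF v(1)]) blast
  have "(\<Sum>x\<leftarrow>[u, k]. (cmod (a v x))\<^sup>2) \<le> row_weight n a v"
    using weight_split[of "[u, k]" v] v by (auto intro!: sum_nonneg)
  then have "(cmod (a v k))\<^sup>2 \<le> 2" using weight_le[OF v(1)] v(5) by simp
  moreover have "(cmod (a v k))\<^sup>2 \<noteq> 2" using single v by metis
  ultimately show "a v k \<in> {0, 1, -1}" using light_entry v by simp
  then show "a k v = a v k" using herm[OF v(1,3)] by auto
qed

text \<open>Row \<open>u\<close> consists of \<open>\<omega>\<close>, its charge and one unit entry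
  at \<open>p\<close>. Orthogonality to row \<open>v\<close> forces the charge at \<open>v\<close>
  and hence a further unit neighbour \<open>q\<close>. The relations at \<open>p\<close> and
  \<open>q\<close> give their charges and a heavy edge between them, after which all four rows are
  full.\<close>

lemma charged_heavy_edge:
  assumes single: "\<And>i j k. i < n \<Longrightarrow> j < n \<Longrightarrow> k < n \<Longrightarrow> j \<noteq> k \<Longrightarrow>
      (cmod (a i j))\<^sup>2 = 2 \<Longrightarrow> (cmod (a i k))\<^sup>2 \<noteq> 2"
    and uv: "u < n" "v < n" and auv: "a u v = \<omega>" and cu: "a u u = 1"
  shows "equiv_entries n a S4"
proof -
  have wuv: "(cmod (a u v))\<^sup>2 = 2" by (simp add: auv)
  have wvu: "(cmod (a v u))\<^sup>2 = 2" using wuv norm_sym uv by simp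
  have ne: "u \<noteq> v" using heavy_ne uv wuv by blast
  have avu: "a v u = cnj \<omega>" using herm[OF uv] auv by simp
  obtain p where p: "p < n" "p \<noteq> u" "p \<noteq> v" "(cmod (a u p))\<^sup>2 = 1"
    using remaining_weight_1[OF uv(1) heavy_saturated[OF uv wuv], of "[u, v]"] ne uv cu wuv by auto
  have aup: "a u p \<in> {1, -1}" using Zomega_norm_1 entry uv p by blast
  have apu: "a p u = a u p" using herm[OF uv(1) p(1)] aup by auto
  note fu = full_row[of u "[u, v, p]"]
  have zu: "a u k = 0" if "k < n" "k \<noteq> u" "k \<noteq> v" "k \<noteq> p" for k
    by (rule fu(1)) (use that uv ne p wuv cu in auto)
  have ou: "a u u * a u k + (a u v * a v k + a u p * a p k) = 0" if "k < n" "k \<noteq> u" for k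
    using fu(2)[of k] that uv ne p wuv cu by auto
  have avp: "a v p \<in> {0, 1, -1}" "a p v = a v p"
    using second_heavy_light[OF single uv(2,1) p(1,2) wvu] by auto
  have "\<omega> + (\<omega> * a v v + a u p * a v p) = 0" using ou[of v] uv ne cu auv avp by auto
  \<comment> \<open>In the imaginary part only the multiples of \<open>\<omega>\<close> survive, so
    the coefficient \<open>1 + a v v\<close> is 0.\<close>
  then have cv: "a v v = -1" and avp0: "a v p = 0"
    using diag[OF uv(2)] aup avp(1) by (auto simp: complex_eq_iff)
  obtain q where q: "q < n" "q \<noteq> u" "q \<noteq> v" "(cmod (a v q))\<^sup>2 = 1"
    using remaining_weight_1[OF uv(2) heavy_saturated[OF uv(2,1) wvu], of "[u, v]"] ne uv cv wvu by auto
  have pq: "p \<noteq> q" using q(4) avp0 by auto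
  have avq: "a v q \<in> {1, -1}" using Zomega_norm_1 entry uv q by blast
  have aqv: "a q v = a v q" using herm[OF uv(2) q(1)] avq by auto
  note fv = full_row[of v "[u, v, q]"]
  have zv: "a v k = 0" if "k < n" "k \<noteq> u" "k \<noteq> v" "k \<noteq> q" for k
    by (rule fv(1)) (use that uv ne q wvu cv in auto)
  have ov: "a v u * a u k + (a v v * a v k + a v q * a q k) = 0" if "k < n" "k \<noteq> v" for k
    using fv(2)[of k] that uv ne q wvu cv by auto
  have cp: "a p p = -1"
    using ou[OF p(1,2)] cu avp0 aup diag[OF p(1)] by auto
  have auq: "a u q = 0" using zu q pq by simp
  have cq: "a q q = 1"
    using ov[OF q(1,3)] auq cv avq by auto
  have apq: "a p q = - \<omega> * a v q * a u p"
  proof -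
    have 1: "a u p * a p q = - (\<omega> * a v q)"
      using ou[OF q(1,2)] auq auv by (simp add: eq_neg_iff_add_eq_0 add.commute)
    have "a p q = a u p * (a u p * a p q)" using aup by auto
    then show ?thesis unfolding 1 by simp
  qed
  then have wpq: "(cmod (a p q))\<^sup>2 = 2" "(cmod (a q p))\<^sup>2 = 2"
    using aup avq norm_sym[OF p(1) q(1)] by auto
  have zp: "a p k = 0" if "k < n" "k \<noteq> u" "k \<noteq> p" "k \<noteq> q" for k
    by (rule full_row(1)[of p "[u, p, q]"]) (use that uv ne p q pq wpq cp apu in auto)
  have zq: "a q k = 0" if "k < n" "k \<noteq> v" "k \<noteq> p" "k \<noteq> q" for k
    by (rule full_row(1)[of q "[v, p, q]"]) (use that uv ne p q pq wpq cq aqv in auto)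
  have V: "{..<n} = set [u, v, p, q]"
    by (rule all_vertices) (use uv p q zu zv zp zq in auto)
  have d: "distinct [u, v, p, q]" using ne p q pq by auto
  note bij = bij_betw_nth_vertices[OF d V]
  define s where "s = (\<lambda>i::nat. if i = 2 then a u p else if i = 3 then a v q else 1)"
  have n4: "n = 4" using bij(1) by simp
  have "equiv_entries n a (graph_mat n (\<lambda>i. if i \<in> {1, 4} then 1 else -1)
     [((1, 2), \<omega>), ((3, 4), - \<omega>), ((1, 3), 1), ((2, 4), 1)])"
  proof (rule equiv_graph_matI[where f = "\<lambda>x. x", OF _ bij(2), of s])
    show "s i \<in> {1, -1}" for i using aup avq by (auto simp: s_def)
    fix i assume "i < n"
    then have "i = 0 \<or> i = 1 \<or> i = 2 \<or> i = 3" using n4 by auto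
    then show "(if i + 1 \<in> {1, 4} then 1 else -1) = a ([u, v, p, q] ! i) ([u, v, p, q] ! i)"
      using cu cv cp cq by auto
  next
    fix i j assume "i < j" "j < n"
    then have "(i = 0 \<and> j = 1) \<or> (i = 0 \<and> j = 2) \<or> (i = 0 \<and> j = 3) \<or> (i = 1 \<and> j = 2) \<or>
      (i = 1 \<and> j = 3) \<or> (i = 2 \<and> j = 3)" using n4 by auto
    then show "edge_label [((1, 2), \<omega>), ((3, 4), - \<omega>), ((1, 3), 1), ((2, 4), 1)] (i + 1) (j + 1) =
        s i * s j * a ([u, v, p, q] ! i) ([u, v, p, q] ! j)"
      using aup avq by (auto simp: edge_label_def s_def auv auq avp0 apq)
  qed simp
  then show ?thesis unfolding S4_def n4 .
qed

text \<open>The six vertices \<open>u, v, p, p', q, q'\<close> are the closed neighbourhood of a heavy edge \<open>u v\<close>;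
  orthogonality of the rows of \<open>u\<close> and \<open>v\<close> to all others leaves two possibilities for the
  block between \<open>{p, p'}\<close> and \<open>{q, q'}\<close>.\<close>

definition edge_star :: "nat \<Rightarrow> nat \<Rightarrow> nat \<Rightarrow> nat \<Rightarrow> nat \<Rightarrow> nat \<Rightarrow> bool" where
  "edge_star u v p p' q q' \<longleftrightarrow> distinct [u, v, p, p', q, q'] \<and> {u, v, p, p', q, q'} \<subseteq> {..<n} \<and>
    a u v = \<omega> \<and> a u p = 1 \<and> a u p' = 1 \<and> a v q = 1 \<and> a v q' = 1 \<and> a v p = 0 \<and> a v p' = 0"

lemma edge_star_facts:
  assumes es: "edge_star u v p p' q q'"
  shows "\<And>k. k < n \<Longrightarrow> k \<notin> {v, p, p'} \<Longrightarrow> a u k = 0"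
    and "\<And>k. k < n \<Longrightarrow> k \<notin> {u, q, q'} \<Longrightarrow> a v k = 0"
    and "\<And>k. k < n \<Longrightarrow> k \<noteq> u \<Longrightarrow> \<omega> * a v k + a p k + a p' k = 0"
    and "\<And>k. k < n \<Longrightarrow> k \<noteq> v \<Longrightarrow> cnj \<omega> * a u k + a q k + a q' k = 0"
proof -
  have lt: "u < n" "v < n" "p < n" "p' < n" "q < n" "q' < n" and d: "distinct [u, v, p, p', q, q']"
    and e: "a u v = \<omega>" "a u p = 1" "a u p' = 1" "a v q = 1" "a v q' = 1"
    using es unfolding edge_star_def by auto
  have avu: "a v u = cnj \<omega>" using herm[OF lt(1,2)] e by simp
  note fu = full_row[of u "[v, p, p']"] and fv = full_row[of v "[u, q, q']"]
  show "a u k = 0" if "k < n" "k \<notin> {v, p, p'}" for k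
    by (rule fu(1)) (use that lt d e in auto)
  show "a v k = 0" if "k < n" "k \<notin> {u, q, q'}" for k
    by (rule fv(1)) (use that lt d e avu in auto)
  show "\<omega> * a v k + a p k + a p' k = 0" if "k < n" "k \<noteq> u" for k
    using fu(2)[of k] that lt d e by (auto simp: add.assoc)
  show "cnj \<omega> * a u k + a q k + a q' k = 0" if "k < n" "k \<noteq> v" for k
    using fv(2)[of k] that lt d e avu by (auto simp: add.assoc)
qed

text \<open>With this block all six rows have weight 4 within the six vertices, so there are no
  others.\<close>

lemma edge_star_S6:
  assumes es: "edge_star u v p p' q q'"
    and B: "a p q = cnj \<omega>" "a p' q = -1" "a p q' = -1" "a p' q' = cnj \<omega>"
  shows "equiv_entries n a S6_dagger"
proof -
  have lt: "u < n" "v < n" "p < n" "p' < n" "q < n" "q' < n" and d: "distinct [u, v, p, p', q, q']"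
    and e: "a u v = \<omega>" "a u p = 1" "a u p' = 1" "a v q = 1" "a v q' = 1" "a v p = 0" "a v p' = 0"
    using es unfolding edge_star_def by auto
  note zu = edge_star_facts(1)[OF es, simplified] and zv = edge_star_facts(2)[OF es, simplified]
  have bk: "a p u = 1" "a p' u = 1" "a q v = 1" "a q' v = 1" "a q p = \<omega>" "a q p' = -1"
    "a q' p = -1" "a q' p' = \<omega>"
    using herm[of u p] herm[of u p'] herm[of v q] herm[of v q'] herm[of p q] herm[of p' q]
      herm[of p q'] herm[of p' q'] lt e B by auto
  have zp: "a p k = 0" if "k < n" "k \<noteq> u" "k \<noteq> q" "k \<noteq> q'" for k
    by (rule full_row(1)[of p "[u, q, q']"]) (use that lt d bk B in auto)
  have zp': "a p' k = 0" if "k < n" "k \<noteq> u" "k \<noteq> q" "k \<noteq> q'" for k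
    by (rule full_row(1)[of p' "[u, q, q']"]) (use that lt d bk B in auto)
  have zq: "a q k = 0" if "k < n" "k \<noteq> v" "k \<noteq> p" "k \<noteq> p'" for k
    by (rule full_row(1)[of q "[v, p, p']"]) (use that lt d bk B in auto)
  have zq': "a q' k = 0" if "k < n" "k \<noteq> v" "k \<noteq> p" "k \<noteq> p'" for k
    by (rule full_row(1)[of q' "[v, p, p']"]) (use that lt d bk B in auto)
  let ?xs = "[p, u, v, q', p', q]"
  have V: "{..<n} = set ?xs"
    by (rule all_vertices) (use lt zu zv zp zp' zq zq' in auto)
  have d': "distinct ?xs" using d by auto
  note bij = bij_betw_nth_vertices[OF d' V]
  have n6: "n = 6" using bij(1) by simp
  \<comment> \<open>The sign sits at \<open>p'\<close>, the vertex of index 4 in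
    \<open>?xs\<close>.\<close>
  define s where "s = (\<lambda>i::nat. if i = 4 then -1 else 1 :: complex)"
  let ?es = "[((1, 2), 1), ((3, 4), 1), ((3, 6), 1), ((5, 6), 1), ((1, 4), -1), ((2, 5), -1),
      ((2, 3), \<omega>), ((1, 6), cnj \<omega>), ((4, 5), - \<omega>)]"
  have dg: "a u u = 0" "a v v = 0" "a p p = 0" "a p' p' = 0" "a q q = 0" "a q' q' = 0"
    using zu zv zp zp' zq zq' lt d by auto
  have zz: "a p v = 0" "a p p' = 0" "a u q' = 0" "a u q = 0" "a v p' = 0" "a q' q = 0"
    using zu zv zp zq' lt d by auto
  have "equiv_entries n a (graph_mat n (\<lambda>_. 0) ?es)"
  proof (rule equiv_graph_matI[where f = "\<lambda>x. x", OF _ bij(2), of s])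
    show "s i \<in> {1, -1}" for i by (auto simp: s_def)
    fix i assume "i < n"
    then have "i = 0 \<or> i = 1 \<or> i = 2 \<or> i = 3 \<or> i = 4 \<or> i = 5" using n6 by auto
    then show "0 = a (?xs ! i) (?xs ! i)" using dg by auto
  next
    fix i j assume ij: "i < j" "j < n"
    then have "j = 1 \<or> j = 2 \<or> j = 3 \<or> j = 4 \<or> j = 5" using n6 by auto
    moreover have "i = 0 \<or> i = 1 \<or> i = 2 \<or> i = 3 \<or> i = 4" using ij n6 by auto
    ultimately show "edge_label ?es (i + 1) (j + 1) = s i * s j * a (?xs ! i) (?xs ! j)"
      using ij(1) by (elim disjE) (simp_all add: edge_label_def s_def e B bk zz)
  qed simp
  then show ?thesis unfolding S6_dagger_def n6 .
qed

text \<open>Here \<open>p\<close> and \<open>q\<close> have weight 3 within the six vertices. Their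
  missing unit neighbours \<open>s\<close> and \<open>r\<close> are shared with \<open>p'\<close>
  and \<open>q'\<close>, by orthogonality to rows \<open>u\<close> and \<open>v\<close>. Row
  \<open>p\<close> then forces a heavy edge between \<open>s\<close> and \<open>r\<close>, and all
  eight rows are full.\<close>

lemma edge_star_S8:
  assumes es: "edge_star u v p p' q q'"
    and unch: "\<And>i j. i < n \<Longrightarrow> j < n \<Longrightarrow> (cmod (a i j))\<^sup>2 = 2 \<Longrightarrow> a i i = 0"
    and B: "a p q = - \<omega>" "a p' q = 0" "a p q' = 0" "a p' q' = - \<omega>"
  shows "equiv_entries n a S8_star"
proof -
  have lt: "u < n" "v < n" "p < n" "p' < n" "q < n" "q' < n" and d: "distinct [u, v, p, p', q, q']"
    and e: "a u v = \<omega>" "a u p = 1" "a u p' = 1" "a v q = 1" "a v q' = 1" "a v p = 0" "a v p' = 0"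
    using es unfolding edge_star_def by auto
  note zu = edge_star_facts(1)[OF es, simplified] and zv = edge_star_facts(2)[OF es, simplified]
  note ou = edge_star_facts(3)[OF es] and ov = edge_star_facts(4)[OF es]
  have bk: "a p u = 1" "a p' u = 1" "a q v = 1" "a q' v = 1" "a q p = - cnj \<omega>" "a q p' = 0"
    "a q' p = 0" "a q' p' = - cnj \<omega>"
    using herm[of u p] herm[of u p'] herm[of v q] herm[of v q'] herm[of p q] herm[of p' q]
      herm[of p q'] herm[of p' q'] lt e B by auto
  have w: "(cmod (a p q))\<^sup>2 = 2" "(cmod (a p' q'))\<^sup>2 = 2" "(cmod (a q p))\<^sup>2 = 2" "(cmod (a q' p'))\<^sup>2 = 2"
    by (simp_all add: B bk)
  have dg: "a u u = 0" "a v v = 0" "a p p = 0" "a p' p' = 0" "a q q = 0" "a q' q' = 0"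
    using zu zv lt d unch w by auto
  have zz: "a u q = 0" "a u q' = 0" "a p v = 0" "a p' v = 0"
    using zu lt d herm[of v p] herm[of v p'] e by auto
  have "a p' p = 0" using ou[of p] lt d e dg by auto
  moreover have "a q' q = 0" using ov[of q] lt d dg zz by auto
  ultimately have zz2: "a p p' = 0" "a p' p = 0" "a q q' = 0" "a q' q = 0"
    using herm[of p' p] herm[of q' q] lt by auto
  obtain s where s: "s < n" "s \<noteq> u" "s \<noteq> q" "(cmod (a p s))\<^sup>2 = 1"
    using remaining_weight_1[OF lt(3) heavy_saturated[OF lt(3,5) w(1)], of "[u, q]"] lt d bk w by auto
  obtain r where r: "r < n" "r \<noteq> v" "r \<noteq> p" "(cmod (a q r))\<^sup>2 = 1"
    using remaining_weight_1[OF lt(5) heavy_saturated[OF lt(5,3) w(3)], of "[v, p]"] lt d bk w by auto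
  have aps: "a p s \<in> {1, -1}" and aqr: "a q r \<in> {1, -1}"
    using Zomega_norm_1 entry lt s r by blast+
  have sne: "s \<noteq> p" "s \<noteq> p'" "s \<noteq> v" "s \<noteq> q'" using s(4) dg zz zz2 B by auto
  have "a q u = 0" using herm[of u q] lt zz by simp
  then have rne: "r \<noteq> q" "r \<noteq> q'" "r \<noteq> u" "r \<noteq> p'" using r(4) dg zz2 bk by auto
  have ap's: "a p' s = - a p s"
    using ou[OF s(1,2)] zv[of s] s sne by (simp add: add_eq_0_iff)
  have aq'r: "a q' r = - a q r"
    using ov[OF r(1,2)] zu[of r] r rne by (simp add: add_eq_0_iff)
  have bs: "a s p = a p s" "a s p' = - a p s" "a r q = a q r" "a r q' = - a q r"
    using herm[of p s] herm[of p' s] herm[of q r] herm[of q' r] lt s r aps aqr ap's aq'r by auto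
  note fp = full_row[of p "[u, q, s]"]
  have zp: "a p k = 0" if "k < n" "k \<noteq> u" "k \<noteq> q" "k \<noteq> s" for k
    by (rule fp(1)) (use that lt d s sne w bk in auto)
  have op: "a p u * a u k + (a p q * a q k + a p s * a s k) = 0" if "k < n" "k \<noteq> p" for k
    using fp(2)[of k] that lt d s sne w bk by auto
  have zp': "a p' k = 0" if "k < n" "k \<noteq> u" "k \<noteq> q'" "k \<noteq> s" for k
    by (rule full_row(1)[of p' "[u, q', s]"]) (use that lt d s sne w bk ap's in auto)
  have zq: "a q k = 0" if "k < n" "k \<noteq> v" "k \<noteq> p" "k \<noteq> r" for k
    by (rule full_row(1)[of q "[v, p, r]"]) (use that lt d r rne w bk in auto)
  have zq': "a q' k = 0" if "k < n" "k \<noteq> v" "k \<noteq> p'" "k \<noteq> r" for k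
    by (rule full_row(1)[of q' "[v, p', r]"]) (use that lt d r rne w bk aq'r in auto)
  have "a s q = 0" using op[of q] lt d zz dg aps by auto
  then have "a q s = 0" using herm[of s q] lt s by simp
  then have sr: "s \<noteq> r" using r(4) by auto
  have asr: "a s r = \<omega> * a q r * a p s"
  proof -
    have 1: "a p s * a s r = \<omega> * a q r"
      using op[OF r(1,3)] zu[of r] r rne B by (simp add: eq_neg_iff_add_eq_0)
    have "a s r = a p s * (a p s * a s r)" using aps by auto
    then show ?thesis unfolding 1 by simp
  qed
  have wsr: "(cmod (a s r))\<^sup>2 = 2" "(cmod (a r s))\<^sup>2 = 2"
    using asr aps aqr norm_sym[OF s(1) r(1)] by auto
  have zs: "a s k = 0" if "k < n" "k \<noteq> p" "k \<noteq> p'" "k \<noteq> r" for k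
    by (rule full_row(1)[of s "[p, p', r]"]) (use that lt d s sne r rne sr wsr bs in auto)
  have zr: "a r k = 0" if "k < n" "k \<noteq> q" "k \<noteq> q'" "k \<noteq> s" for k
    by (rule full_row(1)[of r "[q, q', s]"]) (use that lt d s sne r rne sr wsr bs in auto)
  let ?xs = "[u, p, q, v, p', s, r, q']"
  have V: "{..<n} = set ?xs"
  proof (rule all_vertices)
    fix j k assume j: "j \<in> set ?xs" and k: "k < n" "k \<notin> set ?xs"
    have "a u k = 0" "a p k = 0" "a q k = 0" "a v k = 0" "a p' k = 0" "a s k = 0" "a r k = 0" "a q' k = 0"
      using k by (simp_all add: zu zv zp zp' zq zq' zs zr)
    then show "a j k = 0" using j by auto
  qed (use lt s(1) r(1) in auto)
  have d': "distinct ?xs" using d s r sne rne sr by auto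
  note bij = bij_betw_nth_vertices[OF d' V]
  have n8: "n = 8" using bij(1) by simp
  \<comment> \<open>The signs absorb the undetermined units at \<open>s\<close> and
    \<open>r\<close>.\<close>
  define t where "t = (\<lambda>i::nat. if i = 5 then a p s else if i = 6 then a q r else 1)"
  let ?es = "[((1, 2), 1), ((1, 5), 1), ((2, 6), 1), ((3, 4), 1), ((3, 7), 1), ((4, 8), 1),
      ((5, 6), -1), ((7, 8), -1),
      ((1, 4), \<omega>), ((2, 3), - \<omega>), ((5, 8), - \<omega>), ((6, 7), \<omega>)]"
  have zz3: "a u s = 0" "a u r = 0" "a p r = 0" "a q s = 0" "a v s = 0" "a v r = 0"
    "a p' r = 0" "a s q' = 0" "a q p' = 0"
    using zu zv zp zp' zq zs lt d s r sne rne sr by auto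
  have dg2: "a s s = 0" "a r r = 0" using zs zr s r sne rne sr by auto
  have labels: "\<forall>i j. i < j \<and> j < (8::nat) \<longrightarrow>
      edge_label ?es (i + 1) (j + 1) = t i * t j * a (?xs ! i) (?xs ! j)"
    unfolding all_less_8 t_def using aps aqr
    by (auto simp: edge_label_Nil edge_label_Cons e B bk bs zz zz2 zz3 ap's asr)
  have "equiv_entries n a (graph_mat n (\<lambda>_. 0) ?es)"
  proof (rule equiv_graph_matI[where f = "\<lambda>x. x", OF _ bij(2), of t])
    show "t i \<in> {1, -1}" for i using aps aqr by (auto simp: t_def)
    fix i assume "i < n"
    then have "i = 0 \<or> i = 1 \<or> i = 2 \<or> i = 3 \<or> i = 4 \<or> i = 5 \<or> i = 6 \<or> i = 7" using n8 by auto
    then show "0 = a (?xs ! i) (?xs ! i)" using dg dg2 by auto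
  next
    fix i j assume "i < j" "j < n"
    then show "edge_label ?es (i + 1) (j + 1) = t i * t j * a (?xs ! i) (?xs ! j)"
      using labels n8 by blast
  qed simp
  then show ?thesis unfolding S8_star_def n8 .
qed


text \<open>All row and column sums of the block between \<open>{p, p'}\<close> and
  \<open>{q, q'}\<close> are \<open>- \<omega>\<close>, so \<open>x = a p q\<close> and
  \<open>y = - \<omega> - x\<close> determine it. Both have norm at most 3, since \<open>p\<close>
  also meets \<open>u\<close>. This leaves the pairs \<open>- \<omega>, 0\<close> and
  \<open>cnj \<omega>, -1\<close>, in an order that can be fixed by exchanging \<open>q\<close> and
  \<open>q'\<close>.\<close>

lemma edge_star_classification:
  assumes es: "edge_star u v p p' q q'"
    and unch: "\<And>i j. i < n \<Longrightarrow> j < n \<Longrightarrow> (cmod (a i j))\<^sup>2 = 2 \<Longrightarrow> a i i = 0"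
  shows "equiv_entries n a S6_dagger \<or> equiv_entries n a S8_star"
proof -
  have lt: "u < n" "v < n" "p < n" "p' < n" "q < n" "q' < n" and d: "distinct [u, v, p, p', q, q']"
    and e: "a u v = \<omega>" "a u p = 1" "a u p' = 1" "a v q = 1" "a v q' = 1" "a v p = 0" "a v p' = 0"
    using es unfolding edge_star_def by auto
  note ou = edge_star_facts(3)[OF es] and ov = edge_star_facts(4)[OF es]
  have 1: "a p q + a p' q = - \<omega>" "a p q' + a p' q' = - \<omega>"
    using ou[of q] ou[of q'] lt d e by (auto simp: add_eq_0_iff algebra_simps)
  have "a q p + a q' p = - cnj \<omega>" "a q p' + a q' p' = - cnj \<omega>"
    using ov[of p] ov[of p'] lt d e by (auto simp: add_eq_0_iff algebra_simps)
  then have "cnj (a q p + a q' p) = - \<omega>" "cnj (a q p' + a q' p') = - \<omega>" by simp_all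
  then have 2: "a p q + a p q' = - \<omega>" "a p' q + a p' q' = - \<omega>"
    using herm[of q p] herm[of q' p] herm[of q p'] herm[of q' p'] lt by simp_all
  have eqs: "a p' q = a p q'" "a p' q' = a p q"
    using 1 2 by (metis add_left_cancel, metis add.commute add_left_cancel)
  have apu: "a p u = 1" using herm[of u p] lt e by simp
  have small: "(cmod (a p k))\<^sup>2 \<le> 3" if "k < n" "k \<noteq> u" for k
  proof -
    have "(\<Sum>x\<leftarrow>[u, k]. (cmod (a p x))\<^sup>2) \<le> row_weight n a p"
      using weight_split[of "[u, k]" p] lt that by (auto intro!: sum_nonneg)
    then show ?thesis using weight_le[OF lt(3)] apu by simp
  qed
  have val: "a p k \<in> {0, 1, -1, \<omega>, -\<omega>, cnj \<omega>, -cnj \<omega>}" if "k < n" "k \<noteq> u" for k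
  proof -
    have "(cmod (- 1 - \<omega>))\<^sup>2 = 4" "(cmod (- 1 - cnj \<omega>))\<^sup>2 = 4"
      unfolding cmod_power2 by (simp_all add: power2_eq_square)
    then show ?thesis
      using Zomega_norm_cases[OF entry[OF lt(3) that(1)]] small[OF that] cmod2_one_add_omega
      by auto
  qed
  have x: "a p q \<in> {0, 1, -1, \<omega>, -\<omega>, cnj \<omega>, -cnj \<omega>}" using val lt d by auto
  have y: "a p q' = - \<omega> - a p q" using 2(1) by (simp add: eq_diff_eq add.commute)
  have ny: "(cmod (- \<omega> - a p q))\<^sup>2 \<le> 3" using small[of q'] lt d unfolding y by auto
  have "a p q = - \<omega> \<or> a p q = 0 \<or> a p q = cnj \<omega> \<or> a p q = -1"
  proof -
    \<comment> \<open>For the remaining candidates for \<open>x\<close>, the norm of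
      \<open>y\<close> exceeds 3.\<close>
    have "(cmod (- \<omega> - 1))\<^sup>2 = 4" "(cmod (- \<omega> - \<omega>))\<^sup>2 = 8" "(cmod (- \<omega> + cnj \<omega>))\<^sup>2 = 7"
      unfolding cmod_power2 by (simp_all add: power2_eq_square)
    then have "a p q \<noteq> 1" "a p q \<noteq> \<omega>" "a p q \<noteq> - cnj \<omega>" using ny by auto
    then show ?thesis using x by blast
  qed
  moreover have "- \<omega> - cnj \<omega> = -1" "- \<omega> - (-1) = cnj \<omega>" by (simp_all add: complex_eq_iff)
  ultimately have "(a p q = - \<omega> \<and> a p q' = 0) \<or> (a p q = 0 \<and> a p q' = - \<omega>) \<or>
      (a p q = cnj \<omega> \<and> a p q' = -1) \<or> (a p q = -1 \<and> a p q' = cnj \<omega>)"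
    using y by auto
  moreover have es': "edge_star u v p p' q' q"
    using es unfolding edge_star_def by auto
  ultimately show ?thesis
  proof (elim disjE conjE)
    assume "a p q = - \<omega>" "a p q' = 0"
    then show ?thesis using edge_star_S8[OF es unch] eqs by simp
  next
    assume "a p q = 0" "a p q' = - \<omega>"
    then show ?thesis using edge_star_S8[OF es' unch] eqs by simp
  next
    assume "a p q = cnj \<omega>" "a p q' = -1"
    then show ?thesis using edge_star_S6[OF es] eqs by simp
  next
    assume "a p q = -1" "a p q' = cnj \<omega>"
    then show ?thesis using edge_star_S6[OF es'] eqs by simp
  qed
qed

end

text \<open>Negation allows the charge at a heavy edge to be taken positive.\<close>

lemma (in tight) tight_uminus: "tight n (\<lambda>i j. - a i j)"
proof -
  have W: "row_weight n (\<lambda>i j. - a i j) i = row_weight n a i" for i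
    by (simp add: row_weight_def)
  show ?thesis
  proof
    show "- a j i = cnj (- a i j)" if "i < n" "j < n" for i j
      using herm[OF that] by simp
    show "- a i i \<in> {0, 1, -1}" if "i < n" for i using diag[OF that] by auto
    show "- a i j \<in> Zomega" if "i < n" "j < n" for i j using entry[OF that] by (rule Zomega_uminus)
    show "U = {..<n}" if "U \<subseteq> {..<n}" "U \<noteq> {}" "closed_under n (\<lambda>i j. - a i j) U" for U
      using conn[OF that(1,2)] that(3) by (simp add: closed_under_def)
    show False if "i < n" "row_weight n (\<lambda>i j. - a i j) i = 2" "p \<in> Zomega" "(cmod p)\<^sup>2 = 2"
      and "\<And>k. k < n \<Longrightarrow> k \<noteq> i \<Longrightarrow> \<exists>w\<in>Zomega. (\<Sum>j<n. - a i j * - a j k) = p * w" for i p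
      by (rule weight_2[of i p]) (use that W in auto)
    show "(\<Sum>j<n. - a i j * - a j k) = 0"
      if "i < n" "k < n" "k \<noteq> i" "row_weight n (\<lambda>i j. - a i j) i = 4" for i k
      using orth[OF that(1-3)] that(4) unfolding W by simp
  qed (use W weight_le weight_ne_3 in auto)
qed

lemma equiv_entries_uminus:
  assumes "equiv_entries n (\<lambda>i j. - a i j) B"
  shows "equiv_entries n a B"
proof -
  obtain f p s where f: "f \<in> {\<lambda>x. x, uminus, cnj, \<lambda>x. - cnj x}" "bij_betw p {..<n} {..<n}"
    "\<forall>i. s i \<in> {1, -1}" "\<forall>i<n. \<forall>j<n. B $$ (i, j) = s i * s j * f (- a (p i) (p j))"
    and B: "B \<in> carrier_mat n n"
    using assms unfolding equiv_entries_def by blast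
  have "(\<lambda>x. f (- x)) \<in> {\<lambda>x. x, uminus, cnj, \<lambda>x. - cnj x}" using f(1) by auto
  then show ?thesis using f(2-4) B unfolding equiv_entries_def by blast
qed

context tight
begin

text \<open>The point is that \<open>u\<close> and \<open>v\<close> have no common neighbour. After
  that, switching turns the four unit labels into 1 and \<open>edge_star\<close> applies.\<close>

lemma uncharged_heavy_edge:
  assumes single: "\<And>i j k. i < n \<Longrightarrow> j < n \<Longrightarrow> k < n \<Longrightarrow> j \<noteq> k \<Longrightarrow>
      (cmod (a i j))\<^sup>2 = 2 \<Longrightarrow> (cmod (a i k))\<^sup>2 \<noteq> 2"
    and unch: "\<And>i j. i < n \<Longrightarrow> j < n \<Longrightarrow> (cmod (a i j))\<^sup>2 = 2 \<Longrightarrow> a i i = 0"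
    and uv: "u < n" "v < n" and auv: "a u v = \<omega>"
  shows "equiv_entries n a S6_dagger \<or> equiv_entries n a S8_star"
proof -
  have wuv: "(cmod (a u v))\<^sup>2 = 2" by (simp add: auv)
  have wvu: "(cmod (a v u))\<^sup>2 = 2" using wuv norm_sym uv by simp
  have ne: "u \<noteq> v" using heavy_ne uv wuv by blast
  have avu: "a v u = cnj \<omega>" using herm[OF uv] auv by simp
  have dg: "a u u = 0" "a v v = 0" using unch uv wuv wvu by blast+
  obtain p p' where p: "p < n" "p' < n" "p \<noteq> p'" "p \<noteq> v" "p' \<noteq> v"
      "(cmod (a u p))\<^sup>2 = 1" "(cmod (a u p'))\<^sup>2 = 1"
    using remaining_weight_2[OF uv(1) heavy_saturated[OF uv wuv], of "[v]"] uv wuv single[OF uv]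
    by auto
  obtain q q' where q: "q < n" "q' < n" "q \<noteq> q'" "q \<noteq> u" "q' \<noteq> u"
      "(cmod (a v q))\<^sup>2 = 1" "(cmod (a v q'))\<^sup>2 = 1"
    using remaining_weight_2[OF uv(2) heavy_saturated[OF uv(2,1) wvu], of "[u]"] uv wvu single[OF uv(2,1)]
    by auto
  have pu: "p \<noteq> u" "p' \<noteq> u" and qv: "q \<noteq> v" "q' \<noteq> v" using p q dg by auto
  have e: "a u p \<in> {1, -1}" "a u p' \<in> {1, -1}" "a v q \<in> {1, -1}" "a v q' \<in> {1, -1}"
    using Zomega_norm_1 entry uv p q by blast+
  have ou: "a u v * a v k + (a u p * a p k + a u p' * a p' k) = 0" if "k < n" "k \<noteq> u" for k
    using full_row(2)[of u "[v, p, p']" k] that uv p wuv by auto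
  have gp: "a v p \<in> {0, 1, -1}" "a p v = a v p" and gp': "a v p' \<in> {0, 1, -1}" "a p' v = a v p'"
    using second_heavy_light[OF single uv(2,1) p(1) pu(1) wvu]
      second_heavy_light[OF single uv(2,1) p(2) pu(2) wvu] by auto
  have o1: "a u p * a v p + a u p' * a v p' = 0"
    using ou[of v] uv ne dg gp gp' by simp
  \<comment> \<open>By \<open>o1\<close> both \<open>p\<close> and \<open>p'\<close> would be
    adjacent to \<open>v\<close>. Orthogonality to row \<open>u\<close> then fixes the imaginary
    part of \<open>a p p'\<close> up to sign, giving norm at least 7/4; beside two unit edges this
    leaves no room for charges at \<open>p\<close> and \<open>p'\<close>. The real parts of the
    remaining relations contradict \<open>o1\<close>.\<close>
  have common: "a v p = 0 \<and> a v p' = 0"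
  proof (rule ccontr)
    assume "\<not> (a v p = 0 \<and> a v p' = 0)"
    then have g: "a v p \<in> {1, -1}" "a v p' \<in> {1, -1}" using o1 gp gp' e by auto
    have x: "a p' p = cnj (a p p')" using herm[OF p(1,2)] .
    have r1: "\<omega> * a v p + (a u p * a p p + a u p' * a p' p) = 0"
      and r2: "\<omega> * a v p' + (a u p * a p p' + a u p' * a p' p') = 0"
      using ou[OF p(1) pu(1)] ou[OF p(2) pu(2)] auv by simp_all
    have im: "(Im (a p p'))\<^sup>2 = 7 / 4"
    proof -
      have "Im (\<omega> * a v p' + (a u p * a p p' + a u p' * a p' p')) = 0" using r2 by simp
      then have "Im (a p p') = sqrt 7 / 2 \<or> Im (a p p') = - (sqrt 7 / 2)"
        using g e diag[OF p(2)] by auto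
      then have "(Im (a p p'))\<^sup>2 = (sqrt 7 / 2)\<^sup>2"
        by (elim disjE) (simp_all only: power2_minus)
      then show ?thesis by (simp add: power_divide)
    qed
    have bk: "cmod (a p u) = 1" "cmod (a p' u) = 1" "cmod (a p v) = 1" "cmod (a p' v) = 1"
      using norm_sym[of u p] norm_sym[of u p'] norm_sym[of v p] norm_sym[of v p'] uv p e g by auto
    have "(cmod (a p p'))\<^sup>2 \<ge> 7 / 4" using im unfolding cmod_power2 by simp
    moreover have "cmod (a p' p) = cmod (a p p')" using x by simp
    moreover have "(\<Sum>x\<leftarrow>[u, v, p', p]. (cmod (a p x))\<^sup>2) \<le> row_weight n a p"
      using weight_split[of "[u, v, p', p]" p] uv p pu ne by (auto intro!: sum_nonneg)
    moreover have "(\<Sum>x\<leftarrow>[u, v, p, p']. (cmod (a p' x))\<^sup>2) \<le> row_weight n a p'"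
      using weight_split[of "[u, v, p, p']" p'] uv p pu ne by (auto intro!: sum_nonneg)
    ultimately have "(cmod (a p p))\<^sup>2 < 1" "(cmod (a p' p'))\<^sup>2 < 1"
      using weight_le[OF p(1)] weight_le[OF p(2)] bk by auto
    then have "a p p = 0" "a p' p' = 0" using diag[OF p(1)] diag[OF p(2)] by auto
    then have r1': "\<omega> * a v p + a u p' * cnj (a p p') = 0" and r2': "\<omega> * a v p' + a u p * a p p' = 0"
      using r1 r2 x by simp_all
    have "Re (\<omega> * a v p + a u p' * cnj (a p p')) = 0" "Re (\<omega> * a v p' + a u p * a p p') = 0"
      using r1' r2' by simp_all
    then show False using e g o1 by auto
  qed
  have pq: "p \<noteq> q" "p \<noteq> q'" "p' \<noteq> q" "p' \<noteq> q'" using common q by auto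
  define t where "t = (\<lambda>i. if i = p then a u p else if i = p' then a u p' else if i = q then a v q
    else if i = q' then a v q' else 1)"
  have t: "t i \<in> {1, -1}" for i using e by (auto simp: t_def)
  interpret b: tight n "\<lambda>i j. t i * t j * a i j" by (rule tight_switch[OF t])
  have tu: "t u = 1" "t v = 1" using pu qv p q by (auto simp: t_def)
  have tt: "t p = a u p" "t p' = a u p'" "t q = a v q" "t q' = a v q'"
    using p q pq by (auto simp: t_def)
  have star: "b.edge_star u v p p' q q'"
    unfolding b.edge_star_def tu tt using e auv common ne pu qv p q pq uv by auto
  have "cmod (t i) = 1" for i using t[of i] by auto
  then have "equiv_entries n (\<lambda>i j. t i * t j * a i j) S6_dagger \<or>
      equiv_entries n (\<lambda>i j. t i * t j * a i j) S8_star"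
    by (intro b.edge_star_classification[OF star]) (simp add: norm_mult unch)
  then show ?thesis using equiv_entries_switch[of t, OF t] by blast
qed

text \<open>A reduction to the label \<open>\<omega>\<close>: negation makes a charge at a heavy
  edge positive, conjugation turns \<open>cnj \<omega>\<close> into \<open>\<omega>\<close>, and
  switching at one end removes a sign.\<close>

lemma single_heavy_classification:
  assumes single: "\<And>i j k. i < n \<Longrightarrow> j < n \<Longrightarrow> k < n \<Longrightarrow> j \<noteq> k \<Longrightarrow>
      (cmod (a i j))\<^sup>2 = 2 \<Longrightarrow> (cmod (a i k))\<^sup>2 \<noteq> 2"
    and uv: "u < n" "v < n" "(cmod (a u v))\<^sup>2 = 2"
  shows "equiv_entries n a S4 \<or> equiv_entries n a S6_dagger \<or> equiv_entries n a S8_star"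
proof (cases "\<exists>i j. i < n \<and> j < n \<and> (cmod (a i j))\<^sup>2 = 2 \<and> a i i \<noteq> 0")
  case True
  then obtain i j where ij: "i < n" "j < n" "(cmod (a i j))\<^sup>2 = 2" "a i i \<noteq> 0" by blast
  have ne: "i \<noteq> j" using heavy_ne ij by blast
  have key: "equiv_entries n b S4"
    if tb: "tight n b" and nb: "\<And>k l. cmod (b k l) = cmod (a k l)" and bi: "b i i = 1" for b
  proof -
    interpret b: tight n b by (rule tb)
    have key': "equiv_entries n c S4" if tc: "tight n c" and nc: "\<And>k l. cmod (c k l) = cmod (a k l)"
      and ci: "c i i = 1" and w: "c i j \<in> {\<omega>, -\<omega>}" for c
    proof -
      interpret c: tight n c by (rule tc)
      define t where "t = (\<lambda>k. if k = j \<and> c i j = -\<omega> then -1 else 1 :: complex)"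
      have t: "t k \<in> {1, -1}" for k by (auto simp: t_def)
      interpret d: tight n "\<lambda>k l. t k * t l * c k l" by (rule c.tight_switch[OF t])
      have nt: "cmod (t k) = 1" for k by (simp add: t_def)
      have "equiv_entries n (\<lambda>k l. t k * t l * c k l) S4"
      proof (rule d.charged_heavy_edge[OF _ ij(1,2)])
        show "t i * t j * c i j = \<omega>" using w ne by (auto simp: t_def)
        show "t i * t i * c i i = 1" using ci t[of i] by auto
      qed (use single nt nc in \<open>simp add: norm_mult\<close>)
      then show ?thesis by (rule equiv_entries_switch[of t, OF t])
    qed
    have "(cmod (b i j))\<^sup>2 = 2" using ij nb by simp
    then have "b i j \<in> {\<omega>, -\<omega>, cnj \<omega>, - cnj \<omega>}" using Zomega_norm_2 b.entry ij by blast
    then consider "b i j \<in> {\<omega>, -\<omega>}" | "cnj (b i j) \<in> {\<omega>, -\<omega>}" by auto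
    then show ?thesis
    proof cases
      case 1
      then show ?thesis using key'[OF tb nb bi] by blast
    next
      case 2
      have "equiv_entries n (\<lambda>k l. cnj (b k l)) S4"
        by (rule key'[OF b.tight_cnj]) (use nb bi 2 in auto)
      then show ?thesis by (rule equiv_entries_cnj)
    qed
  qed
  have "a i i = 1 \<or> a i i = -1" using diag[OF ij(1)] ij(4) by auto
  then show ?thesis
  proof
    assume "a i i = 1"
    then show ?thesis using key[OF tight_axioms] by simp
  next
    assume "a i i = -1"
    then have "equiv_entries n (\<lambda>k l. - a k l) S4" by (intro key[OF tight_uminus]) auto
    then show ?thesis using equiv_entries_uminus by blast
  qed
next
  case False
  have ne: "u \<noteq> v" using heavy_ne uv by blast
  have key: "equiv_entries n c S6_dagger \<or> equiv_entries n c S8_star"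
    if tc: "tight n c" and nc: "\<And>k l. cmod (c k l) = cmod (a k l)" and w: "c u v \<in> {\<omega>, -\<omega>}" for c
  proof -
    interpret c: tight n c by (rule tc)
    define t where "t = (\<lambda>k. if k = v \<and> c u v = -\<omega> then -1 else 1 :: complex)"
    have t: "t k \<in> {1, -1}" for k by (auto simp: t_def)
    interpret d: tight n "\<lambda>k l. t k * t l * c k l" by (rule c.tight_switch[OF t])
    have nt: "cmod (t k) = 1" for k by (simp add: t_def)
    have c0: "c k k = 0" if "k < n" "l < n" "(cmod (a k l))\<^sup>2 = 2" for k l
    proof -
      have "a k k = 0" using False that by blast
      then show ?thesis using nc[of k k] by simp
    qed
    have "equiv_entries n (\<lambda>k l. t k * t l * c k l) S6_dagger \<or>
        equiv_entries n (\<lambda>k l. t k * t l * c k l) S8_star"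
    proof (rule d.uncharged_heavy_edge[OF _ _ uv(1,2)])
      show "t u * t v * c u v = \<omega>" using w ne by (auto simp: t_def)
      show "t k * t k * c k k = 0" if "k < n" "l < n" "(cmod (t k * t l * c k l))\<^sup>2 = 2" for k l
        using c0[OF that(1,2)] that(3) nt nc by (simp add: norm_mult)
    qed (use single nt nc in \<open>simp add: norm_mult\<close>)
    then show ?thesis using equiv_entries_switch[of t, OF t] by blast
  qed
  have "a u v \<in> {\<omega>, -\<omega>, cnj \<omega>, - cnj \<omega>}" using Zomega_norm_2 entry uv by blast
  then consider "a u v \<in> {\<omega>, -\<omega>}" | "cnj (a u v) \<in> {\<omega>, -\<omega>}" by auto
  then show ?thesis
  proof cases
    case 1
    then show ?thesis using key[OF tight_axioms] by simp
  next
    case 2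
    then have "equiv_entries n (\<lambda>k l. cnj (a k l)) S6_dagger \<or> equiv_entries n (\<lambda>k l. cnj (a k l)) S8_star"
      by (intro key[OF tight_cnj]) auto
    then show ?thesis using equiv_entries_cnj by blast
  qed
qed

end

section \<open>Chains of columns\<close>

lemma edge_label_eqI:
  assumes "\<And>y. ((i, j), y) \<in> set es \<Longrightarrow> y = x" "x \<noteq> 0 \<Longrightarrow> ((i, j), x) \<in> set es"
  shows "edge_label es i j = x"
proof (cases "map_of es (i, j)")
  case None
  then have "((i, j), x) \<notin> set es" by (metis map_of_eq_None_iff fst_conv image_eqI)
  then show ?thesis using None assms(2) by (auto simp: edge_label_def)
next
  case (Some y)
  then show ?thesis using assms(1)[OF map_of_SomeD[OF Some]] by (simp add: edge_label_def)
qed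

text \<open>Parametrises the edges by their smaller endpoint instead of the column, the form in
  which labels are compared.\<close>

lemma set_ladder_edges:
  "((i, j), x) \<in> set (ladder_edges m) \<longleftrightarrow>
    (1 \<le> i \<and> i < m \<and> j = i + 1 \<and> x = 1) \<or> (m < i \<and> i < 2 * m \<and> j = i + 1 \<and> x = -1) \<or>
    (1 \<le> i \<and> i < m \<and> j = m + i + 1 \<and> x = 1) \<or> (2 \<le> i \<and> i \<le> m \<and> j + 1 = m + i \<and> x = -1)"
  (is "_ \<longleftrightarrow> ?r")
proof
  assume "((i, j), x) \<in> set (ladder_edges m)"
  then show ?r unfolding ladder_edges_def by auto
next
  assume ?r
  then consider "1 \<le> i" "i < m" "j = i + 1" "x = 1" | "m < i" "i < 2 * m" "j = i + 1" "x = -1" |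
    "1 \<le> i" "i < m" "j = m + i + 1" "x = 1" | "2 \<le> i" "i \<le> m" "j + 1 = m + i" "x = -1" by blast
  then show "((i, j), x) \<in> set (ladder_edges m)"
  proof cases
    case 2
    then show ?thesis unfolding ladder_edges_def by (auto intro!: bexI[of _ "i - m"])
  next
    case 4
    then show ?thesis unfolding ladder_edges_def by (auto intro!: bexI[of _ "i - 1"])
  qed (auto simp: ladder_edges_def)
qed

text \<open>Index \<open>0\<close> is the end vertex; indices \<open>2 c - 1\<close> and \<open>2 c\<close> form column \<open>c \<ge> 1\<close>.\<close>

definition chain_column :: "nat \<Rightarrow> nat" where
  "chain_column i = (i + 1) div 2"

text \<open>The model is an infinite uncharged chain. A label between consecutive columns depends
  only on the vertex in the earlier one, so the two vertices of a column agree to the left and are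
  opposite to the right, which makes their rows orthogonal.\<close>

definition chain_entry :: "nat \<Rightarrow> nat \<Rightarrow> complex" where
  "chain_entry i j =
    (if chain_column j = Suc (chain_column i) then if i = 0 then cnj \<omega> else if odd i then 1 else -1
     else if chain_column i = Suc (chain_column j) then if j = 0 then \<omega> else if odd j then 1 else -1
     else 0)"

lemma chain_entry_cnj: "cnj (chain_entry i j) = chain_entry j i"
  by (auto simp: chain_entry_def)

lemma chain_column_simps [simp]:
  "chain_column 0 = 0" "chain_column (Suc (2 * c)) = Suc c" "chain_column (2 * c + 2) = Suc c"
  "chain_column (Suc (Suc (2 * c))) = Suc c"
  by (simp_all add: chain_column_def)

text \<open>Column \<open>k\<close> may end the chain: its charges \<open>c\<close> and inner edge
  \<open>- c\<close> take over the contribution that the next column would make to the orthogonality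
  of its two rows.\<close>

definition chain_entry_charged :: "nat \<Rightarrow> complex \<Rightarrow> nat \<Rightarrow> nat \<Rightarrow> complex" where
  "chain_entry_charged k c i j =
    (if chain_column i = k \<and> chain_column j = k then if i = j then c else - c else chain_entry i j)"

context tight
begin

text \<open>The induction invariant: up to the signs \<open>s\<close> the vertices found so far form
  the model. Those before the last column (indices below \<open>2 * m - 1\<close>) are saturated and
  have no edges outside, and the two vertices of the last column are opposite outside, up to
  signs.\<close>

definition chain :: "nat \<Rightarrow> (nat \<Rightarrow> nat) \<Rightarrow> (nat \<Rightarrow> complex) \<Rightarrow> bool" where
  "chain m f s \<longleftrightarrow> inj_on f {..2 * m} \<and> f ` {..2 * m} \<subseteq> {..<n} \<and> (\<forall>i. s i \<in> {1, -1}) \<and>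
    (\<forall>i\<le>2 * m. \<forall>j\<le>2 * m. a (f i) (f j) = s i * s j * chain_entry i j) \<and>
    (\<forall>i<2 * m - 1. row_weight n a (f i) = 4 \<and> (\<forall>z<n. z \<notin> f ` {..2 * m} \<longrightarrow> a (f i) z = 0)) \<and>
    (\<forall>z<n. z \<notin> f ` {..2 * m} \<longrightarrow> s (2 * m) * a (f (2 * m)) z = - (s (2 * m - 1) * a (f (2 * m - 1)) z))"

lemma symmetric_entries:
  fixes N i j :: nat
  assumes s: "\<And>i. s i \<in> {1, -1 :: complex}" and f: "\<And>i. i \<le> N \<Longrightarrow> f i < n"
    and M: "\<And>i j. cnj (M i j) = M j i"
    and e: "\<And>i j. i \<le> j \<Longrightarrow> j \<le> N \<Longrightarrow> a (f i) (f j) = s i * s j * M i j"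
    and ij: "i \<le> N" "j \<le> N"
  shows "a (f i) (f j) = s i * s j * M i j"
proof (cases "i \<le> j")
  case True
  then show ?thesis using e ij by simp
next
  case False
  have "a (f i) (f j) = cnj (a (f j) (f i))" using herm f ij by blast
  also have "a (f j) (f i) = s j * s i * M j i" using False ij by (intro e) simp_all
  also have "cnj (s j * s i * M j i) = s i * s j * M i j"
    using s[of i] s[of j] M[of j i] by auto
  finally show ?thesis .
qed

text \<open>The label \<open>\<theta>\<close> at the closing vertex is \<open>\<omega>\<close> for
  \<open>T4\<close> and \<open>cnj \<omega>\<close> for \<open>T4'\<close>.\<close>

lemma chain_T4:
  assumes m: "m \<ge> 1" and f: "inj_on f {..2 * m + 1}" "f ` {..2 * m + 1} = {..<n}"
    and s: "\<And>i. s i \<in> {1, -1}"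
    and e: "\<And>i j. i \<le> 2 * m \<Longrightarrow> j \<le> 2 * m \<Longrightarrow> a (f i) (f j) = s i * s j * chain_entry i j"
    and w: "a (f (2 * m - 1)) (f (2 * m + 1)) = s (2 * m - 1) * s (2 * m + 1) * \<theta>"
      "a (f (2 * m)) (f (2 * m + 1)) = - (s (2 * m) * s (2 * m + 1) * \<theta>)"
      "\<And>i. i < 2 * m - 1 \<Longrightarrow> a (f i) (f (2 * m + 1)) = 0"
      "a (f (2 * m + 1)) (f (2 * m + 1)) = 0"
    and th: "\<theta> \<noteq> 0"
  shows "equiv_entries n a (graph_mat (2 * (m + 1)) (\<lambda>_. 0) (ladder_edges m @
     [((1, 2 * m + 1), \<omega>), ((m + 1, 2 * m + 1), \<omega>), ((m, 2 * m + 2), \<theta>), ((2 * m, 2 * m + 2), - \<theta>)]))"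
proof -
  let ?es = "ladder_edges m @
     [((1, 2 * m + 1), \<omega>), ((m + 1, 2 * m + 1), \<omega>), ((m, 2 * m + 2), \<theta>), ((2 * m, 2 * m + 2), - \<theta>)]"
  have n: "n = 2 * (m + 1)"
    using card_image[OF f(1)] f(2) by simp
  \<comment> \<open>The target lists the first vertices of the columns, then the second ones, the
    end vertex and last the closing vertex; a chain is numbered column by column from its end
    vertex.\<close>
  define g where "g = (\<lambda>i. if i < m then Suc (2 * i) else if i < 2 * m then Suc (Suc (2 * (i - m)))
    else if i = 2 * m then 0 else 2 * m + 1)"
  have gi: "inj_on g {..<n}"
  proof (rule inj_onI)
    fix i j assume "i \<in> {..<n}" "j \<in> {..<n}" "g i = g j"
    then show "i = j" unfolding g_def n by (auto split: if_splits) presburger+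
  qed
  have gr: "g i \<le> 2 * m + 1" if "i < n" for i using that m unfolding g_def n by auto
  have "inj_on (f \<circ> g) {..<n}"
    using gi gr by (intro comp_inj_on inj_on_subset[OF f(1)]) auto
  moreover have "(f \<circ> g) ` {..<n} \<subseteq> {..<n}" using gr f(2) by auto
  ultimately have bij: "bij_betw (f \<circ> g) {..<n} {..<n}"
    unfolding bij_betw_def using endo_inj_surj[OF finite_lessThan] by blast
  have ss: "s i * s i = 1" "s i * (s i * x) = x" "s i * s j * (s i * s j * x) = x" for i j x
    using s[of i] s[of j] by auto
  have "equiv_entries n a (graph_mat n (\<lambda>_. 0) ?es)"
  proof (rule equiv_graph_matI[where f = "\<lambda>x. x", OF _ bij, of "s \<circ> g"])
    show "(s \<circ> g) i \<in> {1, -1}" for i using s by simp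
    fix i assume i: "i < n"
    show "0 = a ((f \<circ> g) i) ((f \<circ> g) i)"
    proof (cases "g i \<le> 2 * m")
      case True
      then show ?thesis using e by (simp add: chain_entry_def)
    next
      case False
      then have "g i = 2 * m + 1" using gr[OF i] by simp
      then show ?thesis using w(4) by simp
    qed
  next
    fix i j assume ij: "i < j" "j < n"
    show "edge_label ?es (i + 1) (j + 1) = (s \<circ> g) i * (s \<circ> g) j * a ((f \<circ> g) i) ((f \<circ> g) j)"
    proof (cases "j = 2 * m + 1")
      case True
      then have gj: "g j = 2 * m + 1" by (simp add: g_def)
      have "edge_label ?es (i + 1) (j + 1) = (if i + 1 = m then \<theta> else if i + 1 = 2 * m then - \<theta> else 0)"
        using True ij m by (intro edge_label_eqI) (auto simp: set_ladder_edges split: if_splits)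
      also have "\<dots> = (s \<circ> g) i * (s \<circ> g) j * a ((f \<circ> g) i) ((f \<circ> g) j)"
      proof -
        consider "i + 1 = m" | "i + 1 = 2 * m" "i + 1 \<noteq> m" | "i + 1 \<noteq> m" "i + 1 \<noteq> 2 * m" by blast
        then show ?thesis
        proof cases
          case 1
          then have "g i = 2 * m - 1" by (auto simp: g_def)
          then show ?thesis using 1 w(1) by (simp add: gj ss)
        next
          case 2
          then have "g i = 2 * m" using m by (auto simp: g_def)
          then show ?thesis using 2 w(2) by (simp add: gj ss)
        next
          case 3
          then have "g i < 2 * m - 1" using ij True m by (auto simp: g_def)
          then show ?thesis using 3 w(3) by (simp add: gj)
        qed
      qed
      finally show ?thesis .
    next
      case False
      then have j: "j \<le> 2 * m" using ij n by simp
      then have le: "g i \<le> 2 * m" "g j \<le> 2 * m" using ij m by (auto simp: g_def)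
      have "(s \<circ> g) i * (s \<circ> g) j * a ((f \<circ> g) i) ((f \<circ> g) j) = chain_entry (g i) (g j)"
        using e[OF le] by (simp add: ss)
      moreover have "edge_label ?es (i + 1) (j + 1) = chain_entry (g i) (g j)"
      proof -
        consider "j < m" | "i < m" "m \<le> j" "j < 2 * m" | "m \<le> i" "j < 2 * m" |
          "i < m" "j = 2 * m" | "m \<le> i" "j = 2 * m" using ij j by linarith
        then show ?thesis
        proof cases
          case 1
          then have "chain_entry (g i) (g j) = (if j = Suc i then 1 else 0)"
            using ij by (simp add: g_def chain_entry_def)
          then show ?thesis using 1 ij by (intro edge_label_eqI) (auto simp: set_ladder_edges split: if_splits)
        next
          case 2
          then have "chain_entry (g i) (g j) = (if j - m = Suc i then 1 else if i = Suc (j - m) then -1 else 0)"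
            by (simp add: g_def chain_entry_def)
          then show ?thesis using 2 ij by (intro edge_label_eqI) (auto simp: set_ladder_edges split: if_splits)
        next
          case 3
          then have "chain_entry (g i) (g j) = (if j = Suc i then -1 else 0)"
            using ij by (auto simp: g_def chain_entry_def)
          then show ?thesis using 3 ij by (intro edge_label_eqI) (auto simp: set_ladder_edges split: if_splits)
        next
          case 4
          then have "chain_entry (g i) (g j) = (if i = 0 then \<omega> else 0)"
            by (simp add: g_def chain_entry_def)
          then show ?thesis using 4 ij by (intro edge_label_eqI) (auto simp: set_ladder_edges split: if_splits)
        next
          case 5
          then have "chain_entry (g i) (g j) = (if i = m then \<omega> else 0)"
            using ij by (simp add: g_def chain_entry_def)
          then show ?thesis using 5 ij by (intro edge_label_eqI) (auto simp: set_ladder_edges split: if_splits)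
        qed
      qed
      ultimately show ?thesis by simp
    qed
  qed simp
  then show ?thesis unfolding n .
qed

lemma chain_C2:
  assumes k: "k \<ge> 1" and f: "inj_on f {..2 * k}" "f ` {..2 * k} = {..<n}"
    and s: "\<And>i. s i \<in> {1, -1}" and c: "c \<in> {1, -1}"
    and e: "\<And>i j. i \<le> 2 * k \<Longrightarrow> j \<le> 2 * k \<Longrightarrow> a (f i) (f j) = s i * s j * chain_entry_charged k c i j"
  shows "equiv_entries n a (C2_plus k)"
proof -
  let ?es = "[((1, k + 1), 1)] @ ladder_edges k @ [((k, 2 * k + 1), \<omega>), ((2 * k, 2 * k + 1), - \<omega>)]"
  have n: "n = 2 * k + 1"
    using card_image[OF f(1)] f(2) by simp
  \<comment> \<open>\<open>C2_plus\<close> counts columns from the charged end, so the chain is read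
    backwards, with its end vertex last.\<close>
  define g where "g = (\<lambda>i. if i < k then Suc (2 * (k - 1 - i)) else if i < 2 * k then Suc (Suc (2 * (2 * k - 1 - i))) else 0)"
  have gi: "inj_on g {..<n}"
  proof (rule inj_onI)
    fix i j assume "i \<in> {..<n}" "j \<in> {..<n}" "g i = g j"
    then show "i = j" unfolding g_def n by (auto split: if_splits) presburger+
  qed
  have gr: "g i \<le> 2 * k" if "i < n" for i using that k unfolding g_def n by auto
  have "inj_on (f \<circ> g) {..<n}"
    using gi gr by (intro comp_inj_on inj_on_subset[OF f(1)]) auto
  moreover have "(f \<circ> g) ` {..<n} \<subseteq> {..<n}" using gr f(2) by auto
  ultimately have bij: "bij_betw (f \<circ> g) {..<n} {..<n}"
    unfolding bij_betw_def using endo_inj_surj[OF finite_lessThan] by blast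
  have ss: "s i * s i = 1" for i using s[of i] by auto
  have gcol: "chain_column (g i) = (if i < k then k - i else if i < 2 * k then 2 * k - i else 0)" for i
    by (auto simp: g_def)
  have godd: "odd (g i) \<longleftrightarrow> i < k" and g0: "g i = 0 \<longleftrightarrow> 2 * k \<le> i" for i
    by (auto simp: g_def)
  have cc: "c * c = 1" using c by auto
  \<comment> \<open>Charge \<open>-1\<close> is treated by negating the graph.\<close>
  define h where "h = (\<lambda>x. if c = 1 then x else - x :: complex)"
  have h: "h \<in> {\<lambda>x. x, uminus, cnj, \<lambda>x. - cnj x}" unfolding h_def by (cases "c = 1") auto
  have hc: "h x = c * x" for x using c by (auto simp: h_def)
  \<comment> \<open>Reading backwards makes labels depend on the later column, which a sign on the
    second row of vertices repairs. The power of \<open>c\<close> undoes the negation on edges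
    between consecutive columns, whose numbers have an odd sum.\<close>
  define t where "t = (\<lambda>i. s (g i) * (if k \<le> i \<and> i < 2 * k then -1 else 1) * c ^ chain_column (g i))"
  have t: "t i \<in> {1, -1}" for i
  proof -
    have "c ^ chain_column (g i) \<in> {1, -1}" using c by (cases "even (chain_column (g i))") auto
    then show ?thesis using s[of "g i"] by (auto simp: t_def)
  qed
  have "equiv_entries n a (graph_mat n (\<lambda>i. if i \<in> {1, k + 1} then 1 else 0) ?es)"
  proof (rule equiv_graph_matI[OF h bij, of t])
    show "t i \<in> {1, -1}" for i by (rule t)
    fix i assume i: "i < n"
    have "chain_column (g i) = k \<longleftrightarrow> i = 0 \<or> i = k"
      using k i n by (auto simp: g_def)
    then show "(if i + 1 \<in> {1, k + 1} then 1 else 0) = h (a ((f \<circ> g) i) ((f \<circ> g) i))"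
      using e[OF gr[OF i] gr[OF i]] cc
      by (auto simp: hc ss chain_entry_charged_def chain_entry_def)
  next
    fix i j assume ij: "i < j" "j < n"
    let ?u = "\<lambda>i. if k \<le> i \<and> i < 2 * k then -1 else 1 :: complex"
    have le: "g i \<le> 2 * k" "g j \<le> 2 * k" using gr ij by auto
    have "t i * t j * h (a ((f \<circ> g) i) ((f \<circ> g) j)) =
      (s (g i) * s (g i)) * (s (g j) * s (g j)) * ?u i * ?u j *
        (c ^ Suc (chain_column (g i) + chain_column (g j)) * chain_entry_charged k c (g i) (g j))"
      unfolding hc t_def comp_def e[OF le] power_Suc power_add by (simp only: mult_ac)
    also have "\<dots> = ?u i * ?u j *
        (c ^ Suc (chain_column (g i) + chain_column (g j)) * chain_entry_charged k c (g i) (g j))"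
      by (simp add: ss)
    also have "c ^ Suc (chain_column (g i) + chain_column (g j)) * chain_entry_charged k c (g i) (g j)
        = (if i = 0 \<and> j = k then - 1 else chain_entry (g i) (g j))"
    proof (cases "i = 0 \<and> j = k")
      case True
      then have "chain_column (g i) = k" "chain_column (g j) = k" "g i \<noteq> g j"
        using k by (auto simp: g_def)
      moreover have "c ^ (k + k) = 1" using cc by (simp add: power_add flip: power_mult_distrib)
      ultimately show ?thesis using True cc by (simp add: chain_entry_charged_def)
    next
      case False
      then have "\<not> (chain_column (g i) = k \<and> chain_column (g j) = k)"
        using k ij n by (auto simp: g_def split: if_splits)
      then have 1: "chain_entry_charged k c (g i) (g j) = chain_entry (g i) (g j)"
        by (auto simp: chain_entry_charged_def)
      have pw: "c ^ Suc (N + Suc N) = 1" for N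
      proof -
        have "c ^ Suc (N + Suc N) = (c * c) ^ Suc N" by (simp add: power_add power_mult_distrib)
        then show ?thesis using cc by simp
      qed
      have "c ^ Suc (N + M) * chain_entry (g i) (g j) = chain_entry (g i) (g j)"
        if N: "N = chain_column (g i)" and M: "M = chain_column (g j)" for N M
      proof (cases "M = Suc N \<or> N = Suc M")
        case True
        then have "c ^ Suc (N + M) = 1" using pw[of N] pw[of M] by (auto simp: add.commute)
        then show ?thesis by simp
      next
        case False
        then have "chain_entry (g i) (g j) = 0" unfolding chain_entry_def N M by simp
        then show ?thesis by simp
      qed
      then show ?thesis using False unfolding 1 by auto
    qed
    also have "?u i * ?u j * (if i = 0 \<and> j = k then - 1 else chain_entry (g i) (g j)) =
        edge_label ?es (i + 1) (j + 1)"
    proof -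
      consider "j < k" | "i < k" "k \<le> j" "j < 2 * k" | "k \<le> i" "j < 2 * k" |
          "i < k" "j = 2 * k" | "k \<le> i" "j = 2 * k" using ij n by linarith
      then show ?thesis
      proof cases
        case 1
        then have "chain_entry (g i) (g j) = (if j = Suc i then 1 else 0)"
          using ij by (auto simp: chain_entry_def gcol godd g0)
        then show ?thesis using 1 ij
          by (intro edge_label_eqI[symmetric]) (auto simp: set_ladder_edges split: if_splits)
      next
        case 2
        then have "chain_entry (g i) (g j) = (if j = Suc (k + i) then -1 else if k + i = Suc j then 1 else 0)"
          by (auto simp: chain_entry_def gcol godd g0)
        then show ?thesis using 2 ij
          by (intro edge_label_eqI[symmetric]) (auto simp: set_ladder_edges split: if_splits)
      next
        case 3
        then have "chain_entry (g i) (g j) = (if j = Suc i then -1 else 0)"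
          using ij by (auto simp: chain_entry_def gcol godd g0)
        then show ?thesis using 3 ij k
          by (intro edge_label_eqI[symmetric]) (auto simp: set_ladder_edges split: if_splits)
      next
        case 4
        then have "chain_entry (g i) (g j) = (if i = k - 1 then \<omega> else 0)"
          by (auto simp: chain_entry_def gcol godd g0)
        then show ?thesis using 4 ij
          by (intro edge_label_eqI[symmetric]) (auto simp: set_ladder_edges split: if_splits)
      next
        case 5
        then have "chain_entry (g i) (g j) = (if i = 2 * k - 1 then \<omega> else 0)"
          using ij by (auto simp: chain_entry_def gcol godd g0)
        then show ?thesis using 5 ij k
          by (intro edge_label_eqI[symmetric]) (auto simp: set_ladder_edges split: if_splits)
      qed
    qed
    finally show "edge_label ?es (i + 1) (j + 1) = t i * t j * h (a ((f \<circ> g) i) ((f \<circ> g) j))" ..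
  qed
  then show ?thesis unfolding C2_plus_def n .
qed


section \<open>Growing a chain column by column\<close>

lemma chainD:
  assumes "chain m f s"
  shows "inj_on f {..2 * m}" "\<And>i. i \<le> 2 * m \<Longrightarrow> f i < n" "\<And>i. s i \<in> {1, -1}"
    "\<And>i j. i \<le> 2 * m \<Longrightarrow> j \<le> 2 * m \<Longrightarrow> a (f i) (f j) = s i * s j * chain_entry i j"
    "\<And>i. i < 2 * m - 1 \<Longrightarrow> row_weight n a (f i) = 4"
    "\<And>i z. i < 2 * m - 1 \<Longrightarrow> z < n \<Longrightarrow> z \<notin> f ` {..2 * m} \<Longrightarrow> a (f i) z = 0"
    "\<And>z. z < n \<Longrightarrow> z \<notin> f ` {..2 * m} \<Longrightarrow> s (2 * m) * a (f (2 * m)) z = - (s (2 * m - 1) * a (f (2 * m - 1)) z)"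
  using assms unfolding chain_def by blast+

text \<open>Treats the first column and later ones alike. Whether the last column is joined to the
  end vertex by two heavy edges or to a column by four unit edges, each of its vertices has weight 2
  to the left, and there the two rows have inner product 2 up to sign.\<close>

lemma chain_previous:
  assumes ch: "chain m f s" and m: "m \<ge> 1"
  obtains xs where "distinct xs" "set xs \<subseteq> f ` {..<2 * m - 1}"
    "(\<Sum>z\<leftarrow>xs. (cmod (a (f (2 * m - 1)) z))\<^sup>2) = 2" "(\<Sum>z\<leftarrow>xs. (cmod (a (f (2 * m)) z))\<^sup>2) = 2"
    "(\<Sum>z\<leftarrow>xs. a (f (2 * m - 1)) z * a z (f (2 * m))) = 2 * (s (2 * m - 1) * s (2 * m))"
    "\<And>i. i \<le> 2 * m \<Longrightarrow> f i \<notin> set xs \<Longrightarrow> a (f (2 * m - 1)) (f i) = 0"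
proof -
  note D = chainD[OF ch]
  have ss: "s i * s i = 1" "cmod (s i) = 1" for i using D(3)[of i] by auto
  have sx: "s i * s j * (s j * s k) = s i * s k" for i j k using ss(1)[of j] by (simp add: mult_ac)
  obtain c where c: "m = Suc c" using m by (cases m) auto
  have i1: "2 * m - 1 = Suc (2 * c)" "2 * m = Suc (Suc (2 * c))" by (simp_all add: c)
  show ?thesis
  proof (cases c)
    case 0
    have E: "a (f 1) (f 0) = s 1 * s 0 * \<omega>" "a (f 2) (f 0) = s 2 * s 0 * \<omega>" "a (f 0) (f 2) = s 0 * s 2 * cnj \<omega>"
      using D(4)[of 1 0] D(4)[of 2 0] D(4)[of 0 2] by (simp_all add: c 0 chain_entry_def chain_column_def)
    have i2: "2 * m - 1 = 1" "2 * m = 2" by (simp_all add: c 0)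
    show ?thesis
    proof (rule that[of "[f 0]"])
      show "set [f 0] \<subseteq> f ` {..<2 * m - 1}" unfolding i2 by auto
      show "(\<Sum>z\<leftarrow>[f 0]. (cmod (a (f (2 * m - 1)) z))\<^sup>2) = 2"
        "(\<Sum>z\<leftarrow>[f 0]. (cmod (a (f (2 * m)) z))\<^sup>2) = 2"
        unfolding i2 using E ss by (simp_all add: norm_mult)
      show "a (f (2 * m - 1)) (f i) = 0" if "i \<le> 2 * m" "f i \<notin> set [f 0]" for i
      proof -
        have "i = 1 \<or> i = 2" using that by (auto simp: c 0) (metis One_nat_def Suc_1 le_Suc_eq le_zero_eq)
        then show ?thesis using D(4)[of 1 i] by (auto simp: c 0 chain_entry_def chain_column_def)
      qed
      show "(\<Sum>z\<leftarrow>[f 0]. a (f (2 * m - 1)) z * a z (f (2 * m))) = 2 * (s (2 * m - 1) * s (2 * m))"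
      proof -
        have "s 1 * s 0 * \<omega> * (s 0 * s 2 * cnj \<omega>) = (s 1 * s 0 * (s 0 * s 2)) * (\<omega> * cnj \<omega>)"
          by (simp only: mult_ac)
        also have "\<dots> = 2 * (s 1 * s 2)" unfolding sx omega_mult_cnj by simp
        finally have "a (f 1) (f 0) * a (f 0) (f 2) = 2 * (s 1 * s 2)" unfolding E .
        then show ?thesis unfolding i2 by simp
      qed
    qed simp
  next
    case (Suc d)
    let ?p = "Suc (2 * d)" and ?q = "Suc (Suc (2 * d))" and ?x = "Suc (2 * c)" and ?y = "Suc (Suc (2 * c))"
    have lt: "?p \<le> 2 * m" "?q \<le> 2 * m" "?x \<le> 2 * m" "?y \<le> 2 * m" by (simp_all add: c Suc)
    have E: "a (f ?x) (f ?p) = s ?x * s ?p" "a (f ?x) (f ?q) = - (s ?x * s ?q)"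
      "a (f ?y) (f ?p) = s ?y * s ?p" "a (f ?y) (f ?q) = - (s ?y * s ?q)"
      "a (f ?p) (f ?y) = s ?p * s ?y" "a (f ?q) (f ?y) = - (s ?q * s ?y)"
    proof -
      have "chain_entry ?x ?p = 1" "chain_entry ?x ?q = -1" "chain_entry ?y ?p = 1" "chain_entry ?y ?q = -1"
        "chain_entry ?p ?y = 1" "chain_entry ?q ?y = -1"
        by (simp_all add: chain_entry_def chain_column_def Suc del: chain_column_simps)
      then show "a (f ?x) (f ?p) = s ?x * s ?p" "a (f ?x) (f ?q) = - (s ?x * s ?q)"
        "a (f ?y) (f ?p) = s ?y * s ?p" "a (f ?y) (f ?q) = - (s ?y * s ?q)"
        "a (f ?p) (f ?y) = s ?p * s ?y" "a (f ?q) (f ?y) = - (s ?q * s ?y)"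
        using lt D(4) by simp_all
    qed
    have ne: "f ?p \<noteq> f ?q" using inj_onD[OF D(1), of ?p ?q] lt by auto
    show ?thesis
    proof (rule that[of "[f ?p, f ?q]"])
      show "distinct [f ?p, f ?q]" using ne by simp
      show "set [f ?p, f ?q] \<subseteq> f ` {..<2 * m - 1}" unfolding i1 by (auto simp: Suc)
      show "(\<Sum>z\<leftarrow>[f ?p, f ?q]. (cmod (a (f (2 * m - 1)) z))\<^sup>2) = 2"
        "(\<Sum>z\<leftarrow>[f ?p, f ?q]. (cmod (a (f (2 * m)) z))\<^sup>2) = 2"
        unfolding i1 using E ss by (simp_all add: norm_mult)
      show "(\<Sum>z\<leftarrow>[f ?p, f ?q]. a (f (2 * m - 1)) z * a z (f (2 * m))) = 2 * (s (2 * m - 1) * s (2 * m))"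
        unfolding i1 by (simp add: E sx)
      show "a (f (2 * m - 1)) (f i) = 0" if i: "i \<le> 2 * m" "f i \<notin> set [f ?p, f ?q]" for i
      proof -
        have "i \<noteq> ?p" "i \<noteq> ?q" using i by auto
        then have "chain_column i \<noteq> c" using Suc by (auto simp: chain_column_def)
        moreover have "chain_column i \<le> Suc c" using i by (simp add: chain_column_def c)
        ultimately have "chain_entry ?x i = 0" by (auto simp: chain_entry_def)
        then show ?thesis using D(4)[of ?x i] i lt unfolding i1 by simp
      qed
    qed
  qed
qed

text \<open>Otherwise the row has weight 2 and sees only what lies to its left. Then its row of
  \<open>A\<^sup>2\<close> vanishes off the diagonal except at the other vertex of the last column,
  where it is 2 up to sign, hence divisible by \<open>\<omega>\<close>. This is excluded by
  \<open>weight_2\<close>.\<close>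

lemma chain_saturated:
  assumes ch: "chain m f s" and m: "m \<ge> 1"
  shows "row_weight n a (f (2 * m - 1)) = 4"
proof (rule ccontr)
  assume not4: "row_weight n a (f (2 * m - 1)) \<noteq> 4"
  note D = chainD[OF ch]
  let ?x = "f (2 * m - 1)" and ?y = "f (2 * m)"
  obtain xs where xs: "distinct xs" "set xs \<subseteq> f ` {..<2 * m - 1}"
    "(\<Sum>z\<leftarrow>xs. (cmod (a ?x z))\<^sup>2) = 2" "(\<Sum>z\<leftarrow>xs. a ?x z * a z ?y) = 2 * (s (2 * m - 1) * s (2 * m))"
    by (rule chain_previous[OF ch m]) blast
  have x: "?x < n" using D(2) by simp
  have xsn: "set xs \<subseteq> {..<n}" using xs(2) D(2) by fastforce
  have W: "row_weight n a ?x = 2" and z: "\<And>j. j < n \<Longrightarrow> j \<notin> set xs \<Longrightarrow> a ?x j = 0"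
    using weight_2_or_4[OF x xs(1) xsn xs(3)] not4 by auto
  have sum: "(\<Sum>j<n. a ?x j * a j k) = (\<Sum>z\<leftarrow>xs. a ?x z * a z k)" for k
  proof -
    have "(\<Sum>j<n. a ?x j * a j k) = (\<Sum>j\<in>set xs. a ?x j * a j k)"
      by (rule sum.mono_neutral_right) (use xsn z in auto)
    then show ?thesis using xs(1) by (simp add: sum_list_distinct_conv_sum_set)
  qed
  show False
  proof (rule weight_2[OF x W, of \<omega>])
    fix k assume k: "k < n" "k \<noteq> ?x"
    consider "k = ?y" | i where "k = f i" "i < 2 * m - 1" | "k \<notin> f ` {..2 * m}"
    proof (cases "k \<in> f ` {..2 * m}")
      case True
      then obtain i where i: "k = f i" "i \<le> 2 * m" by auto
      then have "i = 2 * m \<or> i < 2 * m - 1" using k(2) m by (cases "i = 2 * m - 1") auto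
      then show ?thesis using i that by blast
    qed (use that in blast)
    then show "\<exists>w\<in>Zomega. (\<Sum>j<n. a ?x j * a j k) = \<omega> * w"
    proof cases
      case 1
      have "s (2 * m - 1) * s (2 * m) \<in> Zomega"
        using D(3)[of "2 * m - 1"] D(3)[of "2 * m"] Zomega_uminus[of 1] by auto
      then have "cnj \<omega> * (s (2 * m - 1) * s (2 * m)) \<in> Zomega"
        using Zomega_mult Zomega_cnj Zomega_omega by blast
      moreover have "(\<Sum>j<n. a ?x j * a j k) = \<omega> * (cnj \<omega> * (s (2 * m - 1) * s (2 * m)))"
        unfolding sum 1 xs(4) by (simp flip: mult.assoc)
      ultimately show ?thesis by blast
    next
      case 2
      have "(\<Sum>j<n. a k j * a j ?x) = 0"
        by (rule orth[OF k(1) x]) (use k 2 D(5) in auto)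
      moreover have "hermitian n a" unfolding hermitian_def using herm by blast
      ultimately have "(\<Sum>j<n. a ?x j * a j k) = 0"
        using hermitian_square_cnj[of n a ?x k] x k(1) by simp
      then show ?thesis by (auto intro!: bexI[of _ 0])
    next
      case 3
      have "a z k = 0" if "z \<in> set xs" for z using that xs(2) D(6)[OF _ k(1) 3] by auto
      then have "map (\<lambda>z. a ?x z * a z k) xs = map (\<lambda>_. 0) xs" by (intro map_cong) auto
      then have "(\<Sum>z\<leftarrow>xs. a ?x z * a z k) = 0" by (simp only: sum_list_0)
      then show ?thesis unfolding sum by (auto intro!: bexI[of _ 0])
    qed
  qed simp_all
qed

text \<open>The last column has weight 2 to spare. One heavy edge leads to a vertex that closes the
  chain. Two unit edges lead to a new column, which ends the graph if it is charged and otherwise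
  lengthens the chain.\<close>

lemma chain_classification:
  assumes "chain m f s" "m \<ge> 1"
  shows "(\<exists>k\<ge>2. equiv_entries n a (T4 k)) \<or> (\<exists>k\<ge>2. equiv_entries n a (T4' k)) \<or>
    (\<exists>k\<ge>1. equiv_entries n a (C2_plus k))"
  using assms
proof (induction "n - m" arbitrary: m f s rule: less_induct)
  case less
  note ch = less.prems(1) and m = less.prems(2) and D = chainD[OF less.prems(1)]
  let ?x = "f (2 * m - 1)" and ?y = "f (2 * m)" and ?U = "f ` {..2 * m}"
  obtain xs where xs: "distinct xs" "set xs \<subseteq> f ` {..<2 * m - 1}"
    "(\<Sum>z\<leftarrow>xs. (cmod (a ?x z))\<^sup>2) = 2" "(\<Sum>z\<leftarrow>xs. (cmod (a ?y z))\<^sup>2) = 2"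
    "\<And>i. i \<le> 2 * m \<Longrightarrow> f i \<notin> set xs \<Longrightarrow> a ?x (f i) = 0"
    by (rule chain_previous[OF ch m]) blast
  have x: "?x < n" and y: "?y < n" using D(2) by simp_all
  have xy: "?x \<noteq> ?y" using inj_onD[OF D(1), of "2 * m - 1" "2 * m"] m by auto
  have xsn: "set xs \<subseteq> {..<n}" using xs(2) D(2) by fastforce
  have xsU: "set xs \<subseteq> ?U" using xs(2) by fastforce
  have ss: "s i * s i = 1" "cmod (s i) = 1" "s i * (s i * b) = b" "cnj (s i) = s i" for i b
    using D(3)[of i] by auto
  have twin: "a ?y z = - (s (2 * m - 1) * s (2 * m) * a ?x z)" if "z < n" "z \<notin> ?U" for z
  proof -
    have "a ?y z = s (2 * m) * (s (2 * m) * a ?y z)" by (simp add: ss)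
    also have "\<dots> = s (2 * m) * (- (s (2 * m - 1) * a ?x z))" unfolding D(7)[OF that] ..
    finally show ?thesis by (simp add: mult_ac)
  qed
  then have twin_norm: "cmod (a ?y z) = cmod (a ?x z)" if "z < n" "z \<notin> ?U" for z
    using that by (simp add: norm_mult ss)
  have outside: "z \<notin> ?U" if "z < n" "z \<notin> set xs" "a ?x z \<noteq> 0" for z
    using that xs(5) by auto
  have W: "row_weight n a ?x = 4" by (rule chain_saturated[OF ch m])
  from remaining_weight_2[OF x W xs(1) xsn xs(3)]
  show ?case
  proof (elim disjE exE conjE)
    fix w assume w: "w < n" "w \<notin> set xs" "(cmod (a ?x w))\<^sup>2 = 2"
    have wU: "w \<notin> ?U" using outside w by force
    have wy: "(cmod (a ?y w))\<^sup>2 = 2" using twin_norm[OF w(1) wU] w(3) by simp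
    have zx: "a ?x z = 0" if "z < n" "z \<notin> ?U" "z \<noteq> w" for z
      by (rule full_row(1)[of ?x "w # xs"]) (use that w x xs xsn xsU in auto)
    have zy: "a ?y z = 0" if "z < n" "z \<notin> ?U" "z \<noteq> w" for z
      using zx[OF that] twin[OF that(1,2)] by simp
    have wx': "(cmod (a w ?x))\<^sup>2 = 2" "(cmod (a w ?y))\<^sup>2 = 2"
      using norm_sym[OF x w(1)] norm_sym[OF y w(1)] w wy by auto
    \<comment> \<open>The two heavy edges back to the last column fill row \<open>w\<close>, so
      nothing lies beyond it.\<close>
    have zw: "a w z = 0" if "z < n" "z \<noteq> ?x" "z \<noteq> ?y" for z
      by (rule full_row(1)[of w "[?x, ?y]"]) (use that w x y xy wx' in auto)
    have "insert w ?U = {..<n}"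
    proof (rule conn)
      show "insert w ?U \<subseteq> {..<n}" using w D(2) by auto
      show "closed_under n a (insert w ?U)"
        unfolding closed_under_def
      proof (intro ballI allI impI, rule ccontr)
        fix i z assume i: "i \<in> insert w ?U" and z: "z < n" "a i z \<noteq> 0" "z \<notin> insert w ?U"
        have "z \<noteq> ?x" "z \<noteq> ?y" using z(3) by auto
        then have "i \<noteq> w" using zw[OF z(1)] z(2) by auto
        then obtain l where l: "i = f l" "l \<le> 2 * m" using i by auto
        then have "l < 2 * m - 1 \<or> l = 2 * m - 1 \<or> l = 2 * m" by linarith
        then show False using l z D(6)[of l z] zx[of z] zy[of z] by auto
      qed
    qed simp
    define F where "F = f(2 * m + 1 := w)"
    have Ff: "F i = f i" if "i \<le> 2 * m" for i using that by (simp add: F_def)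
    have set2: "{..2 * m + 1} = insert (2 * m + 1) {..2 * m}" by auto
    have Fim: "F ` {..2 * m} = ?U" by (rule image_cong) (simp_all add: Ff)
    have "inj_on F {..2 * m}" using D(1) by (subst inj_on_cong[of _ _ f]) (simp_all add: Ff)
    then have Fi: "inj_on F {..2 * m + 1}"
      unfolding set2 using wU Fim by (simp add: inj_on_insert) (simp add: F_def)
    have FV: "F ` {..2 * m + 1} = {..<n}"
      unfolding set2 using \<open>insert w ?U = {..<n}\<close> Fim by (simp) (simp add: F_def)
    have key: "equiv_entries n a (graph_mat (2 * (m + 1)) (\<lambda>_. 0) (ladder_edges m @
       [((1, 2 * m + 1), \<omega>), ((m + 1, 2 * m + 1), \<omega>), ((m, 2 * m + 2), \<theta>), ((2 * m, 2 * m + 2), - \<theta>)]))"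
      if th: "a ?x w = \<theta> \<or> a ?x w = - \<theta>" "\<theta> \<noteq> 0" for \<theta>
    proof -
      obtain e where e: "e \<in> {1, -1}" "a ?x w = e * \<theta>" using th(1) by (metis insertI1 insertI2 mult_1 mult_minus1)
      define S where "S = s(2 * m + 1 := s (2 * m - 1) * e)"
      have Sf: "S i = s i" if "i \<le> 2 * m" for i using that by (simp add: S_def)
      show ?thesis
      proof (rule chain_T4[OF m Fi FV, of S])
        show "S i \<in> {1, -1}" for i using D(3)[of i] D(3)[of "2 * m - 1"] e(1) by (auto simp: S_def)
        show "a (F i) (F j) = S i * S j * chain_entry i j" if "i \<le> 2 * m" "j \<le> 2 * m" for i j
          using D(4)[OF that] that by (simp add: Ff Sf)
        have 1: "S (2 * m - 1) = s (2 * m - 1)" "S (2 * m) = s (2 * m)" "S (2 * m + 1) = s (2 * m - 1) * e"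
          "F (2 * m - 1) = ?x" "F (2 * m) = ?y" "F (2 * m + 1) = w"
          using Ff[of "2 * m - 1"] Sf[of "2 * m - 1"] Ff[of "2 * m"] Sf[of "2 * m"]
          by (simp_all, simp_all add: S_def F_def)
        show "a (F (2 * m - 1)) (F (2 * m + 1)) = S (2 * m - 1) * S (2 * m + 1) * \<theta>"
          unfolding 1 e(2) using ss(1)[of "2 * m - 1"] by (simp flip: mult.assoc)
        show "a (F (2 * m)) (F (2 * m + 1)) = - (S (2 * m) * S (2 * m + 1) * \<theta>)"
          unfolding 1 twin[OF w(1) wU] e(2) by (simp add: mult_ac)
        show "a (F i) (F (2 * m + 1)) = 0" if "i < 2 * m - 1" for i
          unfolding 1 using D(6)[OF that w(1) wU] that by (simp add: Ff)
        show "a (F (2 * m + 1)) (F (2 * m + 1)) = 0"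
        proof -
          have "w \<noteq> ?x" "w \<noteq> ?y" using wU by auto
          then show ?thesis unfolding 1 using zw[OF w(1)] by simp
        qed
      qed (rule th)
    qed
    have T: "equiv_entries n a (T4 (m + 1))" if "a ?x w = \<omega> \<or> a ?x w = - \<omega>"
      using key[OF that] by (simp add: T4_def Let_def)
    have T': "equiv_entries n a (T4' (m + 1))" if "a ?x w = cnj \<omega> \<or> a ?x w = - cnj \<omega>"
      using key[OF that] by (simp add: T4'_def Let_def)
    have "a ?x w \<in> {\<omega>, -\<omega>, cnj \<omega>, - cnj \<omega>}" using Zomega_norm_2 entry x w by blast
    moreover have "m + 1 \<ge> 2" using m by simp
    ultimately show ?thesis using T T' by blast
  next
    fix w1 w2
    assume w: "w1 < n" "w2 < n" "w1 \<noteq> w2" "w1 \<notin> set xs" "w2 \<notin> set xs"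
      "(cmod (a ?x w1))\<^sup>2 = 1" "(cmod (a ?x w2))\<^sup>2 = 1"
    have wU: "w1 \<notin> ?U" "w2 \<notin> ?U" using outside[OF w(1,4)] outside[OF w(2,5)] w(6,7) by force+
    have e: "a ?x w1 \<in> {1, -1}" "a ?x w2 \<in> {1, -1}" using Zomega_norm_1 entry x w by blast+
    let ?e = "a ?x w1" and ?e' = "a ?x w2"
    have ee: "?e * ?e = 1" "?e' * ?e' = 1" using e by auto
    note full = full_row[of ?x "w1 # w2 # xs"]
    have fprem: "distinct (w1 # w2 # xs)" "set (w1 # w2 # xs) \<subseteq> {..<n}"
      "4 \<le> (\<Sum>z\<leftarrow>w1 # w2 # xs. (cmod (a ?x z))\<^sup>2)"
      using w xs xsn by auto
    have zx: "a ?x z = 0" if "z < n" "z \<notin> ?U" "z \<noteq> w1" "z \<noteq> w2" for z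
      by (rule full(1)[OF x fprem]) (use that xsU in auto)
    have zy: "a ?y z = 0" if "z < n" "z \<notin> ?U" "z \<noteq> w1" "z \<noteq> w2" for z
      using zx[OF that] twin[OF that(1,2)] by simp
    \<comment> \<open>The vertices in \<open>xs\<close> have no edges outside the chain, so
      orthogonality of row \<open>?x\<close> to an outside column involves only \<open>w1\<close>
      and \<open>w2\<close>. It makes their rows opposite there and gives them a common charge
      \<open>c\<close>.\<close>
    have ox: "?e * a w1 z + ?e' * a w2 z = 0" if z: "z < n" "z \<notin> ?U" for z
    proof -
      have "a v z = 0" if "v \<in> set xs" for v using that xs(2) D(6)[OF _ z] by auto
      then have "map (\<lambda>v. a ?x v * a v z) xs = map (\<lambda>_. 0) xs" by (intro map_cong) auto
      then have "(\<Sum>v\<leftarrow>xs. a ?x v * a v z) = 0" by (simp only: sum_list_0)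
      moreover have "z \<noteq> ?x" using z(2) by auto
      ultimately show ?thesis using full(2)[OF x fprem z(1)] by (simp add: add.assoc)
    qed
    define c where "c = a w1 w1"
    have c: "c \<in> {0, 1, -1}" unfolding c_def by (rule diag[OF w(1)])
    have w21: "a w2 w1 = - (?e * ?e' * c)"
    proof -
      have "?e' * a w2 w1 = - (?e * c)"
        using ox[OF w(1) wU(1)] unfolding c_def by (simp add: eq_neg_iff_add_eq_0 add.commute)
      moreover have "a w2 w1 = ?e' * (?e' * a w2 w1)" using ee(2) by (simp flip: mult.assoc)
      ultimately show ?thesis by (simp add: mult_ac)
    qed
    have w12: "a w1 w2 = - (?e * ?e' * c)"
      using herm[OF w(2,1)] w21 e c by auto
    have c2: "a w2 w2 = c"
    proof -
      have "?e' * a w2 w2 = - (?e * a w1 w2)"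
        using ox[OF w(2) wU(2)] by (simp add: eq_neg_iff_add_eq_0 add.commute)
      then show ?thesis using e unfolding w12 by auto
    qed
    define F where "F = f(2 * m + 1 := w1, 2 * m + 2 := w2)"
    define S where "S = s(2 * m + 1 := s (2 * m - 1) * ?e, 2 * m + 2 := s (2 * m - 1) * ?e')"
    have Ff: "F i = f i" if "i \<le> 2 * m" for i using that by (simp add: F_def)
    have Sf: "S i = s i" if "i \<le> 2 * m" for i using that by (simp add: S_def)
    have F12: "F (2 * m + 1) = w1" "F (2 * m + 2) = w2" by (simp_all add: F_def)
    have S12: "S (2 * m + 1) = s (2 * m - 1) * ?e" "S (2 * m + 2) = s (2 * m - 1) * ?e'" by (simp_all add: S_def)
    have S: "S i \<in> {1, -1}" for i
      using D(3)[of i] D(3)[of "2 * m - 1"] e by (auto simp: S_def)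
    have set2: "{..2 * (m + 1)} = insert (2 * m + 2) (insert (2 * m + 1) {..2 * m})" by auto
    have Fim: "F ` {..2 * m} = ?U" by (rule image_cong) (simp_all add: Ff)
    have "inj_on F {..2 * m}" using D(1) by (subst inj_on_cong[of _ _ f]) (simp_all add: Ff)
    then have Fi: "inj_on F {..2 * (m + 1)}"
      unfolding set2 inj_on_insert using wU w(3) Fim F12 by auto
    have FV: "F ` {..2 * (m + 1)} = insert w2 (insert w1 ?U)"
      unfolding set2 using Fim F12 by simp
    have Fn: "F i < n" if "i \<le> 2 * (m + 1)" for i
    proof -
      have "F i \<in> insert w2 (insert w1 ?U)" using that FV by blast
      then show ?thesis using w D(2) by auto
    qed
    have entries: "a (F i) (F j) = S i * S j * chain_entry_charged (m + 1) c i j"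
      if ij: "i \<le> j" "j \<le> 2 * (m + 1)" for i j
    proof -
      have col: "chain_column i = m + 1 \<longleftrightarrow> i = 2 * m + 1 \<or> i = 2 * m + 2" for i
        unfolding chain_column_def by presburger
      have "j \<le> 2 * m \<or> j > 2 * m \<and> (i < 2 * m - 1 \<or> i = 2 * m - 1 \<or> i = 2 * m) \<or>
          i = 2 * m + 1 \<and> j = 2 * m + 1 \<or> i = 2 * m + 1 \<and> j = 2 * m + 2 \<or> i = 2 * m + 2 \<and> j = 2 * m + 2"
        using ij by presburger
      then consider "j \<le> 2 * m" | "j > 2 * m" "i < 2 * m - 1" | "j > 2 * m" "i = 2 * m - 1" | "j > 2 * m" "i = 2 * m" |
        "i = 2 * m + 1" "j = 2 * m + 1" | "i = 2 * m + 1" "j = 2 * m + 2" | "i = 2 * m + 2" "j = 2 * m + 2"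
        by blast
      then show ?thesis
      proof cases
        case 1
        then have "chain_column j \<noteq> m + 1" using col[of j] by simp
        then show ?thesis using 1 ij D(4)[of i j] by (simp add: Ff Sf chain_entry_charged_def)
      next
        case 2
        then have j: "j = 2 * m + 1 \<or> j = 2 * m + 2" using ij by auto
        have "chain_column i < m" using 2 by (simp add: chain_column_def)
        then have "chain_entry_charged (m + 1) c i j = 0"
          using j col[of j] by (auto simp: chain_entry_charged_def chain_entry_def)
        moreover have "a (F i) (F j) = 0"
          using 2 j D(6)[OF 2(2) w(1) wU(1)] D(6)[OF 2(2) w(2) wU(2)] F12 by (auto simp: Ff)
        ultimately show ?thesis by simp
      next
        case 3
        then have j: "j = 2 * m + 1 \<or> j = 2 * m + 2" using ij by auto
        have "chain_column i = m" "odd i" "i \<noteq> 0" using 3 m by (auto simp: chain_column_def)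
        then have "chain_entry_charged (m + 1) c i j = 1"
          using j col[of j] by (auto simp: chain_entry_charged_def chain_entry_def)
        then show ?thesis using 3 j F12 S12 ss by (auto simp: Ff Sf)
      next
        case 4
        then have j: "j = 2 * m + 1 \<or> j = 2 * m + 2" using ij by auto
        have "chain_column i = m" "even i" "i \<noteq> 0" using 4 m by (auto simp: chain_column_def)
        then have "chain_entry_charged (m + 1) c i j = -1"
          using j col[of j] by (auto simp: chain_entry_charged_def chain_entry_def)
        then show ?thesis using 4 j F12 S12 twin[OF w(1) wU(1)] twin[OF w(2) wU(2)]
          by (auto simp: Ff Sf mult_ac)
      next
        case 5
        then show ?thesis using S[of "2 * m + 1"] F12 col[of i] by (auto simp: chain_entry_charged_def c_def)
      next
        case 6
        have "a w1 w2 = - (S i * S j * c)"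
          unfolding w12 using 6 S12 ss(1)[of "2 * m - 1"] by (simp add: mult_ac ss)
        then show ?thesis using 6 F12 col[of i] col[of j] by (simp add: chain_entry_charged_def)
      next
        case 7
        then show ?thesis using S[of "2 * m + 2"] F12 c2 col[of i] by (auto simp: chain_entry_charged_def)
      qed
    qed
    have sym: "cnj (chain_entry_charged (m + 1) c i j) = chain_entry_charged (m + 1) c j i" for i j
      using c by (auto simp: chain_entry_charged_def chain_entry_cnj)
    have all: "a (F i) (F j) = S i * S j * chain_entry_charged (m + 1) c i j"
      if "i \<le> 2 * (m + 1)" "j \<le> 2 * (m + 1)" for i j
      by (rule symmetric_entries[OF S Fn sym entries that])
    show ?thesis
    proof (cases "c = 0")
      case True
      have "chain_entry_charged (m + 1) 0 i j = chain_entry i j" for i j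
        by (simp add: chain_entry_charged_def chain_entry_def)
      then have all0: "a (F i) (F j) = S i * S j * chain_entry i j"
        if "i \<le> 2 * (m + 1)" "j \<le> 2 * (m + 1)" for i j using all[OF that] True by simp
      have Wy: "row_weight n a ?y = 4"
        by (rule full_row(3)[of ?y "w1 # w2 # xs"])
          (use y w xs xsn twin_norm[OF w(1) wU(1)] twin_norm[OF w(2) wU(2)] in auto)
      have "chain (m + 1) F S"
        unfolding chain_def
      proof (intro conjI allI impI)
        show "inj_on F {..2 * (m + 1)}" by (rule Fi)
        show "F ` {..2 * (m + 1)} \<subseteq> {..<n}" using Fn by auto
        show "S i \<in> {1, -1}" for i by (rule S)
        show "a (F i) (F j) = S i * S j * chain_entry i j" if "i \<le> 2 * (m + 1)" "j \<le> 2 * (m + 1)" for i j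
          by (rule all0[OF that])
        show "row_weight n a (F i) = 4" if "i < 2 * (m + 1) - 1" for i
        proof -
          have "i < 2 * m - 1 \<or> i = 2 * m - 1 \<or> i = 2 * m" using that by presburger
          then show ?thesis using D(5)[of i] W Wy by (auto simp: Ff)
        qed
        show "a (F i) z = 0" if "i < 2 * (m + 1) - 1" "z < n" "z \<notin> F ` {..2 * (m + 1)}" for i z
        proof -
          have z: "z \<notin> ?U" "z \<noteq> w1" "z \<noteq> w2" using that(3) unfolding FV by auto
          have "i < 2 * m - 1 \<or> i = 2 * m - 1 \<or> i = 2 * m" using that(1) by presburger
          then show ?thesis using D(6)[of i z] zx[of z] zy[of z] z that by (auto simp: Ff)
        qed
        show "S (2 * (m + 1)) * a (F (2 * (m + 1))) z = - (S (2 * (m + 1) - 1) * a (F (2 * (m + 1) - 1)) z)"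
          if "z < n" "z \<notin> F ` {..2 * (m + 1)}" for z
        proof -
          have z: "z \<notin> ?U" using that(2) unfolding FV by auto
          have "?e' * a w2 z = - (?e * a w1 z)"
            using ox[OF that(1) z] by (simp add: eq_neg_iff_add_eq_0 add.commute)
          then have "s (2 * m - 1) * (?e' * a w2 z) = - (s (2 * m - 1) * (?e * a w1 z))" by simp
          then show ?thesis using F12 S12 by (simp add: mult.assoc)
        qed
      qed
      moreover have "n - (m + 1) < n - m"
      proof -
        \<comment> \<open>The injection \<open>f\<close> embeds \<open>2 * m + 1\<close> indices
          into \<open>n\<close> vertices, so \<open>m < n\<close> and the measure drops.\<close>
        have "card {..2 * m} \<le> card {..<n}"
          using card_inj_on_le[OF D(1), of "{..<n}"] D(2) by auto
        then show ?thesis using m by simp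
      qed
      ultimately show ?thesis using less.hyps[of "m + 1" F S] by simp
    next
      case False
      then have c1: "c \<in> {1, -1}" using c by auto
      have n1: "cmod c = 1" using c1 by auto
      have bk: "cmod (a w1 ?x) = 1" "cmod (a w1 ?y) = 1" "cmod (a w2 ?x) = 1" "cmod (a w2 ?y) = 1"
        using norm_sym[OF x w(1)] norm_sym[OF x w(2)] norm_sym[OF y w(1)] norm_sym[OF y w(2)]
          twin_norm[OF w(1) wU(1)] twin_norm[OF w(2) wU(2)] e by auto
      have n12: "cmod (a w1 w2) = 1" "cmod (a w2 w1) = 1" using w12 w21 e c1 by auto
      have ne: "w1 \<noteq> ?x" "w1 \<noteq> ?y" "w2 \<noteq> ?x" "w2 \<noteq> ?y" using wU by auto
      \<comment> \<open>In a charged column each row is full: two edges back, the edge inside the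
        column and the charge.\<close>
      have z1: "a w1 z = 0" if "z < n" "z \<notin> {?x, ?y, w1, w2}" for z
        by (rule full_row(1)[of w1 "[?x, ?y, w1, w2]"])
          (use that x y xy w(1-3) ne bk n12 n1 c_def[symmetric] in auto)
      have z2: "a w2 z = 0" if "z < n" "z \<notin> {?x, ?y, w1, w2}" for z
        by (rule full_row(1)[of w2 "[?x, ?y, w1, w2]"])
          (use that x y xy w(1-3) ne bk n12 n1 c2 in auto)
      have "insert w2 (insert w1 ?U) = {..<n}"
      proof (rule conn)
        show "insert w2 (insert w1 ?U) \<subseteq> {..<n}" using w D(2) by auto
        show "closed_under n a (insert w2 (insert w1 ?U))"
          unfolding closed_under_def
        proof (intro ballI allI impI, rule ccontr)
          fix i z assume i: "i \<in> insert w2 (insert w1 ?U)"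
            and z: "z < n" "a i z \<noteq> 0" "z \<notin> insert w2 (insert w1 ?U)"
          have "z \<notin> {?x, ?y, w1, w2}" using z(3) by auto
          then have "i \<noteq> w1" "i \<noteq> w2" using z1[OF z(1)] z2[OF z(1)] z by auto
          then obtain l where l: "i = f l" "l \<le> 2 * m" using i by auto
          then have "l < 2 * m - 1 \<or> l = 2 * m - 1 \<or> l = 2 * m" by linarith
          then show False using l z D(6)[of l z] zx[of z] zy[of z] by auto
        qed
      qed simp
      then have "equiv_entries n a (C2_plus (m + 1))"
        using FV by (intro chain_C2[OF _ Fi _ S c1 all]) auto
      then show ?thesis by (intro disjI2 exI[of _ "m + 1"]) simp
    qed
  qed
qed

end

section \<open>Vertices with two edges of weight 2\<close>

context tight
begin

text \<open>The common prime \<open>cnj \<omega>\<close> cancels from the orthogonality relations of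
  row \<open>u\<close>, which leaves \<open>v\<close> and \<open>v'\<close> opposite away from
  \<open>u\<close>. They are the first column of a chain with end vertex \<open>u\<close>, or, if
  charged, complete \<open>C2_plus 1\<close>.\<close>

lemma equal_heavy_edges:
  assumes u: "u < n" and v: "v < n" "v' < n" "v \<noteq> v'"
    and w: "a u v \<in> {cnj \<omega>, - cnj \<omega>}" "a u v' \<in> {cnj \<omega>, - cnj \<omega>}"
  shows "(\<exists>k\<ge>2. equiv_entries n a (T4 k)) \<or> (\<exists>k\<ge>2. equiv_entries n a (T4' k)) \<or>
    (\<exists>k\<ge>1. equiv_entries n a (C2_plus k))"
proof -
  obtain e where e: "e \<in> {1, -1}" "a u v = e * cnj \<omega>" using w(1) by force
  obtain e' where e': "e' \<in> {1, -1}" "a u v' = e' * cnj \<omega>" using w(2) by force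
  have ee: "e * e = 1" "e' * e' = 1" "cmod e = 1" "cmod e' = 1" "cnj e = e" "cnj e' = e'" using e e' by auto
  have nw: "(cmod (a u v))\<^sup>2 = 2" "(cmod (a u v'))\<^sup>2 = 2" using e e' by (auto simp: norm_mult)
  have ne: "u \<noteq> v" "u \<noteq> v'" using heavy_ne u v nw by blast+
  have full: "distinct [v, v']" "set [v, v'] \<subseteq> {..<n}" "4 \<le> (\<Sum>z\<leftarrow>[v, v']. (cmod (a u z))\<^sup>2)"
    using v nw by auto
  note fu = full_row[OF u full]
  have zu: "a u z = 0" if "z < n" "z \<noteq> v" "z \<noteq> v'" for z
    using fu(1) that by simp
  have ou: "e * a v k + e' * a v' k = 0" if "k < n" "k \<noteq> u" for k
  proof -
    have "cnj \<omega> * (e * a v k + e' * a v' k) = 0"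
      using fu(2)[OF that] by (simp add: e e' algebra_simps)
    then show ?thesis by simp
  qed
  define c where "c = a v v"
  have c: "c \<in> {0, 1, -1}" unfolding c_def by (rule diag[OF v(1)])
  have vv: "a v' k = - (e * e' * a v k)" if "k < n" "k \<noteq> u" for k
  proof -
    have "e' * a v' k = - (e * a v k)"
      using ou[OF that] by (simp add: eq_neg_iff_add_eq_0 add.commute)
    moreover have "a v' k = e' * (e' * a v' k)" using ee(2) by (simp flip: mult.assoc)
    ultimately show ?thesis by (simp add: mult_ac)
  qed
  have v'v: "a v' v = - (e * e' * c)" using vv[of v] v ne by (simp add: c_def)
  have vv': "a v v' = - (e * e' * c)" using herm[OF v(2,1)] v'v c ee by auto
  have c': "a v' v' = c" using vv[of v'] v ne vv' e e' by auto
  have bk: "(cmod (a v u))\<^sup>2 = 2" "(cmod (a v' u))\<^sup>2 = 2" using norm_sym nw u v by auto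
  define F where "F = (\<lambda>i::nat. if i = 0 then u else if i = 1 then v else v')"
  define S where "S = (\<lambda>i::nat. if i = 0 then 1 else if i = 1 then e else e')"
  have S: "S i \<in> {1, -1}" for i using e e' by (auto simp: S_def)
  have le2: "i = 0 \<or> i = 1 \<or> i = 2" if "i \<le> 2" for i :: nat using that by auto
  have FV: "F ` {..2} = {u, v, v'}"
  proof -
    have "{..2::nat} = {0, 1, 2}" by auto
    then show ?thesis by (auto simp: F_def)
  qed
  have Fn: "F i < n" for i using u v by (simp add: F_def)
  have Fi: "inj_on F {..2}"
    using ne v by (intro inj_onI) (auto simp: F_def split: if_splits)
  have entries: "a (F i) (F j) = S i * S j * chain_entry_charged 1 c i j" if "i \<le> j" "j \<le> 2" for i j
  proof -
    have "(i = 0 \<and> j = 0) \<or> (i = 0 \<and> j = 1) \<or> (i = 0 \<and> j = 2) \<or> (i = 1 \<and> j = 1) \<or> (i = 1 \<and> j = 2) \<or> (i = 2 \<and> j = 2)"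
      using that by auto
    moreover have "chain_entry_charged 1 c 0 0 = 0" "chain_entry_charged 1 c 0 1 = cnj \<omega>"
      "chain_entry_charged 1 c 0 2 = cnj \<omega>" "chain_entry_charged 1 c 1 1 = c"
      "chain_entry_charged 1 c 1 2 = - c" "chain_entry_charged 1 c 2 2 = c"
      by (simp_all add: chain_entry_charged_def chain_entry_def chain_column_def)
    moreover have "F 0 = u" "F 1 = v" "F 2 = v'" "S 0 = 1" "S 1 = e" "S 2 = e'" by (simp_all add: F_def S_def)
    moreover have "a v v = c" by (simp add: c_def)
    ultimately show ?thesis
      by (elim disjE conjE) (simp_all add: e(2) e'(2) zu[OF u ne] vv' c' ee(1,2))
  qed
  have sym: "cnj (chain_entry_charged 1 c i j) = chain_entry_charged 1 c j i" for i j
    using c by (auto simp: chain_entry_charged_def chain_entry_cnj)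
  have all: "a (F i) (F j) = S i * S j * chain_entry_charged 1 c i j" if "i \<le> 2" "j \<le> 2" for i j
    by (rule symmetric_entries[OF S Fn sym entries that])
  show ?thesis
  proof (cases "c = 0")
    case True
    have c0: "chain_entry_charged 1 0 i j = chain_entry i j" for i j
      by (auto simp: chain_entry_charged_def chain_entry_def)
    have "chain 1 F S"
      unfolding chain_def
    proof (intro conjI allI impI)
      show "inj_on F {..2 * 1}" using Fi by simp
      show "F ` {..2 * 1} \<subseteq> {..<n}" using Fn by auto
      show "S i \<in> {1, -1}" for i by (rule S)
      show "a (F i) (F j) = S i * S j * chain_entry i j" if "i \<le> 2 * 1" "j \<le> 2 * 1" for i j
        using all[of i j] that True c0 by simp
      show "row_weight n a (F i) = 4" if "i < 2 * 1 - 1" for i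
        using that fu(3) by (simp add: F_def)
      show "a (F i) z = 0" if "i < 2 * 1 - 1" "z < n" "z \<notin> F ` {..2 * 1}" for i z
      proof -
        have "z \<noteq> v" "z \<noteq> v'" using that(3) FV by auto
        then have "a u z = 0" using zu that(2) by blast
        moreover have "F i = u" using that(1) by (simp add: F_def)
        ultimately show ?thesis by simp
      qed
      show "S (2 * 1) * a (F (2 * 1)) z = - (S (2 * 1 - 1) * a (F (2 * 1 - 1)) z)"
        if "z < n" "z \<notin> F ` {..2 * 1}" for z
      proof -
        have "z \<noteq> u" using that(2) FV by auto
        then have "e' * a v' z = - (e * a v z)"
          using ou[of z] that(1) by (simp add: eq_neg_iff_add_eq_0 add.commute)
        then show ?thesis by (simp add: F_def S_def)
      qed
    qed
    then show ?thesis by (rule chain_classification) simp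
  next
    case False
    then have c1: "c \<in> {1, -1}" "cmod c = 1" using c by auto
    have n1: "cmod (a v v) = 1" "cmod (a v' v') = 1" "cmod (a v v') = 1" "cmod (a v' v) = 1"
      using c1 c' v'v vv' ee by (simp_all add: c_def[symmetric] norm_mult)
    have zv: "a v z = 0" if "z < n" "z \<notin> {u, v, v'}" for z
      by (rule full_row(1)[of v "[u, v, v']"]) (use that u v ne bk n1 in auto)
    have zv': "a v' z = 0" if "z < n" "z \<notin> {u, v, v'}" for z
      by (rule full_row(1)[of v' "[u, v, v']"]) (use that u v ne bk n1 in auto)
    have V: "{..<n} = set [u, v, v']"
      by (rule all_vertices) (use u v zu zv zv' in auto)
    have "equiv_entries n a (C2_plus 1)"
    proof (rule chain_C2[OF _ _ _ S c1(1)])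
      show "inj_on F {..2 * 1}" using Fi by simp
      show "F ` {..2 * 1} = {..<n}" using FV V by simp
      show "a (F i) (F j) = S i * S j * chain_entry_charged 1 c i j" if "i \<le> 2 * 1" "j \<le> 2 * 1" for i j
        using all[of i j] that by simp
    qed simp
    then show ?thesis by blast
  qed
qed

text \<open>Two labels with different primes at \<open>u\<close> are avoided by moving to
  \<open>v\<close>, which turns out to have two heavy edges with the same prime, one back to
  \<open>u\<close> and one to \<open>z\<close>.\<close>

lemma conjugate_heavy_edges:
  assumes u: "u < n" and v: "v < n" "v' < n" "v \<noteq> v'"
    and w: "a u v \<in> {\<omega>, -\<omega>}" "a u v' \<in> {cnj \<omega>, - cnj \<omega>}"
  obtains z where "z < n" "z \<noteq> u" "a v u \<in> {cnj \<omega>, - cnj \<omega>}" "a v z \<in> {cnj \<omega>, - cnj \<omega>}"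
proof -
  have nw: "(cmod (a u v))\<^sup>2 = 2" "(cmod (a u v'))\<^sup>2 = 2" using w by auto
  have ne: "u \<noteq> v" "u \<noteq> v'" using heavy_ne u v nw by blast+
  have avu: "a v u \<in> {cnj \<omega>, - cnj \<omega>}" using herm[OF u v(1)] w(1) by auto
  have bk: "(cmod (a v u))\<^sup>2 = 2" using avu by auto
  have full: "distinct [v, v']" "set [v, v'] \<subseteq> {..<n}" "4 \<le> (\<Sum>z\<leftarrow>[v, v']. (cmod (a u z))\<^sup>2)"
    using v nw by auto
  have ou: "a u v * a v k + a u v' * a v' k = 0" if "k < n" "k \<noteq> u" for k
    using full_row(2)[OF u full that] by simp
  have nk: "cmod (a v' k) = cmod (a v k)" if "k < n" "k \<noteq> u" for k
  proof -
    have "a u v * a v k = - (a u v' * a v' k)" using ou[OF that] by (simp add: eq_neg_iff_add_eq_0)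
    then have "cmod (a u v) * cmod (a v k) = cmod (a u v') * cmod (a v' k)"
      by (metis norm_minus_cancel norm_mult)
    moreover have "cmod (a u v) = cmod \<omega>" "cmod (a u v') = cmod \<omega>" using w by auto
    ultimately show ?thesis by simp
  qed
  \<comment> \<open>A unit here would make the two labels at \<open>u\<close> equal up to sign, but
    \<open>\<omega>\<close> and \<open>cnj \<omega>\<close> are not associates.\<close>
  have unit: "(cmod (a v k))\<^sup>2 \<noteq> 1" if k: "k < n" "k \<noteq> u" for k
  proof
    assume 1: "(cmod (a v k))\<^sup>2 = 1"
    then have "a v k \<in> {1, -1}" "a v' k \<in> {1, -1}"
      using Zomega_norm_1[OF entry[OF v(1) k(1)]] Zomega_norm_1[OF entry[OF v(2) k(1)]] nk[OF k] by auto
    moreover have "a u v * a v k = - (a u v' * a v' k)"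
      using ou[OF k] by (simp add: eq_neg_iff_add_eq_0)
    ultimately have "a u v = a u v' \<or> a u v = - a u v'"
      by (auto simp: minus_equation_iff[of "a u v"])
    moreover have "\<omega> \<noteq> - cnj \<omega>" "- \<omega> \<noteq> cnj \<omega>" by (simp_all add: complex_eq_iff)
    ultimately show False using w by auto
  qed
  \<comment> \<open>A label \<open>\<omega>\<close> here would, by orthogonality to row
    \<open>u\<close>, make \<open>\<omega> * \<omega>\<close> a multiple of the other prime
    \<open>cnj \<omega>\<close>.\<close>
  have heavy: "a v z \<in> {cnj \<omega>, - cnj \<omega>}" if z: "z < n" "z \<noteq> u" "(cmod (a v z))\<^sup>2 = 2" for z
  proof (rule ccontr)
    assume "a v z \<notin> {cnj \<omega>, - cnj \<omega>}"
    then have "a v z \<in> {\<omega>, -\<omega>}" using Zomega_norm_2[OF entry[OF v(1) z(1)] z(3)] by auto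
    then have "a u v * a v z = \<omega> * \<omega> \<or> a u v * a v z = - (\<omega> * \<omega>)" using w(1) by auto
    moreover have "a u v * a v z = - (a u v' * a v' z)"
      using ou[OF z(1,2)] by (simp add: eq_neg_iff_add_eq_0)
    ultimately have "\<omega> * \<omega> = a u v' * a v' z \<or> \<omega> * \<omega> = - (a u v' * a v' z)" by auto
    moreover have "a v' z \<in> {\<omega>, -\<omega>, cnj \<omega>, - cnj \<omega>}"
      using Zomega_norm_2[OF entry[OF v(2) z(1)]] nk[OF z(1,2)] z(3) by simp
    ultimately have "\<omega> * \<omega> \<in> {2, -2, cnj \<omega> * cnj \<omega>, - (cnj \<omega> * cnj \<omega>)}"
      using w(2) by auto
    then show False by (auto simp: complex_eq_iff)
  qed
  from remaining_weight_2[OF v(1) heavy_saturated[OF v(1) u bk], of "[u]"]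
  obtain z where "z < n" "z \<noteq> u" "(cmod (a v z))\<^sup>2 = 2"
    using u bk unit by auto
  then show ?thesis using that heavy avu by blast
qed

text \<open>A pair with prime \<open>\<omega>\<close> becomes one with \<open>cnj \<omega>\<close>
  in the conjugate graph, and a mixed pair is treated from the neighbouring vertex.\<close>

lemma double_heavy_classification:
  assumes u: "u < n" and v: "v < n" "v' < n" "v \<noteq> v'"
    and w: "(cmod (a u v))\<^sup>2 = 2" "(cmod (a u v'))\<^sup>2 = 2"
  shows "(\<exists>k\<ge>2. equiv_entries n a (T4 k)) \<or> (\<exists>k\<ge>2. equiv_entries n a (T4' k)) \<or>
    (\<exists>k\<ge>1. equiv_entries n a (C2_plus k))"
proof -
  have x: "a u v \<in> {\<omega>, -\<omega>, cnj \<omega>, - cnj \<omega>}" "a u v' \<in> {\<omega>, -\<omega>, cnj \<omega>, - cnj \<omega>}"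
    using Zomega_norm_2 entry u v w by blast+
  have mixed: ?thesis if h: "u < n" "v < n" "v' < n" "v \<noteq> v'" "a u v \<in> {\<omega>, -\<omega>}" "a u v' \<in> {cnj \<omega>, - cnj \<omega>}" for u v v'
  proof -
    obtain z where "z < n" "z \<noteq> u" "a v u \<in> {cnj \<omega>, - cnj \<omega>}" "a v z \<in> {cnj \<omega>, - cnj \<omega>}"
      using conjugate_heavy_edges[OF h] by blast
    then show ?thesis using equal_heavy_edges[of v u z] h by auto
  qed
  consider "a u v \<in> {cnj \<omega>, - cnj \<omega>}" "a u v' \<in> {cnj \<omega>, - cnj \<omega>}" |
    "a u v \<in> {\<omega>, -\<omega>}" "a u v' \<in> {\<omega>, -\<omega>}" |
    "a u v \<in> {\<omega>, -\<omega>}" "a u v' \<in> {cnj \<omega>, - cnj \<omega>}" |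
    "a u v' \<in> {\<omega>, -\<omega>}" "a u v \<in> {cnj \<omega>, - cnj \<omega>}" using x by blast
  then show ?thesis
  proof cases
    case 1
    then show ?thesis by (rule equal_heavy_edges[OF u v])
  next
    case 2
    interpret b: tight n "\<lambda>i j. cnj (a i j)" by (rule tight_cnj)
    have "cnj (a u v) \<in> {cnj \<omega>, - cnj \<omega>}" "cnj (a u v') \<in> {cnj \<omega>, - cnj \<omega>}" using 2 by auto
    from b.equal_heavy_edges[OF u v this] show ?thesis using equiv_entries_cnj by blast
  next
    case 3
    then show ?thesis by (rule mixed[OF u v])
  next
    case 4
    then show ?thesis using mixed[OF u v(2,1)] v(3) by auto
  qed
qed

end

theorem theorem5:
  fixes A :: "complex mat"
  assumes "maximal_cyclotomic (-7) A"
    and "\<not> (\<exists>B. charged_signed_graph (-7) B \<and> equivalent_mat A B)"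
  shows "equivalent_mat A S2 \<or> equivalent_mat A S2_star \<or>
    equivalent_mat A S4 \<or>
    equivalent_mat A S6_dagger \<or>
    equivalent_mat A S8_star \<or>
    (\<exists>k\<ge>2. equivalent_mat A (T4 k)) \<or>
    (\<exists>k\<ge>2. equivalent_mat A (T4' k)) \<or>
    (\<exists>k\<ge>1. equivalent_mat A (C2_plus k))"
proof -
  define n where "n = dim_row A"
  define a where "a = (\<lambda>i j. A $$ (i, j))"
  interpret tight n a unfolding a_def by (rule maximal_tight[OF assms(1) n_def])
  have L: "L_graph (-7) A" using assms(1) unfolding maximal_cyclotomic_def by blast
  then have A: "A \<in> carrier_mat n n" unfolding L_graph_def n_def by auto
  have eq: "equivalent_mat A B" if "equiv_entries n a B" for B
    using equiv_entries_equivalent_mat[OF A] that unfolding a_def by blast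
  \<comment> \<open>\<open>A\<close> is equivalent to itself, so it is not a charged signed graph
    and has an entry outside \<open>{0, 1, -1}\<close>.\<close>
  have "equiv_entries n a A"
    unfolding equiv_entries_def
    by (intro conjI A exI[of _ "\<lambda>x. x"] exI[of _ "\<lambda>_. 1"]) (auto simp: a_def bij_betw_def)
  then have "\<not> charged_signed_graph (-7) A" using assms(2) eq by blast
  then have "\<not> elements_mat A \<subseteq> {0, 1, -1}" using L unfolding charged_signed_graph_def by blast
  then obtain i j where ij: "i < n" "j < n" "a i j \<notin> {0, 1, -1}"
  proof -
    from \<open>\<not> elements_mat A \<subseteq> {0, 1, -1}\<close> obtain y where y: "y \<in> elements_mat A" "y \<notin> {0, 1, -1}"
      by blast
    then show ?thesis using that A elements_matD[OF y(1)] by (auto simp: a_def)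
  qed
  have "row_weight n a i \<ge> (cmod (a i j))\<^sup>2"
    unfolding row_weight_def using ij by (intro member_le_sum) auto
  then have le: "(cmod (a i j))\<^sup>2 \<le> 4" using weight_le[OF ij(1)] by linarith
  have neq: "i \<noteq> j" using diag ij by blast
  \<comment> \<open>The norms 0 and 1 occur only at the excluded entries and 3 is not a norm, which
    leaves 4 and 2.\<close>
  have "(cmod (- 1 - \<omega>))\<^sup>2 = 4" "(cmod (- 1 - cnj \<omega>))\<^sup>2 = 4"
    unfolding cmod_power2 by (simp_all add: power2_eq_square)
  then consider "(cmod (a i j))\<^sup>2 = 4" | "(cmod (a i j))\<^sup>2 = 2"
    using Zomega_norm_cases[OF entry[OF ij(1,2)] le] ij(3) cmod2_one_add_omega by auto
  then show ?thesis
  proof cases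
    case 1
    then show ?thesis using weight_4_edge[OF ij(1,2) neq] eq by blast
  next
    case 2
    show ?thesis
    proof (cases "\<exists>u v v'. u < n \<and> v < n \<and> v' < n \<and> v \<noteq> v' \<and> (cmod (a u v))\<^sup>2 = 2 \<and> (cmod (a u v'))\<^sup>2 = 2")
      case True
      then show ?thesis using double_heavy_classification eq by blast
    next
      case False
      then show ?thesis using single_heavy_classification[OF _ ij(1,2) 2] eq by blast
    qed
  qed
qed

end
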